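(* Let $n\ge 2$ and let $(\mathbb G,\lVert\cdot\rVert_{\mathrm{sf}})$ be a sub-Finsler free-Carnot group of step $2$ and rank $n$, and let $d_{\mathrm{cc}}$ be its Carnot–Carathéodory distance. Then the unit sphere $$\mathbb S_{\mathrm{cc}}:=\{g\in\mathbb G : d_{\mathrm{cc}}(g,0_{\mathbb G})=1\}$$ is Euclidean $(d-1)$-rectifiable, where $d=n+\binom n2$ is the topological dimension of $\mathbb G$ and $0_{\mathbb G}$ is its identity element.
   Context: Model of the group: $\mathbb G=\mathbb R^n\times\bigwedge^2(\mathbb R^n)$, where $\bigwedge^2(\mathbb R^n)$ is the span of the tensors $v\wedge w:=v\otimes w-w\otimes v$, with product $(x_1,Y_1)*(x_2,Y_2)=(x_1+x_2,\,Y_1+Y_2+\tfrac12 x_1\wedge x_2)$; its identity is $0_{\mathbb G}=(0,0)$. (Every free-Carnot group of step 2 and rank $n$ is isomorphic to this one.) A sub-Finsler structure is a norm $\lVert\cdot\rVert_{\mathrm{sf}}$ on $\mathbb R^n$ (the first layer), extended left-invariantly to the distribution spanned by left-translates of $\mathbb R^n$. For $u\in L^1([0,1],\mathbb R^n)$, the horizontal curve with control $u$ is $\gamma_u(t)=\int_0^t u(s)\,ds+\tfrac12\int_0^t\big(\int_0^s u(\tau)\,d\tau\big)\wedge u(s)\,ds$, and horizontal curves from a point $g$ are left translates $g*\gamma_u$; the length is $\ell(g*\gamma_u)=\int_0^1\lVert u(t)\rVert_{\mathrm{sf}}dt$. The Carnot–Carathéodory distance $d_{\mathrm{cc}}(g,h)$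 is the infimum of lengths of horizontal curves joining $g$ and $h$. A subset $S$ of a smooth $d$-manifold $M$ is Euclidean $k$-rectifiable if, for some (equivalently any, for bounded sets) Riemannian metric on $M$ with $k$-dimensional Hausdorff measure $\mathcal H^k$, one has $\mathcal H^k(S)<\infty$ and there are countably many measurable sets $E_j\subseteq\mathbb R^k$ and Lipschitz maps $f_j:E_j\to M$ with $\mathcal H^k(S\setminus\bigcup_j f_j(E_j))=0$. *)

theory Defs
  imports "HOL-Analysis.Analysis"
begin

section \<open>Hausdorff measure on a metric space (unnormalised; normalisation is
irrelevant for finiteness / nullity)\<close>

definition hausdorff_pre :: "real \<Rightarrow> real \<Rightarrow> 'a::metric_space set \<Rightarrow> ennreal" where
  "hausdorff_pre s \<delta> A =
     (INF C \<in> {C :: nat \<Rightarrow> 'a set. A \<subseteq> (\<Union>i. C i) \<and>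
                  (\<forall>i. bounded (C i) \<and> diameter (C i) \<le> \<delta>)}.
        (\<Sum>i. ennreal (diameter (C i) powr s)))"

definition hausdorff_measure :: "real \<Rightarrow> 'a::metric_space set \<Rightarrow> ennreal" where
  "hausdorff_measure s A = (SUP \<delta> \<in> {0<..}. hausdorff_pre s \<delta> A)"

definition euclid_rectifiable ::
    "'k::euclidean_space itself \<Rightarrow> 'a::metric_space set \<Rightarrow> 'a set \<Rightarrow> bool" where
  "euclid_rectifiable _ M S \<longleftrightarrow>
     hausdorff_measure (real DIM('k)) S < \<infinity> \<and>
     (\<exists>(E :: nat \<Rightarrow> 'k set) (f :: nat \<Rightarrow> 'k \<Rightarrow> 'a).
        (\<forall>j. E j \<in> sets lebesgue \<and> (\<exists>L. L-lipschitz_on (E j) (f j)) \<and> f j ` E j \<subseteq> M) \<and>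
        hausdorff_measure (real DIM('k)) (S - (\<Union>j. f j ` E j)) = 0)"

text \<open>Second layer: antisymmetric matrices; v \<and> w = v\<otimes>w - w\<otimes>v.\<close>

definition wedge :: "real^'n \<Rightarrow> real^'n \<Rightarrow> real^'n^'n" where
  "wedge v w = (\<chi> i j. v$i * w$j - w$i * v$j)"

definition G_carrier :: "((real^'n) \<times> (real^'n^'n)) set" where
  "G_carrier = {(x, Y). \<forall>i j. Y$i$j = - Y$j$i}"

definition gmult :: "(real^'n) \<times> (real^'n^'n) \<Rightarrow> (real^'n) \<times> (real^'n^'n) \<Rightarrow> (real^'n) \<times> (real^'n^'n)" where
  "gmult g h = (fst g + fst h, snd g + snd h + (1/2) *\<^sub>R wedge (fst g) (fst h))"

definition is_norm :: "(real^'n \<Rightarrow> real) \<Rightarrow> bool" where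
  "is_norm N \<longleftrightarrow> (\<forall>x. N x \<ge> 0) \<and> (\<forall>x. N x = 0 \<longrightarrow> x = 0) \<and>
     (\<forall>c x. N (c *\<^sub>R x) = \<bar>c\<bar> * N x) \<and> (\<forall>x y. N (x + y) \<le> N x + N y)"

definition hcurve :: "(real \<Rightarrow> real^'n) \<Rightarrow> real \<Rightarrow> (real^'n) \<times> (real^'n^'n)" where
  "hcurve u t = (integral {0..t} u,
                 (1/2) *\<^sub>R integral {0..t} (\<lambda>s. wedge (integral {0..s} u) (u s)))"

definition sf_length :: "(real^'n \<Rightarrow> real) \<Rightarrow> (real \<Rightarrow> real^'n) \<Rightarrow> real" where
  "sf_length N u = integral {0..1} (\<lambda>t. N (u t))"

definition dcc :: "(real^'n \<Rightarrow> real) \<Rightarrow> (real^'n) \<times> (real^'n^'n) \<Rightarrow> (real^'n) \<times> (real^'n^'n) \<Rightarrow> real" where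
  "dcc N g h = Inf {sf_length N u | u. u absolutely_integrable_on {0..1} \<and>
                                       gmult g (hcurve u 1) = h}"

definition cc_sphere :: "(real^'n \<Rightarrow> real) \<Rightarrow> ((real^'n) \<times> (real^'n^'n)) set" where
  "cc_sphere N = {g \<in> G_carrier. dcc N g (0, 0) = 1}"

end

(* Controls are replaced by broken lines: the endpoint of a broken line with increments w_j is a
   finite quadratic expression in the w_j, inscribing a broken line in a horizontal curve does not
   increase its length, and the small vertical error is corrected by commutators at a cost of order
   the square root of its size.

   Adding h_j to the increments w_j changes the vertical component to first order by the sum of
   m_j wedge h_j, where m_j is the midpoint of the j-th segment. By separating hyperplanes, either
   these sums cover a ball of radius of order s at bounded cost, or an antisymmetric matrix of norm
   one maps every midpoint to a vector of length of order s. Two rows of such a matrix show that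
   the midpoints are within order s of a subspace of codimension two that is a graph over
   coordinates; then the endpoint is within order s of the abnormal set, which has codimension 3.
   In the first case Brouwer's theorem absorbs the quadratic term, and the distance from the
   identity is Lipschitz with constant of order 1/s near the endpoint.

   On the dyadic shell at distance about s from the abnormal set, the volume of order s^3 and the
   Lipschitz constant of order 1/s give the sphere a measure of order s^2, which is summable.
   Off the abnormal set the sphere is transversal to the dilations and hence locally a
   Lipschitz graph. *)

theory Submission
  imports Defs
begin

subsection \<open>Separated sets and covers\<close>

text \<open>The distance from the identity may fail to be Lipschitz at the abnormal set, so every
  estimate has to be quantitative in the distance s from it. Nearly optimal broken lines stand in
  for minimizers, so no constant may depend on the number of segments. This uniformity comes from
  measuring a perturbation by the total length of its increments: what a unit budget achieves is
  then the convex hull of the contributions of single segments.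

  A perturbation that moves the endpoint by \<delta> has size of order \<delta>/s and a quadratic
  effect of order (\<delta>/s)^2. This is dominated by \<delta> only if \<delta> is at most of order
  s^2, which is why the Lipschitz estimate is local, with exactly that range.

  Volumes are counted rather than measured: a bound on the cardinality of \<epsilon>-separated sets
  yields at once a cover by balls of radius \<epsilon>.\<close>

definition separated :: "real \<Rightarrow> 'a::metric_space set \<Rightarrow> bool" where
  "separated \<epsilon> P \<longleftrightarrow> (\<forall>p\<in>P. \<forall>q\<in>P. p \<noteq> q \<longrightarrow> \<epsilon> \<le> dist p q)"

text \<open>Finite covers with a real bound: the costs of pieces add without series in
  \<open>ennreal\<close>. The bounds c obtained later do not depend on \<delta>, so the supremum
  defining the Hausdorff measure is immediate.\<close>

definition finite_cover_cost :: "real \<Rightarrow> real \<Rightarrow> 'a::metric_space set \<Rightarrow> real \<Rightarrow> bool" where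
  "finite_cover_cost s \<delta> A c \<longleftrightarrow>
     (\<exists>F. finite F \<and> A \<subseteq> \<Union>F \<and> (\<forall>C\<in>F. bounded C \<and> diameter C \<le> \<delta>) \<and>
          (\<Sum>C\<in>F. diameter C powr s) \<le> c)"

lemma finite_cover_cost_mono:
  assumes "finite_cover_cost s \<delta> A c" "B \<subseteq> A" "c \<le> c'"
  shows "finite_cover_cost s \<delta> B c'"
  using assms unfolding finite_cover_cost_def by (meson order_trans)

lemma finite_cover_cost_Un:
  assumes "finite_cover_cost s \<delta> A a" "finite_cover_cost s \<delta> B b"
  shows "finite_cover_cost s \<delta> (A \<union> B) (a + b)"
proof -
  obtain F where F: "finite F" "A \<subseteq> \<Union>F" "\<forall>C\<in>F. bounded C \<and> diameter C \<le> \<delta>"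
    "(\<Sum>C\<in>F. diameter C powr s) \<le> a"
    using assms(1) unfolding finite_cover_cost_def by blast
  obtain H where H: "finite H" "B \<subseteq> \<Union>H" "\<forall>C\<in>H. bounded C \<and> diameter C \<le> \<delta>"
    "(\<Sum>C\<in>H. diameter C powr s) \<le> b"
    using assms(2) unfolding finite_cover_cost_def by blast
  have "(\<Sum>C\<in>F \<union> H. diameter C powr s) \<le> (\<Sum>C\<in>F. diameter C powr s) + (\<Sum>C\<in>H. diameter C powr s)"
    using F(1) H(1) by (simp add: sum_Un sum_nonneg)
  then show ?thesis
    unfolding finite_cover_cost_def using F H
    by (intro exI[of _ "F \<union> H"]) auto
qed

lemma hausdorff_pre_le_finite_cover_cost:
  assumes "finite_cover_cost s \<delta> A c" "\<delta> \<ge> 0"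
  shows "hausdorff_pre s \<delta> A \<le> ennreal c"
proof -
  obtain F where F: "finite F" "A \<subseteq> \<Union>F" "\<forall>C\<in>F. bounded C \<and> diameter C \<le> \<delta>"
    "(\<Sum>C\<in>F. diameter C powr s) \<le> c"
    using assms unfolding finite_cover_cost_def by blast
  obtain f where f: "bij_betw f {0..<card F} F"
    using ex_bij_betw_nat_finite[OF F(1)] by blast
  \<comment> \<open>Padding with empty sets is free: their diameter is 0 and
    \<open>0 powr s = 0\<close>.\<close>
  define C where "C = (\<lambda>i. if i < card F then f i else {})"
  have fF: "f i \<in> F" if "i < card F" for i
    using f that bij_betwE by fastforce
  have "A \<subseteq> (\<Union>i. C i)"
  proof
    fix x assume "x \<in> A"
    then obtain B where B: "B \<in> F" "x \<in> B" using F(2) by blast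
    then obtain i where "i < card F" "f i = B"
      using f unfolding bij_betw_def by (metis atLeastLessThan_iff imageE)
    then show "x \<in> (\<Union>i. C i)" using B by (auto simp: C_def)
  qed
  moreover have "\<forall>i. bounded (C i) \<and> diameter (C i) \<le> \<delta>"
    using F(3) fF assms(2) by (auto simp: C_def)
  ultimately have "hausdorff_pre s \<delta> A \<le> (\<Sum>i. ennreal (diameter (C i) powr s))"
    unfolding hausdorff_pre_def by (intro INF_lower) auto
  also have "\<dots> = (\<Sum>i\<in>{0..<card F}. ennreal (diameter (C i) powr s))"
    by (rule suminf_finite) (auto simp: C_def)
  also have "\<dots> = (\<Sum>i\<in>{0..<card F}. ennreal (diameter (f i) powr s))"
    by (rule sum.cong) (auto simp: C_def)
  also have "\<dots> = (\<Sum>B\<in>F. ennreal (diameter B powr s))"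
    by (rule sum.reindex_bij_betw[OF f])
  also have "\<dots> = ennreal (\<Sum>B\<in>F. diameter B powr s)"
    by (simp add: sum_ennreal)
  also have "\<dots> \<le> ennreal c" using F(4) by (rule ennreal_leI)
  finally show ?thesis .
qed

lemma hausdorff_measure_le_finite_cover_cost:
  assumes "\<And>\<delta>. \<delta> > 0 \<Longrightarrow> finite_cover_cost s \<delta> A c"
  shows "hausdorff_measure s A \<le> ennreal c"
  unfolding hausdorff_measure_def
  by (rule SUP_least) (auto intro!: hausdorff_pre_le_finite_cover_cost assms)

text \<open>A separated set of largest cardinality is a net, since a point far from all its members
  could be added. The bound B guarantees that a largest one exists.\<close>

lemma separated_net:
  fixes A :: "'a::metric_space set"
  assumes bound: "\<And>P. P \<subseteq> A \<Longrightarrow> finite P \<Longrightarrow> separated \<epsilon> P \<Longrightarrow> real (card P) \<le> B"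
    and "\<epsilon> > 0"
  obtains P where "P \<subseteq> A" "finite P" "separated \<epsilon> P" "A \<subseteq> (\<Union>p\<in>P. ball p \<epsilon>)"
proof -
  define Q where "Q = (\<lambda>P. P \<subseteq> A \<and> finite P \<and> separated \<epsilon> P)"
  have "Q {}" by (auto simp: Q_def separated_def)
  moreover have "\<forall>P. Q P \<longrightarrow> card P < Suc (nat \<lfloor>B\<rfloor>)"
    using bound by (auto simp: Q_def le_nat_floor less_Suc_eq_le)
  ultimately obtain P where P: "Q P" "\<forall>P'. Q P' \<longrightarrow> card P' \<le> card P"
    using ex_has_greatest_nat[of Q "{}" card] by blast
  have "A \<subseteq> (\<Union>p\<in>P. ball p \<epsilon>)"
  proof (rule ccontr)
    assume "\<not> ?thesis"
    then obtain x where x: "x \<in> A" "\<forall>p\<in>P. \<epsilon> \<le> dist p x" by (force simp: not_less)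
    then have "x \<notin> P" using assms(2) by force
    moreover have "Q (insert x P)"
      using P(1) x by (auto simp: Q_def separated_def dist_commute)
    then have "card (insert x P) \<le> card P" using P(2) by blast
    ultimately show False using P(1) by (simp add: Q_def)
  qed
  then show ?thesis using that P(1) by (auto simp: Q_def)
qed

text \<open>Balls of radius \<epsilon> about a maximal separated set cover A. When B is of order
  \<epsilon> to the power -s, the resulting cost does not depend on \<epsilon>.\<close>

lemma finite_cover_cost_separated:
  fixes A :: "'a::metric_space set"
  assumes "\<epsilon> > 0" "2 * \<epsilon> \<le> \<delta>" "s > 0"
    and bound: "\<And>P. P \<subseteq> A \<Longrightarrow> finite P \<Longrightarrow> separated \<epsilon> P \<Longrightarrow> real (card P) \<le> B"
  shows "finite_cover_cost s \<delta> A (B * (2 * \<epsilon>) powr s)"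
proof -
  obtain P where P: "P \<subseteq> A" "finite P" "separated \<epsilon> P" "A \<subseteq> (\<Union>p\<in>P. ball p \<epsilon>)"
    using separated_net[of A \<epsilon> B] bound assms(1) by blast
  have D: "bounded (ball p \<epsilon>) \<and> diameter (ball p \<epsilon>) \<le> 2 * \<epsilon>" for p :: 'a
  proof
    show "diameter (ball p \<epsilon>) \<le> 2 * \<epsilon>"
    proof -
      have "dist x y \<le> 2 * \<epsilon>" if "x \<in> ball p \<epsilon>" "y \<in> ball p \<epsilon>" for x y
        using that dist_triangle[of x y p] by (auto simp: dist_commute)
      then show ?thesis
        using assms(1) unfolding diameter_def by (auto intro!: cSUP_least)
    qed
  qed auto
  have "(\<Sum>C\<in>(\<lambda>p. ball p \<epsilon>) ` P. diameter C powr s) \<le> (\<Sum>C\<in>(\<lambda>p. ball p \<epsilon>) ` P. (2 * \<epsilon>) powr s)"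
    using D assms(3) by (intro sum_mono powr_mono2) (auto simp: diameter_ge_0)
  also have "\<dots> = card ((\<lambda>p. ball p \<epsilon>) ` P) * (2 * \<epsilon>) powr s" by simp
  also have "\<dots> \<le> card P * (2 * \<epsilon>) powr s"
    using P(2) by (intro mult_right_mono) (auto simp: card_image_le)
  also have "\<dots> \<le> B * (2 * \<epsilon>) powr s"
    using bound[OF P(1-3)] by (intro mult_right_mono) auto
  finally show ?thesis
    unfolding finite_cover_cost_def using P D assms(2)
    by (intro exI[of _ "(\<lambda>p. ball p \<epsilon>) ` P"]) (auto intro: order_trans)
qed

subsection \<open>Norms and broken lines\<close>

lemma bounded_bilinear_wedge: "bounded_bilinear (wedge :: real^'n \<Rightarrow> _)"
proof -
  have "bilinear (wedge :: real^'n \<Rightarrow> _)"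
    unfolding bilinear_def wedge_def
    by (intro conjI allI linearI) (auto simp: vec_eq_iff algebra_simps)
  then show ?thesis by (simp add: bilinear_conv_bounded_bilinear)
qed

interpretation wedge: bounded_bilinear "wedge :: real^'n \<Rightarrow> _"
  by (rule bounded_bilinear_wedge)

declare wedge.zero_left [simp] wedge.zero_right [simp]

lemma wedge_skew: "wedge w v = - wedge v w"
  by (simp add: wedge_def vec_eq_iff)

lemma wedge_self [simp]: "wedge v v = 0"
  by (simp add: wedge_def vec_eq_iff)

lemma wedge_nth: "wedge v w $ i $ j = v$i * w$j - w$i * v$j"
  by (simp add: wedge_def)

lemma mem_G_carrier: "p \<in> G_carrier \<longleftrightarrow> (\<forall>i j. snd p $ i $ j = - snd p $ j $ i)"
  by (auto simp: G_carrier_def case_prod_beta)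

lemma G_carrier_skew: "p \<in> G_carrier \<Longrightarrow> snd p $ i $ j = - snd p $ j $ i"
  using mem_G_carrier by blast

lemma subspace_G_carrier: "subspace G_carrier"
proof (rule subspaceI)
  fix p q :: "(real^'n) \<times> (real^'n^'n)" and c :: real
  assume p: "p \<in> G_carrier"
  then show "c *\<^sub>R p \<in> G_carrier"
    unfolding mem_G_carrier by (metis mult_minus_right snd_scaleR vector_scaleR_component real_scaleR_def)
  assume q: "q \<in> G_carrier"
  have "snd (p + q) $ i $ j = - snd (p + q) $ j $ i" for i j
    using G_carrier_skew[OF p, of i j] G_carrier_skew[OF q, of i j] by simp
  then show "p + q \<in> G_carrier" unfolding mem_G_carrier by blast
qed (simp add: mem_G_carrier)

lemma is_norm_props:
  assumes "is_norm N"
  shows is_norm_nonneg: "0 \<le> N x"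
    and is_norm_scaleR: "N (c *\<^sub>R x) = \<bar>c\<bar> * N x"
    and is_norm_triangle: "N (x + y) \<le> N x + N y"
  using assms unfolding is_norm_def by auto

lemma is_norm_zero: "is_norm N \<Longrightarrow> N 0 = 0"
  using is_norm_scaleR[of N 0 0] by simp

lemma is_norm_minus: "is_norm N \<Longrightarrow> N (- x) = N x"
  using is_norm_scaleR[of N "-1" x] by simp

lemma is_norm_sum:
  assumes "is_norm N"
  shows "N (sum f A) \<le> (\<Sum>i\<in>A. N (f i))"
proof (induction A rule: infinite_finite_induct)
  case (insert a A)
  then show ?case using is_norm_triangle[OF assms, of "f a" "sum f A"] by auto
qed (auto simp: is_norm_zero[OF assms])

lemma is_norm_upper:
  fixes N :: "real^'n \<Rightarrow> real"
  assumes "is_norm N"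
  obtains K where "K > 0" "\<And>x. N x \<le> K * norm x"
proof
  define K where "K = 1 + (\<Sum>i\<in>UNIV. N (axis i 1 :: real^'n))"
  show "K > 0" unfolding K_def using is_norm_nonneg[OF assms]
    by (smt (verit) sum_nonneg)
  fix x :: "real^'n"
  have "N x = N (\<Sum>i\<in>UNIV. x $ i *\<^sub>R axis i 1)"
    using basis_expansion[of x] by (simp add: scalar_mult_eq_scaleR)
  also have "\<dots> \<le> (\<Sum>i\<in>UNIV. N (x $ i *\<^sub>R (axis i 1 :: real^'n)))"
    by (rule is_norm_sum[OF assms])
  also have "\<dots> \<le> (\<Sum>i\<in>UNIV. norm x * N (axis i 1 :: real^'n))"
    by (intro sum_mono) (simp add: is_norm_scaleR[OF assms] mult_right_mono component_le_norm_cart is_norm_nonneg[OF assms])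
  also have "\<dots> \<le> K * norm x"
    by (simp add: K_def sum_distrib_left[symmetric] algebra_simps)
  finally show "N x \<le> K * norm x" .
qed

lemma is_norm_continuous:
  fixes N :: "real^'n \<Rightarrow> real"
  assumes "is_norm N"
  shows "continuous_on UNIV N"
proof -
  obtain K where K: "K > 0" "\<And>x. N x \<le> K * norm x" using is_norm_upper[OF assms] by blast
  have "N x - N y \<le> K * dist x y" for x y
    using is_norm_triangle[OF assms, of y "x - y"] K(2)[of "x - y"] by (simp add: dist_norm)
  then have "dist (N x) (N y) \<le> K * dist x y" for x y
    by (smt (verit) dist_commute dist_real_def)
  then have "K-lipschitz_on UNIV N"
    using K(1) by (intro lipschitz_onI) auto
  then show ?thesis by (rule lipschitz_on_continuous_on)
qed

lemma is_norm_lower: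
  fixes N :: "real^'n \<Rightarrow> real"
  assumes "is_norm N"
  obtains c where "c > 0" "\<And>x. c * norm x \<le> N x"
proof -
  have "\<exists>x\<in>sphere 0 1. \<forall>y\<in>sphere (0::real^'n) 1. N x \<le> N y"
    by (rule continuous_attains_inf)
       (use is_norm_continuous[OF assms] continuous_on_subset in auto)
  then obtain x0 where x0: "norm x0 = 1" "\<And>y. norm y = 1 \<Longrightarrow> N x0 \<le> N y"
    by auto
  have pos: "N x0 > 0"
    using assms x0(1) unfolding is_norm_def by (metis less_eq_real_def norm_zero zero_neq_one)
  have "N x0 * norm x \<le> N x" for x
  proof (cases "x = 0")
    case False
    have "N x0 \<le> N ((1 / norm x) *\<^sub>R x)" using False by (intro x0) auto
    then show ?thesis using False by (simp add: is_norm_scaleR[OF assms] field_simps)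
  qed (simp add: is_norm_zero[OF assms])
  then show ?thesis using that pos by blast
qed

definition vertex :: "(nat \<Rightarrow> real^'n) \<Rightarrow> nat \<Rightarrow> real^'n" where
  "vertex w j = (\<Sum>i<j. w i)"

definition midpoint_of :: "(nat \<Rightarrow> real^'n) \<Rightarrow> nat \<Rightarrow> real^'n" where
  "midpoint_of w j = vertex w j + (1/2) *\<^sub>R w j"

text \<open>Along a segment from v with increment w, (v + t w) wedge w equals v wedge w at every
  time, so this is the exact endpoint of the horizontal curve and not an approximation.\<close>

definition endpt :: "nat \<Rightarrow> (nat \<Rightarrow> real^'n) \<Rightarrow> (real^'n) \<times> (real^'n^'n)" where
  "endpt m w = (vertex w m, (1/2) *\<^sub>R (\<Sum>j<m. wedge (vertex w j) (w j)))"

definition cost :: "(real^'n \<Rightarrow> real) \<Rightarrow> nat \<Rightarrow> (nat \<Rightarrow> real^'n) \<Rightarrow> real" where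
  "cost N m w = (\<Sum>j<m. N (w j))"

lemma vertex_0 [simp]: "vertex w 0 = 0" and vertex_Suc [simp]: "vertex w (Suc j) = vertex w j + w j"
  by (simp_all add: vertex_def)

lemma endpt_0 [simp]: "endpt 0 w = (0, 0)"
  by (simp add: endpt_def)

lemma endpt_Suc: "endpt (Suc m) w = gmult (endpt m w) (w m, 0)"
  by (simp add: endpt_def gmult_def scaleR_add_right)

lemma endpt_cong: "(\<And>i. i < m \<Longrightarrow> w i = w' i) \<Longrightarrow> endpt m w = endpt m w'"
  by (induction m) (auto simp: endpt_Suc)

lemma gmult_assoc: "gmult (gmult p q) r = gmult p (gmult q r)"
  by (simp add: gmult_def wedge.add_left wedge.add_right algebra_simps)

lemma endpt_append:
  "endpt (m + k) (\<lambda>i. if i < m then w i else w' (i - m)) = gmult (endpt m w) (endpt k w')"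
proof (induction k)
  case 0
  have "gmult (endpt m w) (0, 0) = endpt m w" by (simp add: gmult_def)
  then show ?case by (auto intro: endpt_cong)
next
  case (Suc k)
  then show ?case by (simp add: endpt_Suc gmult_assoc)
qed

lemma cost_append:
  "cost N (m + k) (\<lambda>i. if i < m then w i else w' (i - m)) = cost N m w + cost N k w'"
  by (induction k) (auto simp: cost_def)

section \<open>Points reached by broken lines of bounded cost\<close>

definition reach :: "(real^'n \<Rightarrow> real) \<Rightarrow> (real^'n) \<times> (real^'n^'n) \<Rightarrow> real \<Rightarrow> bool" where
  "reach N p L \<longleftrightarrow> (\<exists>m w. endpt m w = p \<and> cost N m w \<le> L)"

lemma reach_mono: "reach N p L \<Longrightarrow> L \<le> L' \<Longrightarrow> reach N p L'"
  unfolding reach_def using order_trans by blast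

lemma reach_gmult:
  assumes "reach N p a" "reach N q b"
  shows "reach N (gmult p q) (a + b)"
proof -
  obtain m w k w' where "endpt m w = p" "cost N m w \<le> a" "endpt k w' = q" "cost N k w' \<le> b"
    using assms unfolding reach_def by blast
  then show ?thesis
    unfolding reach_def using endpt_append[of m k w w'] cost_append[of N m k w w']
    by (metis add_mono)
qed

lemma reach_horizontal: "reach N (v, 0) (N v)"
  unfolding reach_def
  by (intro exI[of _ 1] exI[of _ "\<lambda>_. v"]) (simp add: endpt_Suc gmult_def cost_def)

lemma reach_0: "reach N (0, 0) 0"
  unfolding reach_def by (intro exI[of _ 0]) (simp add: cost_def)

text \<open>The group commutator of v and w: the closed parallelogram with these sides encloses
  exactly v wedge w.\<close>

lemma reach_wedge:
  assumes "is_norm N"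
  shows "reach N (0, wedge v w) (2 * N v + 2 * N w)"
proof -
  have "gmult (gmult (gmult (v, 0) (w, 0)) (-v, 0)) (-w, 0) = (0, wedge v w)"
    by (simp add: gmult_def wedge.add_left wedge.minus_right wedge_skew[of w v] flip: scaleR_add_left)
  moreover have "reach N (gmult (gmult (gmult (v, 0) (w, 0)) (-v, 0)) (-w, 0)) (N v + N w + N (-v) + N (-w))"
    by (intro reach_gmult reach_horizontal)
  ultimately show ?thesis
    using is_norm_minus[OF assms] by (simp add: algebra_simps)
qed

text \<open>Each unordered pair of indices occurs twice with the same contribution, hence the factor
  1/2; summing over all pairs avoids choosing an order on the index type.\<close>

lemma wedge_basis_expansion:
  fixes Y :: "real^'n^'n"
  assumes "\<forall>i j. Y $ i $ j = - Y $ j $ i"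
  shows "Y = (\<Sum>(a, b)\<in>UNIV. (Y $ a $ b / 2) *\<^sub>R wedge (axis a 1) (axis b 1))"
proof -
  have "(\<Sum>(a, b)\<in>UNIV. (Y $ a $ b / 2) *\<^sub>R wedge (axis a 1) (axis b 1 :: real^'n)) $ i $ j = Y $ i $ j" for i j
  proof -
    have "(\<Sum>(a, b)\<in>UNIV. (Y $ a $ b / 2) *\<^sub>R wedge (axis a 1) (axis b 1 :: real^'n)) $ i $ j
        = (\<Sum>a\<in>UNIV. \<Sum>b\<in>UNIV. Y $ a $ b / 2 * (axis a 1 $ i * axis b 1 $ j - axis b 1 $ i * axis a 1 $ j))"
      by (simp add: sum_component case_prod_beta sum.cartesian_product wedge_nth flip: UNIV_Times_UNIV)
    also have "\<dots> = (\<Sum>a\<in>UNIV. \<Sum>b\<in>UNIV. (if a = i then if b = j then Y $ a $ b / 2 else 0 else 0)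
         - (if a = j then if b = i then Y $ a $ b / 2 else 0 else 0))"
      by (intro sum.cong refl) (auto simp: axis_def)
    also have "\<dots> = Y $ i $ j / 2 - Y $ j $ i / 2"
    proof -
      have "(\<Sum>b\<in>UNIV. if a = p then if b = q then Y $ a $ b / 2 else 0 else 0)
          = (if a = p then Y $ a $ q / 2 else 0)" for a p q
        by (cases "a = p") auto
      then show ?thesis by (simp add: sum_subtractf)
    qed
    also have "\<dots> = Y $ i $ j" using assms[rule_format, of j i] by simp
    finally show ?thesis .
  qed
  then show ?thesis by (simp add: vec_eq_iff)
qed

text \<open>Under dilation by \<mu> the cost scales like \<mu> and the vertical layer like the
  square of \<mu>, so the square root is the natural order. It is attained by one parallelogram per
  matrix entry.\<close>

lemma reach_vertical:
  fixes N :: "real^'n \<Rightarrow> real"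
  assumes "is_norm N"
  obtains C where "C > 0" "\<And>Y. \<forall>i j. Y $ i $ j = - Y $ j $ i \<Longrightarrow> reach N (0, Y) (C * sqrt (norm Y))"
proof -
  obtain K where K: "K > 0" "\<And>x. N x \<le> K * norm x" using is_norm_upper[OF assms] by blast
  have term1: "reach N (0, c *\<^sub>R wedge (axis a 1) (axis b 1)) (4 * K * sqrt \<bar>c\<bar>)" for c a b
  proof -
    \<comment> \<open>Two sides of length \<open>sqrt \<bar>c\<bar>\<close> enclose the area c; its
      sign sits in w.\<close>
    define v w where "v = sqrt \<bar>c\<bar> *\<^sub>R (axis a 1 :: real^'n)" and "w = (sgn c * sqrt \<bar>c\<bar>) *\<^sub>R (axis b 1 :: real^'n)"
    have "wedge v w = c *\<^sub>R wedge (axis a 1) (axis b 1)"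
      by (simp add: v_def w_def wedge.scaleR_left wedge.scaleR_right sgn_if)
    moreover have "2 * N v + 2 * N w \<le> 4 * K * sqrt \<bar>c\<bar>"
    proof -
      have "norm v \<le> sqrt \<bar>c\<bar>" "norm w \<le> sqrt \<bar>c\<bar>"
        by (auto simp: v_def w_def sgn_if)
      then have "K * norm v \<le> K * sqrt \<bar>c\<bar>" "K * norm w \<le> K * sqrt \<bar>c\<bar>" using K(1) by auto
      then show ?thesis using K(2)[of v] K(2)[of w] by linarith
    qed
    ultimately show ?thesis
      using reach_mono[OF reach_wedge[OF assms, of v w], of "4 * K * sqrt \<bar>c\<bar>"] by simp
  qed
  have sums: "reach N (0, \<Sum>i\<in>S. f i) (\<Sum>i\<in>S. r i)"
    if "\<And>i. i \<in> S \<Longrightarrow> reach N (0, f i) (r i)" "finite S"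
    for S :: "('n \<times> 'n) set" and f :: "_ \<Rightarrow> real^'n^'n" and r
    using that(2,1)
  proof induction
    case (insert x F)
    then have "reach N (gmult (0, f x) (0, sum f F)) (r x + sum r F)" by (intro reach_gmult) auto
    then show ?case using insert by (simp add: gmult_def wedge.zero_left)
  qed (simp add: reach_0)
  define C where "C = 1 + (\<Sum>_\<in>(UNIV::('n\<times>'n) set). 4 * K)"
  have "reach N (0, Y) (C * sqrt (norm Y))" if Y: "\<forall>i j. Y $ i $ j = - Y $ j $ i" for Y
  proof -
    have "reach N (0, \<Sum>(a, b)\<in>UNIV. (Y $ a $ b / 2) *\<^sub>R wedge (axis a 1) (axis b 1))
        (\<Sum>(a,b)\<in>(UNIV::('n\<times>'n) set). 4 * K * sqrt \<bar>Y $ a $ b / 2\<bar>)"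
      unfolding case_prod_beta by (rule sums, rule term1, rule finite)
    then have "reach N (0, Y) (\<Sum>(a,b)\<in>(UNIV::('n\<times>'n) set). 4 * K * sqrt \<bar>Y $ a $ b / 2\<bar>)"
      using wedge_basis_expansion[OF Y] by simp
    moreover have "(\<Sum>(a,b)\<in>(UNIV::('n\<times>'n) set). 4 * K * sqrt \<bar>Y $ a $ b / 2\<bar>)
        \<le> (\<Sum>(a,b)\<in>(UNIV::('n\<times>'n) set). 4 * K * sqrt (norm Y))"
    proof (intro sum_mono, clarify)
      fix a b
      have "\<bar>Y $ a $ b\<bar> \<le> norm Y"
        using component_le_norm_cart[of "Y $ a" b] Finite_Cartesian_Product.norm_nth_le[of Y a] by linarith
      then have "sqrt \<bar>Y $ a $ b / 2\<bar> \<le> sqrt (norm Y)" by (intro real_sqrt_le_mono) auto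
      then show "4 * K * sqrt \<bar>Y $ a $ b / 2\<bar> \<le> 4 * K * sqrt (norm Y)" using K(1) by simp
    qed
    moreover have "(\<Sum>(a,b)\<in>(UNIV::('n\<times>'n) set). 4 * K * sqrt (norm Y)) \<le> C * sqrt (norm Y)"
      by (simp add: C_def algebra_simps)
    ultimately show ?thesis by (meson reach_mono order_trans)
  qed
  moreover have "C > 0" unfolding C_def using K(1) by (simp add: add_pos_nonneg)
  ultimately show ?thesis using that by blast
qed

subsection \<open>From controls to broken lines\<close>

lemma norm_wedge_le: obtains B where "B > 0" "\<And>v w :: real^'n. norm (wedge v w) \<le> B * norm v * norm w"
  using wedge.pos_bounded by (metis mult.commute mult.left_commute)

text \<open>For Riemann sums this is the triangle inequality and homogeneity of N; a tagged division
  that is fine for both gauges compares the two integrals.\<close>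

lemma has_integral_is_norm_le:
  fixes u :: "real \<Rightarrow> real^'n"
  assumes N: "is_norm N" and u: "(u has_integral a) (cbox x y)"
    and Nu: "((\<lambda>t. N (u t)) has_integral b) (cbox x y)"
  shows "N a \<le> b"
proof -
  obtain K where K: "K > 0" "\<And>x. N x \<le> K * norm x" using is_norm_upper[OF N] by blast
  have "N a \<le> b + (K + 1) * e" if "e > 0" for e
  proof -
    obtain g1 where g1: "gauge g1" "\<And>p. p tagged_division_of cbox x y \<Longrightarrow> g1 fine p \<Longrightarrow>
        norm ((\<Sum>(x, k)\<in>p. measure lborel k *\<^sub>R u x) - a) < e"
      by (rule has_integralD[OF u \<open>e > 0\<close>]) blast
    obtain g2 where g2: "gauge g2" "\<And>p. p tagged_division_of cbox x y \<Longrightarrow> g2 fine p \<Longrightarrow>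
        norm ((\<Sum>(x, k)\<in>p. measure lborel k *\<^sub>R N (u x)) - b) < e"
      by (rule has_integralD[OF Nu \<open>e > 0\<close>]) blast
    obtain p where p: "p tagged_division_of cbox x y" "(\<lambda>x. g1 x \<inter> g2 x) fine p"
      using fine_division_exists[OF gauge_Int[OF g1(1) g2(1)]] by metis
    define s where "s = (\<Sum>(x, k)\<in>p. measure lborel k *\<^sub>R u x)"
    have fine: "g1 fine p" "g2 fine p" using p(2) by (auto simp: fine_Int)
    have "N s \<le> (\<Sum>z\<in>p. N (measure lborel (snd z) *\<^sub>R u (fst z)))"
      unfolding s_def case_prod_beta by (rule is_norm_sum[OF N])
    also have "\<dots> = (\<Sum>(x, k)\<in>p. measure lborel k *\<^sub>R N (u x))"
      by (simp add: case_prod_beta is_norm_scaleR[OF N])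
    also have "\<dots> \<le> b + e" using g2(2)[OF p(1) fine(2)] by simp
    finally have "N s \<le> b + e" .
    moreover have "N (a - s) \<le> K * e"
      using K(2)[of "a - s"] g1(2)[OF p(1) fine(1)] K(1)
      by (smt (verit) mult_less_cancel_left_pos norm_minus_commute s_def)
    ultimately show ?thesis using is_norm_triangle[OF N, of s "a - s"] by (simp add: algebra_simps)
  qed
  then have "N a \<le> b + e" if "e > 0" for e
    using that K(1) \<open>K > 0\<close> by (metis add_pos_pos divide_pos_pos nonzero_mult_div_cancel_left
        order_less_irrefl times_divide_eq_right zero_less_one)
  then show ?thesis by (rule field_le_epsilon)
qed

lemma absolutely_integrable_is_norm:
  fixes u :: "real \<Rightarrow> real^'n"
  assumes N: "is_norm N" and u: "u absolutely_integrable_on S"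
  shows "(\<lambda>t. N (u t)) absolutely_integrable_on S"
proof -
  obtain K where K: "K > 0" "\<And>x. N x \<le> K * norm x" using is_norm_upper[OF N] by blast
  have [measurable]: "N \<in> borel_measurable borel"
    using is_norm_continuous[OF N] by (rule borel_measurable_continuous_onI)
  have int: "integrable lebesgue (\<lambda>x. indicator S x *\<^sub>R u x)"
    using u unfolding set_integrable_def .
  then have [measurable]: "(\<lambda>x. indicator S x *\<^sub>R u x) \<in> borel_measurable lebesgue"
    by (rule borel_measurable_integrable)
  have eq: "(\<lambda>x. indicator S x *\<^sub>R N (u x)) = (\<lambda>x. N (indicator S x *\<^sub>R u x))"
    by (auto simp: indicator_def is_norm_zero[OF N])
  have "integrable lebesgue (\<lambda>x. N (indicator S x *\<^sub>R u x))"
  proof (rule Bochner_Integration.integrable_bound[OF integrable_mult_right[OF integrable_norm[OF int], of K]])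
    show "(\<lambda>x. N (indicator S x *\<^sub>R u x)) \<in> borel_measurable lebesgue" by measurable
    have "norm (N x) \<le> norm (K * norm x)" for x
      using K(1) K(2)[of x] is_norm_nonneg[OF N, of x] by simp
    then show "AE x in lebesgue. norm (N (indicator S x *\<^sub>R u x)) \<le> norm (K * norm (indicator S x *\<^sub>R u x))"
      by blast
  qed
  then show ?thesis unfolding set_integrable_def eq .
qed

lemma absolutely_integrable_wedge:
  fixes u :: "real \<Rightarrow> real^'n"
  assumes u: "u absolutely_integrable_on {a..b}" and X: "continuous_on {a..b} X"
  shows "(\<lambda>s. wedge (X s) (u s)) absolutely_integrable_on {a..b}"
proof (rule absolutely_integrable_bounded_measurable_product[where h = wedge and f = X and g = u])
  show "bilinear (wedge :: real^'n \<Rightarrow> _)"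
    using bilinear_conv_bounded_bilinear bounded_bilinear_wedge by blast
  show "X \<in> borel_measurable (lebesgue_on {a..b})"
    by (intro continuous_imp_measurable_on_sets_lebesgue X) auto
  show "bounded (X ` {a..b})"
    by (intro compact_imp_bounded compact_continuous_image X) auto
qed (use u in auto)

lemma integral_equipartition:
  fixes f :: "real \<Rightarrow> 'a::banach"
  assumes f: "f integrable_on {0..1}" and m: "m > 0" and "k \<le> m"
  shows "integral {0..real k / real m} f = (\<Sum>i<k. integral {real i / real m..real (Suc i) / real m} f)"
  using \<open>k \<le> m\<close>
proof (induction k)
  case (Suc k)
  have *: "real k / real m \<le> real (Suc k) / real m" "real (Suc k) / real m \<le> 1"
    using Suc.prems m by (auto simp: divide_right_mono)
  have "integral {0..real k / real m} f + integral {real k / real m..real (Suc k) / real m} f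
      = integral {0..real (Suc k) / real m} f"
    by (rule Henstock_Kurzweil_Integration.integral_combine)
       (use * integrable_on_subinterval[OF f] in auto)
  then show ?case using Suc by simp
qed auto

text \<open>The increments are those of the primitive X over m equal intervals. On the i-th one the
  vertical error is the integral of (X s - X (i/m)) wedge u s, at most the oscillation of X times
  the integral of |u| up to a constant. So uniform continuity of X suffices although u is merely
  integrable.\<close>

lemma control_to_word:
  fixes u :: "real \<Rightarrow> real^'n"
  assumes N: "is_norm N" and u: "u absolutely_integrable_on {0..1}" and "e > 0"
  obtains m w where "cost N m w \<le> sf_length N u"
    "fst (endpt m w) = fst (hcurve u 1)" "norm (snd (hcurve u 1) - snd (endpt m w)) < e"
proof -
  obtain B where B: "B > 0" "\<And>v w :: real^'n. norm (wedge v w) \<le> B * norm v * norm w"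
    using norm_wedge_le by blast
  define X where "X = (\<lambda>t. integral {0..t} u)"
  have ui: "u integrable_on {0..1}" using u set_lebesgue_integral_eq_integral(1) by blast
  have Xc: "continuous_on {0..1} X"
    unfolding X_def by (rule indefinite_integral_continuous_1[OF ui])
  define I where "I = integral {0..1} (\<lambda>t. norm (u t))"
  have "I \<ge> 0" unfolding I_def by (rule integral_nonneg) (use u in \<open>auto simp: absolutely_integrable_on_def\<close>)
  \<comment> \<open>The total error is at most \<open>B * e' * I\<close>; adding 1 to I avoids a
    division by zero.\<close>
  define e' where "e' = e / (B * (I + 1))"
  have e': "e' > 0" using \<open>e > 0\<close> B \<open>I \<ge> 0\<close> by (auto simp: e'_def)
  have "uniformly_continuous_on {0..1} X"
    by (rule compact_uniformly_continuous[OF Xc]) auto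
  then obtain d where d: "d > 0" "\<And>s t. s \<in> {0..1} \<Longrightarrow> t \<in> {0..1} \<Longrightarrow> dist s t < d \<Longrightarrow> dist (X s) (X t) < e'"
    using e' unfolding uniformly_continuous_on_def by metis
  obtain m0 :: nat where "1 / d < real m0" using reals_Archimedean2 by blast
  define m where "m = Suc m0"
  have m: "m > 0" "1 / real m < d"
    using \<open>1 / d < real m0\<close> d(1) unfolding m_def by (auto simp: field_simps)
  define J where "J = (\<lambda>i::nat. {real i / real m..real (Suc i) / real m})"
  have Jsub: "J i \<subseteq> {0..1}" if "i < m" for i
  proof -
    have "real (Suc i) / real m \<le> 1" using that m by (auto simp: divide_le_eq_1)
    then show ?thesis unfolding J_def by (auto intro: order_trans[of 0 "real i / real m"])
  qed
  have uJ: "u absolutely_integrable_on J i" if "i < m" for i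
    unfolding J_def by (rule absolutely_integrable_on_subinterval[OF u Jsub[OF that, unfolded J_def]])
  define w where "w = (\<lambda>i. integral (J i) u)"
  have vert: "vertex w k = X (real k / real m)" if "k \<le> m" for k
    using integral_equipartition[OF ui m(1) that] by (simp add: vertex_def X_def w_def J_def)
  have NuI: "(\<lambda>t. N (u t)) integrable_on {0..1}"
    using absolutely_integrable_is_norm[OF N u] set_lebesgue_integral_eq_integral(1) by blast
  have "cost N m w \<le> (\<Sum>i<m. integral (J i) (\<lambda>t. N (u t)))"
    unfolding cost_def
  proof (rule sum_mono)
    fix i assume "i \<in> {..<m}"
    then have i: "i < m" by simp
    have 1: "(u has_integral w i) (J i)"
      using uJ[OF i] set_lebesgue_integral_eq_integral(1) unfolding w_def by (intro integrable_integral) blast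
    have 2: "((\<lambda>t. N (u t)) has_integral integral (J i) (\<lambda>t. N (u t))) (J i)"
      using absolutely_integrable_is_norm[OF N uJ[OF i]] set_lebesgue_integral_eq_integral(1)
      by (intro integrable_integral) blast
    show "N (w i) \<le> integral (J i) (\<lambda>t. N (u t))"
      using has_integral_is_norm_le[OF N, of u "w i" "real i / real m" "real (Suc i) / real m"] 1 2
      unfolding J_def by simp
  qed
  also have "\<dots> = sf_length N u"
    using integral_equipartition[OF NuI m(1) order_refl] m(1) by (simp add: J_def sf_length_def)
  finally have cost: "cost N m w \<le> sf_length N u" .
  have fst: "fst (endpt m w) = fst (hcurve u 1)"
    using vert[OF order_refl] m(1) by (simp add: endpt_def hcurve_def X_def)
  have wa: "(\<lambda>s. wedge (X s) (u s)) absolutely_integrable_on {0..1}"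
    by (rule absolutely_integrable_wedge[OF u Xc])
  have nI: "(\<lambda>t. norm (u t)) integrable_on {0..1}"
    using u by (simp add: absolutely_integrable_on_def)
  have step: "norm (integral (J i) (\<lambda>s. wedge (X s) (u s)) - wedge (vertex w i) (w i))
      \<le> B * e' * integral (J i) (\<lambda>s. norm (u s))" if i: "i < m" for i
  proof -
    have iu: "u integrable_on J i" "(\<lambda>s. norm (u s)) integrable_on J i"
      using uJ[OF i] by (auto simp: absolutely_integrable_on_def)
    have iw: "(\<lambda>s. wedge (X s) (u s)) integrable_on J i"
      using absolutely_integrable_wedge[of "real i / real m" "real (Suc i) / real m" u X] uJ[OF i]
        continuous_on_subset[OF Xc Jsub[OF i]] set_lebesgue_integral_eq_integral(1)
      unfolding J_def by blast
    have c: "((\<lambda>s. wedge (X (real i / real m)) (u s)) has_integral wedge (X (real i / real m)) (w i)) (J i)"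
      using has_integral_linear[OF integrable_integral[OF iu(1)] wedge.bounded_linear_right]
      unfolding w_def comp_def .
    have "((\<lambda>s. wedge (X s) (u s) - wedge (X (real i / real m)) (u s)) has_integral
        integral (J i) (\<lambda>s. wedge (X s) (u s)) - wedge (X (real i / real m)) (w i)) (J i)"
      by (intro has_integral_diff integrable_integral iw c)
    then have h: "((\<lambda>s. wedge (X s - X (real i / real m)) (u s)) has_integral
        integral (J i) (\<lambda>s. wedge (X s) (u s)) - wedge (vertex w i) (w i)) (J i)"
      using vert[of i] i by (simp add: wedge.diff_left)
    have "norm (integral (J i) (\<lambda>s. wedge (X s - X (real i / real m)) (u s)))
        \<le> integral (J i) (\<lambda>s. B * e' * norm (u s))"
    proof (rule integral_norm_bound_integral)
      fix s assume s: "s \<in> J i"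
      have "dist s (real i / real m) \<le> 1 / real m"
        using s unfolding J_def dist_real_def by (auto simp: add_divide_distrib)
      moreover have "real i / real m \<in> J i" unfolding J_def by (auto simp: divide_right_mono)
      ultimately have "dist (X s) (X (real i / real m)) < e'"
        using Jsub[OF i] s m(2) by (intro d(2)) auto
      then have "B * norm (X s - X (real i / real m)) * norm (u s) \<le> B * e' * norm (u s)"
        using B(1) by (intro mult_right_mono mult_left_mono) (auto simp: dist_norm)
      then show "norm (wedge (X s - X (real i / real m)) (u s)) \<le> B * e' * norm (u s)"
        using B(2) order_trans by blast
    next
      show "(\<lambda>s. wedge (X s - X (real i / real m)) (u s)) integrable_on J i" using h by blast
      show "(\<lambda>s. B * e' * norm (u s)) integrable_on J i"
        using integrable_cmul[OF iu(2), of "B * e'"] by simp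
    qed
    then show ?thesis using h by (simp add: integral_unique)
  qed
  have "norm (integral {0..1} (\<lambda>s. wedge (X s) (u s)) - (\<Sum>i<m. wedge (vertex w i) (w i)))
      = norm (\<Sum>i<m. integral (J i) (\<lambda>s. wedge (X s) (u s)) - wedge (vertex w i) (w i))"
    using integral_equipartition[OF set_lebesgue_integral_eq_integral(1)[OF wa] m(1) order_refl] m(1)
    by (simp add: J_def sum_subtractf)
  also have "\<dots> \<le> (\<Sum>i<m. B * e' * integral (J i) (\<lambda>s. norm (u s)))"
    by (intro sum_norm_le step) auto
  also have "\<dots> = B * e' * I"
    using integral_equipartition[OF nI m(1) order_refl] m(1)
    by (simp add: J_def I_def sum_distrib_left)
  \<comment> \<open>The vertical component carries a factor 1/2, so \<open>2 * e\<close> is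
    enough.\<close>
  also have "\<dots> < 2 * e"
  proof -
    have "B * e' * I = e * (I / (I + 1))" using B(1) by (simp add: e'_def)
    also have "\<dots> \<le> e * 1" using \<open>I \<ge> 0\<close> \<open>e > 0\<close> by (intro mult_left_mono) auto
    finally show ?thesis using \<open>e > 0\<close> by simp
  qed
  finally have "norm (snd (hcurve u 1) - snd (endpt m w)) < e"
    by (simp add: hcurve_def endpt_def X_def flip: scaleR_diff_right)
  then show ?thesis using that cost fst by blast
qed

subsection \<open>From broken lines to controls\<close>

lemma has_integral_double_speed:
  fixes f :: "real \<Rightarrow> 'a::euclidean_space"
  assumes f: "(f has_integral I) {0..2 * t}"
    and h: "\<And>s. s \<le> 1/2 \<Longrightarrow> h s = 2 *\<^sub>R f (2 * s)" and t: "t \<le> 1/2"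
  shows "(h has_integral I) {0..t}"
proof -
  have "((\<lambda>s. f (2 * s)) has_integral (I /\<^sub>R 2)) {0..t}"
    using has_integral_affinity'[of f I 0 "2 * t" 2 0] f by simp
  then have "((\<lambda>s. 2 *\<^sub>R f (2 * s)) has_integral I) {0..t}"
    using has_integral_cmul[of "\<lambda>s. f (2 * s)" "I /\<^sub>R 2" "{0..t}" 2] by simp
  then show ?thesis
    by (rule has_integral_eq[rotated]) (use h t in auto)
qed

lemma has_integral_append_const:
  fixes f :: "real \<Rightarrow> 'a::euclidean_space"
  assumes f: "(f has_integral I) {0..1}"
    and h: "\<And>s. s \<le> 1/2 \<Longrightarrow> h s = 2 *\<^sub>R f (2 * s)"
    and h': "\<And>s. s > 1/2 \<Longrightarrow> h s = c" and t: "t \<ge> 1/2"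
  shows "(h has_integral I + (t - 1/2) *\<^sub>R c) {0..t}"
proof (rule has_integral_combine[of 0 "1/2"])
  show "(h has_integral I) {0..1/2}"
    by (rule has_integral_double_speed[of f]) (use f h in auto)
  have "((\<lambda>_. c) has_integral (t - 1/2) *\<^sub>R c) {1/2..t}"
    using has_integral_const_real[of c "1/2" t] t by simp
  then show "(h has_integral (t - 1/2) *\<^sub>R c) {1/2..t}"
    by (rule has_integral_spike_finite[of "{1/2}", rotated 2]) (use h' in auto)
qed (use t in auto)

text \<open>The primitive X and the vertical integral A are carried along explicitly with
  \<open>has_integral\<close>, so that the induction over segments never meets the nested
  \<open>integral\<close> of \<open>hcurve\<close>. The vertical component is A / 2.\<close>

definition controls ::
    "(real^'n \<Rightarrow> real) \<Rightarrow> (real \<Rightarrow> real^'n) \<Rightarrow> (real \<Rightarrow> real^'n) \<Rightarrow> real^'n^'n \<Rightarrow> real \<Rightarrow> bool" where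
  "controls N u X A L \<longleftrightarrow> u absolutely_integrable_on {0..1} \<and>
     (\<forall>t\<in>{0..1}. (u has_integral X t) {0..t}) \<and>
     ((\<lambda>s. wedge (X s) (u s)) has_integral A) {0..1} \<and> ((\<lambda>s. N (u s)) has_integral L) {0..1}"

lemma word_to_control:
  fixes N :: "real^'n \<Rightarrow> real"
  assumes N: "is_norm N"
  shows "\<exists>u X A. controls N u X A (cost N m w) \<and> endpt m w = (X 1, (1/2) *\<^sub>R A)"
proof (induction m)
  case 0
  show ?case
    by (rule exI[of _ "\<lambda>_. 0"], rule exI[of _ "\<lambda>_. 0"], rule exI[of _ 0])
       (simp add: controls_def cost_def is_norm_zero[OF N])
next
  case (Suc m)
  obtain u X A where H: "controls N u X A (cost N m w) \<and> endpt m w = (X 1, (1/2) *\<^sub>R A)"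
    using Suc.IH by blast
  then have u: "u absolutely_integrable_on {0..1}"
    and X: "\<And>t. t \<in> {0..1} \<Longrightarrow> (u has_integral X t) {0..t}"
    and A: "((\<lambda>s. wedge (X s) (u s)) has_integral A) {0..1}"
    and L: "((\<lambda>s. N (u s)) has_integral cost N m w) {0..1}"
    and e: "endpt m w = (X 1, (1/2) *\<^sub>R A)"
    by (simp_all add: controls_def)
  \<comment> \<open>The control for m segments runs at double speed on the first half of the
    interval; the new segment fills the second half, with its speed doubled as well.\<close>
  define c where "c = (\<lambda>t. if t \<le> 1/2 then 2 *\<^sub>R u (2 * t) else 2 *\<^sub>R w m)"
  define X' where "X' = (\<lambda>t. if t \<le> 1/2 then X (2 * t) else X 1 + (t - 1/2) *\<^sub>R (2 *\<^sub>R w m))"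
  have X1: "(u has_integral X 1) {0..1}" using X[of 1] by simp
  have X': "(c has_integral X' t) {0..t}" if "t \<in> {0..1}" for t
  proof (cases "t \<le> 1/2")
    case True
    then show ?thesis
      using that has_integral_double_speed[of u "X (2 * t)" t c] X[of "2 * t"] by (simp add: c_def X'_def)
  next
    case False
    then show ?thesis
      using has_integral_append_const[OF X1, of c "2 *\<^sub>R w m" t] by (simp add: c_def X'_def)
  qed
  have nu: "((\<lambda>s. norm (u s)) has_integral integral {0..1} (\<lambda>s. norm (u s))) {0..1}"
    using u by (intro integrable_integral) (simp add: absolutely_integrable_on_def)
  have "((\<lambda>s. norm (c s)) has_integral integral {0..1} (\<lambda>s. norm (u s)) + (1 - 1/2) *\<^sub>R norm (2 *\<^sub>R w m)) {0..1}"
    by (rule has_integral_append_const[OF nu]) (auto simp: c_def)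
  then have "c absolutely_integrable_on {0..1}"
    using X'[of 1] unfolding absolutely_integrable_on_def by auto
  moreover
  \<comment> \<open>On the second half the integrand is constant, because the wedge of
    \<open>w m\<close> with itself vanishes.\<close>
  have "((\<lambda>s. wedge (X' s) (c s)) has_integral A + (1 - 1/2) *\<^sub>R (2 *\<^sub>R wedge (X 1) (w m))) {0..1}"
    by (rule has_integral_append_const[OF A])
       (auto simp: c_def X'_def wedge.scaleR_right wedge.add_left wedge.scaleR_left)
  then have "((\<lambda>s. wedge (X' s) (c s)) has_integral A + wedge (X 1) (w m)) {0..1}" by simp
  moreover
  have "((\<lambda>s. N (c s)) has_integral cost N m w + (1 - 1/2) *\<^sub>R (2 * N (w m))) {0..1}"
    by (rule has_integral_append_const[OF L]) (auto simp: c_def is_norm_scaleR[OF N])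
  then have "((\<lambda>s. N (c s)) has_integral cost N (Suc m) w) {0..1}" by (simp add: cost_def)
  ultimately have "controls N c X' (A + wedge (X 1) (w m)) (cost N (Suc m) w)"
    using X' by (simp add: controls_def)
  moreover have "endpt (Suc m) w = (X' 1, (1/2) *\<^sub>R (A + wedge (X 1) (w m)))"
    by (simp add: endpt_Suc e gmult_def X'_def scaleR_add_right)
  ultimately show ?case by blast
qed

section \<open>The distance from the identity\<close>

definition cc_norm :: "(real^'n \<Rightarrow> real) \<Rightarrow> (real^'n) \<times> (real^'n^'n) \<Rightarrow> real" where
  "cc_norm N g = dcc N g (0, 0)"

text \<open>In \<open>dcc N g (0, 0)\<close> the curves start at g, so the competing controls have
  endpoint \<open>- g\<close>, the inverse of g; this is the origin of the minus signs
  below.\<close>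

lemma gmult_eq_0_iff: "gmult g h = (0, 0) \<longleftrightarrow> h = - g"
proof
  assume h: "gmult g h = (0, 0)"
  then have "fst h = - fst g" by (simp add: gmult_def add_eq_0_iff)
  then show "h = - g"
    using h by (simp add: gmult_def wedge.minus_right prod_eq_iff add_eq_0_iff)
qed (simp add: gmult_def wedge.minus_right)

lemma sf_length_nonneg:
  assumes "is_norm N" "u absolutely_integrable_on {0..1}"
  shows "0 \<le> sf_length N u"
  unfolding sf_length_def
  using absolutely_integrable_is_norm[OF assms] set_lebesgue_integral_eq_integral(1) is_norm_nonneg[OF assms(1)]
  by (intro integral_nonneg) blast+

lemma reach_control:
  assumes N: "is_norm N" and r: "reach N p L"
  obtains u where "u absolutely_integrable_on {0..1}" "hcurve u 1 = p" "sf_length N u \<le> L"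
proof -
  obtain m w where mw: "endpt m w = p" "cost N m w \<le> L" using r unfolding reach_def by blast
  obtain u X A where H: "controls N u X A (cost N m w) \<and> endpt m w = (X 1, (1/2) *\<^sub>R A)"
    using word_to_control[OF N, of m w] by blast
  then have u: "u absolutely_integrable_on {0..1}"
    and X: "\<And>t. t \<in> {0..1} \<Longrightarrow> (u has_integral X t) {0..t}"
    and A: "((\<lambda>s. wedge (X s) (u s)) has_integral A) {0..1}"
    and L: "((\<lambda>s. N (u s)) has_integral cost N m w) {0..1}"
    and e: "endpt m w = (X 1, (1/2) *\<^sub>R A)"
    by (simp_all add: controls_def)
  have "integral {0..1} (\<lambda>s. wedge (integral {0..s} u) (u s)) = integral {0..1} (\<lambda>s. wedge (X s) (u s))"
    using integral_unique[OF X] by (intro integral_cong) simp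
  then have "hcurve u 1 = p"
    using X[of 1] A mw(1) e by (simp add: hcurve_def integral_unique)
  moreover have "sf_length N u \<le> L"
    using L mw(2) by (simp add: sf_length_def integral_unique)
  ultimately show ?thesis using that u by blast
qed

lemma cc_norm_le:
  assumes N: "is_norm N" and r: "reach N (- g) L"
  shows "cc_norm N g \<le> L"
proof -
  obtain u where u: "u absolutely_integrable_on {0..1}" "hcurve u 1 = - g" "sf_length N u \<le> L"
    using reach_control[OF N r] by blast
  have "cc_norm N g \<le> sf_length N u"
    unfolding cc_norm_def dcc_def
    by (rule cInf_lower) (use u in \<open>auto simp: gmult_eq_0_iff intro!: bdd_belowI[of _ 0] sf_length_nonneg[OF N]\<close>)
  then show ?thesis using u(3) by simp
qed

lemma gmult_mem_G_carrier:
  assumes "p \<in> G_carrier" "q \<in> G_carrier"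
  shows "gmult p q \<in> G_carrier"
proof -
  have "snd (gmult p q) $ i $ j = - snd (gmult p q) $ j $ i" for i j
    using G_carrier_skew[OF assms(1), of i j] G_carrier_skew[OF assms(2), of i j]
    by (simp add: gmult_def wedge_nth algebra_simps)
  then show ?thesis unfolding mem_G_carrier by blast
qed

lemma endpt_mem_G_carrier: "endpt m w \<in> G_carrier"
proof (induction m)
  case (Suc m)
  have "(w m, 0) \<in> G_carrier" by (simp add: mem_G_carrier)
  then show ?case unfolding endpt_Suc by (intro gmult_mem_G_carrier Suc)
qed (simp add: mem_G_carrier)

lemma reach_exists:
  assumes N: "is_norm N" and g: "g \<in> G_carrier"
  obtains L where "reach N g L"
proof -
  obtain C where C: "C > 0" "\<And>Y. \<forall>i j. Y $ i $ j = - Y $ j $ i \<Longrightarrow> reach N (0, Y) (C * sqrt (norm Y))"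
    using reach_vertical[OF N] by blast
  have "reach N (0, snd g) (C * sqrt (norm (snd g)))"
    by (rule C(2)[OF iffD1[OF mem_G_carrier g]])
  then have "reach N (gmult (fst g, 0) (0, snd g)) (N (fst g) + C * sqrt (norm (snd g)))"
    by (intro reach_gmult reach_horizontal)
  moreover have "gmult (fst g, 0) (0, snd g) = g" by (simp add: gmult_def)
  ultimately show ?thesis using that by metis
qed

lemma reach_cc_norm:
  assumes N: "is_norm N" and g: "g \<in> G_carrier" and "e > 0"
  shows "reach N (- g) (cc_norm N g + e)"
proof -
  obtain C where C: "C > 0" "\<And>Y. \<forall>i j. Y $ i $ j = - Y $ j $ i \<Longrightarrow> reach N (0, Y) (C * sqrt (norm Y))"
    using reach_vertical[OF N] by blast
  have g': "- g \<in> G_carrier" using subspace_neg[OF subspace_G_carrier g] .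
  define S where "S = {sf_length N u | u. u absolutely_integrable_on {0..1} \<and> gmult g (hcurve u 1) = (0, 0)}"
  \<comment> \<open>The set of lengths must be nonempty before a control can be extracted from its
    infimum; commutators provide one.\<close>
  obtain L where "reach N (- g) L" using reach_exists[OF N g'] by blast
  then obtain u0 where "u0 absolutely_integrable_on {0..1}" "hcurve u0 1 = - g"
    using reach_control[OF N] by metis
  then have "S \<noteq> {}" unfolding S_def by (auto simp: gmult_eq_0_iff)
  moreover have "Inf S < cc_norm N g + e / 2"
    unfolding S_def cc_norm_def dcc_def using \<open>e > 0\<close> by simp
  ultimately obtain l where "l \<in> S" "l < cc_norm N g + e / 2"
    using cInf_lessD by blast
  then obtain u where u: "u absolutely_integrable_on {0..1}" "hcurve u 1 = - g" "sf_length N u < cc_norm N g + e / 2"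
    unfolding S_def by (auto simp: gmult_eq_0_iff)
  \<comment> \<open>Chosen so that correcting a vertical defect of norm e' costs
    \<open>C * sqrt e' = e / 2\<close>, the half of e that the control has left over.\<close>
  define e' where "e' = (e / (2 * C))\<^sup>2"
  have "e' > 0" using \<open>e > 0\<close> C(1) by (simp add: e'_def)
  obtain m w where mw: "cost N m w \<le> sf_length N u" "fst (endpt m w) = fst (- g)"
    "norm (snd (- g) - snd (endpt m w)) < e'"
    using control_to_word[OF N u(1) \<open>e' > 0\<close>] u(2) by metis
  define Z where "Z = snd (- g) - snd (endpt m w)"
  have "- g - endpt m w \<in> G_carrier"
    by (rule subspace_diff[OF subspace_G_carrier g' endpt_mem_G_carrier])
  then have "\<forall>i j. Z $ i $ j = - Z $ j $ i"
    unfolding mem_G_carrier Z_def snd_diff .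
  then have "reach N (0, Z) (C * sqrt (norm Z))" by (rule C(2))
  moreover have "reach N (endpt m w) (cost N m w)" unfolding reach_def by blast
  ultimately have "reach N (gmult (endpt m w) (0, Z)) (cost N m w + C * sqrt (norm Z))"
    by (intro reach_gmult)
  moreover have "gmult (endpt m w) (0, Z) = - g"
    using mw(2) by (simp add: gmult_def Z_def prod_eq_iff)
  moreover have "C * sqrt (norm Z) \<le> e / 2"
  proof -
    have "sqrt (norm Z) \<le> sqrt e'" using mw(3) by (simp add: Z_def)
    also have "\<dots> = e / (2 * C)" using \<open>e > 0\<close> C(1) by (simp add: e'_def)
    finally show ?thesis using C(1) by (simp add: field_simps)
  qed
  ultimately show ?thesis using mw(1) u(3) reach_mono[of N "- g" "cost N m w + C * sqrt (norm Z)"] by simp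
qed

section \<open>Dilations and boundedness\<close>

definition dil :: "real \<Rightarrow> (real^'n) \<times> (real^'n^'n) \<Rightarrow> (real^'n) \<times> (real^'n^'n)" where
  "dil \<mu> g = (\<mu> *\<^sub>R fst g, \<mu>\<^sup>2 *\<^sub>R snd g)"

lemma endpt_scaleR: "endpt m (\<lambda>i. \<mu> *\<^sub>R w i) = dil \<mu> (endpt m w)"
  by (simp add: endpt_def dil_def vertex_def wedge.scaleR_left wedge.scaleR_right
      power2_eq_square scaleR_sum_right[symmetric])

lemma reach_dil:
  assumes "is_norm N" "\<mu> > 0" "reach N p L"
  shows "reach N (dil \<mu> p) (\<mu> * L)"
proof -
  obtain m w where "endpt m w = p" "cost N m w \<le> L" using assms(3) unfolding reach_def by blast
  then have "endpt m (\<lambda>i. \<mu> *\<^sub>R w i) = dil \<mu> p" "cost N m (\<lambda>i. \<mu> *\<^sub>R w i) \<le> \<mu> * L"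
    using assms(1,2) by (auto simp: endpt_scaleR cost_def is_norm_scaleR sum_distrib_left[symmetric])
  then show ?thesis unfolding reach_def by blast
qed

lemma dil_mem_G_carrier: "g \<in> G_carrier \<Longrightarrow> dil \<mu> g \<in> G_carrier"
proof -
  assume g: "g \<in> G_carrier"
  have "snd (dil \<mu> g) $ i $ j = - snd (dil \<mu> g) $ j $ i" for i j
    using G_carrier_skew[OF g, of i j] by (simp add: dil_def)
  then show ?thesis unfolding mem_G_carrier by blast
qed

lemma cc_norm_dil_le:
  assumes N: "is_norm N" and "\<mu> > 0" "g \<in> G_carrier"
  shows "cc_norm N (dil \<mu> g) \<le> \<mu> * cc_norm N g"
proof (rule field_le_epsilon)
  fix e :: real assume "e > 0"
  have "reach N (dil \<mu> (- g)) (\<mu> * (cc_norm N g + e / \<mu>))"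
    using assms \<open>e > 0\<close> by (intro reach_dil reach_cc_norm) auto
  moreover have "dil \<mu> (- g) = - dil \<mu> g" by (simp add: dil_def)
  ultimately show "cc_norm N (dil \<mu> g) \<le> \<mu> * cc_norm N g + e"
    using cc_norm_le[OF N, of "dil \<mu> g"] \<open>\<mu> > 0\<close> by (simp add: algebra_simps)
qed

lemma dil_dil: "dil a (dil b g) = dil (a * b) g"
  by (simp add: dil_def power_mult_distrib)

lemma dil_1 [simp]: "dil 1 g = g"
  by (simp add: dil_def)

lemma cc_norm_dil:
  assumes N: "is_norm N" and l: "\<mu> > 0" and g: "g \<in> G_carrier"
  shows "cc_norm N (dil \<mu> g) = \<mu> * cc_norm N g"
proof (rule antisym[OF cc_norm_dil_le[OF assms]])
  have "cc_norm N (dil (1 / \<mu>) (dil \<mu> g)) \<le> 1 / \<mu> * cc_norm N (dil \<mu> g)"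
    using assms by (intro cc_norm_dil_le dil_mem_G_carrier) auto
  then show "\<mu> * cc_norm N g \<le> cc_norm N (dil \<mu> g)"
    using l by (simp add: dil_dil field_simps)
qed

lemma norm_vertex_le: "j \<le> m \<Longrightarrow> norm (vertex w j) \<le> (\<Sum>i<m. norm (w i))"
proof -
  assume "j \<le> m"
  have "norm (vertex w j) \<le> (\<Sum>i<j. norm (w i))" unfolding vertex_def by (rule norm_sum)
  also have "\<dots> \<le> (\<Sum>i<m. norm (w i))" using \<open>j \<le> m\<close> by (intro sum_mono2) auto
  finally show ?thesis .
qed

text \<open>The cost controls the Euclidean length of the broken line, which bounds every vertex;
  the area is at most quadratic in it.\<close>

lemma reach_bounded:
  fixes N :: "real^'n \<Rightarrow> real"
  assumes N: "is_norm N"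
  obtains R where "R > 0" "\<And>p. reach N p L \<Longrightarrow> norm p \<le> R"
proof -
  obtain c where c: "c > 0" "\<And>x. c * norm x \<le> N x" using is_norm_lower[OF N] by blast
  obtain B where B: "B > 0" "\<And>v w :: real^'n. norm (wedge v w) \<le> B * norm v * norm w"
    using norm_wedge_le by blast
  define T where "T = \<bar>L\<bar> / c"
  have T0: "T \<ge> 0" using c(1) by (simp add: T_def)
  have "norm p \<le> 1 + T + B * T * T" if r: "reach N p L" for p
  proof -
    obtain m w where mw: "endpt m w = p" "cost N m w \<le> L" using r unfolding reach_def by blast
    have "c * (\<Sum>i<m. norm (w i)) \<le> cost N m w"
      unfolding cost_def sum_distrib_left by (intro sum_mono c)
    then have T: "(\<Sum>i<m. norm (w i)) \<le> T"
      using mw(2) c(1) by (simp add: T_def field_simps)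
    have v: "norm (vertex w j) \<le> T" if "j \<le> m" for j
      using norm_vertex_le[OF that, of w] T by simp
    have "norm (\<Sum>j<m. wedge (vertex w j) (w j)) \<le> (\<Sum>j<m. B * T * norm (w j))"
    proof (rule sum_norm_le)
      fix j assume "j \<in> {..<m}"
      then have "B * norm (vertex w j) * norm (w j) \<le> B * T * norm (w j)"
        using v[of j] B(1) by (intro mult_right_mono mult_left_mono) auto
      then show "norm (wedge (vertex w j) (w j)) \<le> B * T * norm (w j)"
        using B(2) order_trans by blast
    qed
    also have "\<dots> \<le> B * T * T"
      using T B(1) T0 by (simp add: sum_distrib_left[symmetric] mult_left_mono)
    finally have "norm (\<Sum>j<m. wedge (vertex w j) (w j)) \<le> B * T * T" .
    moreover have "norm (snd p) \<le> norm (\<Sum>j<m. wedge (vertex w j) (w j))"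
      using mw(1) by (auto simp: endpt_def)
    ultimately have "norm (snd p) \<le> B * T * T" by linarith
    moreover have "norm (fst p) \<le> T" using v[of m] mw(1) by (auto simp: endpt_def)
    moreover have "norm p \<le> norm (fst p) + norm (snd p)" using norm_Pair_le[of "fst p" "snd p"] by simp
    ultimately show ?thesis by linarith
  qed
  moreover have "1 + T + B * T * T > 0" using T0 B(1) by (simp add: add_pos_nonneg)
  ultimately show ?thesis using that by blast
qed

subsection \<open>Perturbation of broken lines\<close>

lemma midpoint_of_alt: "wedge (midpoint_of w j) (w j) = wedge (vertex w j) (w j)"
  by (simp add: midpoint_of_def wedge.add_left wedge.scaleR_left)

lemma vertex_add: "vertex (\<lambda>i. w i + h i) j = vertex w j + vertex h j"
  by (simp add: vertex_def sum.distrib)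

text \<open>Since \<open>endpt\<close> is quadratic, the second order expansion is exact. With
  vertices v_j and endpoint X of w, the increment h_j pairs with what precedes it, v_j, and with
  opposite sign with what follows it, X - v_j - w_j. Half the difference is the midpoint of segment
  j minus X/2. The quadratic term is the area of h itself.\<close>

lemma endpt_add:
  "endpt m (\<lambda>i. w i + h i) = endpt m w +
     (vertex h m, (\<Sum>j<m. wedge (midpoint_of w j) (h j)) - (1/2) *\<^sub>R wedge (vertex w m) (vertex h m)
        + (1/2) *\<^sub>R (\<Sum>j<m. wedge (vertex h j) (h j)))"
proof (induction m)
  case (Suc m)
  have "wedge (vertex h m) (w m) = - wedge (w m) (vertex h m)" by (rule wedge_skew)
  then show ?case
    unfolding endpt_Suc Suc
    by (simp add: gmult_def endpt_def vertex_add midpoint_of_def wedge.add_left wedge.add_right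
        wedge.scaleR_left algebra_simps flip: scaleR_add_left)
qed simp

lemma norm_area_le:
  fixes h :: "nat \<Rightarrow> real^'n"
  assumes B: "B > 0" "\<And>v w :: real^'n. norm (wedge v w) \<le> B * norm v * norm w"
  shows "norm (\<Sum>j<m. wedge (vertex h j) (h j)) \<le> B * (\<Sum>i<m. norm (h i))\<^sup>2"
proof -
  define S where "S = (\<Sum>i<m. norm (h i))"
  have "norm (\<Sum>j<m. wedge (vertex h j) (h j)) \<le> (\<Sum>j<m. (B * S) * norm (h j))"
  proof (rule sum_norm_le)
    fix j assume "j \<in> {..<m}"
    then have "B * norm (vertex h j) * norm (h j) \<le> (B * S) * norm (h j)"
      using norm_vertex_le[of j m h] B(1) by (intro mult_right_mono mult_left_mono) (auto simp: S_def)
    then show "norm (wedge (vertex h j) (h j)) \<le> (B * S) * norm (h j)"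
      using B(2)[of "vertex h j" "h j"] by linarith
  qed
  also have "\<dots> = (B * S) * S" unfolding S_def by (rule sum_distrib_left[symmetric])
  finally show ?thesis by (simp add: power2_eq_square mult.assoc flip: S_def)
qed

lemma abs_entry_le_norm: "\<bar>(Y :: real^'n^'n) $ a $ b\<bar> \<le> norm Y"
  using component_le_norm_cart[of "Y $ a" b] Finite_Cartesian_Product.norm_nth_le[of Y a] by linarith

text \<open>H solves the linearized problem for the basis bivectors at cost k. Matrices Z
  parametrize perturbations \<open>h Z\<close>; for antisymmetric Z the midpoint sum of
  \<open>h Z\<close> is Z, and a fixed point makes up for the quadratic effect. The bound does not
  involve M, since perturbations are measured by total length.\<close>

lemma perturb_word:
  fixes w :: "nat \<Rightarrow> real^'n"
  assumes B: "B \<ge> 1" "\<And>v w :: real^'n. norm (wedge v w) \<le> B * norm v * norm w"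
    and M: "M > 0" and w0: "w 0 = 0" and T: "T \<ge> 0" "(\<Sum>i<M. norm (w i)) \<le> T"
    and H: "\<And>a b. (\<Sum>j<M. wedge (midpoint_of w j) (H a b j)) = wedge (axis a 1) (axis b 1)"
    and k: "k \<ge> 1" "\<And>a b. (\<Sum>j<M. norm (H a b j)) \<le> k"
    and d: "d \<in> G_carrier"
    and \<kappa>: "\<kappa> = 4 * (real CARD('n))\<^sup>2 + 1"
    and small: "(1 + B * T) * norm d * (B * \<kappa>\<^sup>2 * k\<^sup>2) \<le> 1"
  shows "\<exists>h. endpt M (\<lambda>i. w i + h i) = endpt M w + d \<and>
     (\<Sum>i<M. norm (h i)) \<le> \<kappa> * (1 + B * T) * k * norm d"
proof (cases "d = 0")
  case True
  then show ?thesis by (intro exI[of _ "\<lambda>_. 0"]) auto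
next
  case False
  define r where "r = norm d"
  have r: "r > 0" using False by (simp add: r_def)
  \<comment> \<open>Bounds the part of \<Phi> that does not depend on Z. The quadratic part gets an
    equal share, hence the ball of radius \<open>2 * \<tau>\<close>.\<close>
  define \<tau> where "\<tau> = (1 + B * T) * r"
  have \<tau>r: "r \<le> \<tau>" using B(1) T(1) r by (simp add: \<tau>_def algebra_simps)
  have \<tau>: "\<tau> > 0" using \<tau>r r by linarith
  have xi: "norm (fst d) \<le> r" "norm (snd d) \<le> r"
    unfolding r_def by (metis norm_fst_le prod.collapse) (metis norm_snd_le prod.collapse)
  define h0 where "h0 = (\<lambda>(Z::real^'n^'n) j. \<Sum>(a,b)\<in>UNIV. (Z $ a $ b / 2) *\<^sub>R H a b j)"
  \<comment> \<open>The horizontal discrepancy is placed on segment 0. As \<open>w 0 = 0\<close>,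
    its midpoint is the origin, so this does not change the midpoint sum.\<close>
  define h where "h = (\<lambda>Z j. h0 Z j + (if j = 0 then fst d - (\<Sum>i<M. h0 Z i) else 0))"
  define Q where "Q = (\<lambda>Z. (1/2) *\<^sub>R (\<Sum>j<M. wedge (vertex (h Z) j) (h Z j)))"
  define X where "X = vertex w M"
  \<comment> \<open>For an antisymmetric fixed point Z, the linear effect Z and the remaining terms
    of the expansion add up to exactly \<open>snd d\<close>.\<close>
  define \<Phi> where "\<Phi> = (\<lambda>Z. snd d + (1/2) *\<^sub>R wedge X (fst d) - Q Z)"
  have X: "norm X \<le> T" unfolding X_def using norm_vertex_le[OF order_refl, of w M] T by linarith
  have sum_h: "vertex (h Z) M = fst d" for Z
    unfolding vertex_def h_def using M by (simp add: sum.distrib)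
  have lin: "(\<Sum>j<M. wedge (midpoint_of w j) (h Z j)) = (\<Sum>(a,b)\<in>UNIV. (Z $ a $ b / 2) *\<^sub>R wedge (axis a 1) (axis b 1))" for Z
  proof -
    have m0: "midpoint_of w 0 = 0" by (simp add: midpoint_of_def w0)
    have "wedge (midpoint_of w j) (h Z j) = wedge (midpoint_of w j) (h0 Z j)" for j
      by (auto simp: h_def m0)
    then have "(\<Sum>j<M. wedge (midpoint_of w j) (h Z j))
        = (\<Sum>j<M. \<Sum>(a,b)\<in>UNIV. (Z $ a $ b / 2) *\<^sub>R wedge (midpoint_of w j) (H a b j))"
      by (simp add: h0_def wedge.sum_right wedge.scaleR_right case_prod_beta)
    also have "\<dots> = (\<Sum>(a,b)\<in>UNIV. (Z $ a $ b / 2) *\<^sub>R (\<Sum>j<M. wedge (midpoint_of w j) (H a b j)))"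
      by (subst sum.swap) (simp add: case_prod_beta scaleR_sum_right)
    finally show ?thesis by (simp add: H)
  qed
  have h0_bound: "(\<Sum>j<M. norm (h0 Z j)) \<le> (real CARD('n))\<^sup>2 * k * norm Z" for Z
  proof -
    have "(\<Sum>j<M. norm (h0 Z j)) \<le> (\<Sum>j<M. \<Sum>(a,b)\<in>UNIV. norm Z * norm (H a b j))"
    proof (rule sum_mono)
      fix j
      have "norm (h0 Z j) \<le> (\<Sum>(a,b)\<in>UNIV. norm ((Z $ a $ b / 2) *\<^sub>R H a b j))"
        unfolding h0_def case_prod_beta by (rule norm_sum)
      also have "\<dots> \<le> (\<Sum>(a,b)\<in>UNIV. norm Z * norm (H a b j))"
      proof (rule sum_mono, clarify)
        fix a b
        have "\<bar>Z $ a $ b\<bar> / 2 \<le> norm Z" using abs_entry_le_norm[of Z a b] by simp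
        then have "\<bar>Z $ a $ b\<bar> / 2 * norm (H a b j) \<le> norm Z * norm (H a b j)"
          by (rule mult_right_mono) simp
        then show "norm ((Z $ a $ b / 2) *\<^sub>R H a b j) \<le> norm Z * norm (H a b j)" by simp
      qed
      finally show "norm (h0 Z j) \<le> (\<Sum>(a,b)\<in>UNIV. norm Z * norm (H a b j))" .
    qed
    also have "\<dots> = (\<Sum>(a,b)\<in>UNIV. norm Z * (\<Sum>j<M. norm (H a b j)))"
      by (subst sum.swap) (simp add: case_prod_beta sum_distrib_left)
    also have "\<dots> \<le> (\<Sum>(a,b)\<in>(UNIV::('n\<times>'n) set). norm Z * k)"
      unfolding case_prod_beta by (intro sum_mono mult_left_mono k) auto
    also have "\<dots> = (real CARD('n))\<^sup>2 * k * norm Z"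
      by (simp add: case_prod_beta power2_eq_square)
    finally show ?thesis .
  qed
  \<comment> \<open>\<open>h0\<close> counts twice, once directly and once in the correction on
    segment 0, with norm of Z at most \<open>2 * \<tau>\<close>. This gives the 4 n^2 in \<kappa>,
    and \<open>fst d\<close> gives the 1.\<close>
  have h_bound: "(\<Sum>j<M. norm (h Z j)) \<le> \<kappa> * k * \<tau>" if "norm Z \<le> 2 * \<tau>" for Z
  proof -
    have "(\<Sum>j<M. norm (h Z j)) \<le> (\<Sum>j<M. norm (h0 Z j) + (if j = 0 then norm (fst d - (\<Sum>i<M. h0 Z i)) else 0))"
      by (intro sum_mono) (auto simp: h_def intro: norm_triangle_ineq)
    also have "\<dots> = (\<Sum>j<M. norm (h0 Z j)) + norm (fst d - (\<Sum>i<M. h0 Z i))"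
      using M by (simp add: sum.distrib)
    also have "norm (fst d - (\<Sum>i<M. h0 Z i)) \<le> r + (\<Sum>i<M. norm (h0 Z i))"
      using norm_triangle_ineq4[of "fst d" "\<Sum>i<M. h0 Z i"] norm_sum[of "h0 Z" "{..<M}"] xi(1) by linarith
    also have "(\<Sum>j<M. norm (h0 Z j)) + (r + (\<Sum>i<M. norm (h0 Z i))) \<le> 2 * ((real CARD('n))\<^sup>2 * k * norm Z) + r"
      using h0_bound[of Z] by simp
    also have "(real CARD('n))\<^sup>2 * k * norm Z \<le> (real CARD('n))\<^sup>2 * k * (2 * \<tau>)"
      using that k(1) by (intro mult_left_mono) auto
    also have "r \<le> k * \<tau>" using \<tau>r k(1) \<tau> by (smt (verit) mult_le_cancel_right1)
    finally show ?thesis by (simp add: \<kappa> algebra_simps)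
  qed
  have Q_bound: "norm (Q Z) \<le> \<tau>" if "norm Z \<le> 2 * \<tau>" for Z
  proof -
    have "norm (Q Z) \<le> norm (\<Sum>j<M. wedge (vertex (h Z) j) (h Z j))"
      by (simp add: Q_def)
    also have "\<dots> \<le> B * (\<Sum>j<M. norm (h Z j))\<^sup>2"
      using B by (intro norm_area_le) auto
    also have "\<dots> \<le> B * (\<kappa> * k * \<tau>)\<^sup>2"
      using B(1) h_bound[OF that] by (intro mult_left_mono power_mono sum_nonneg) auto
    also have "\<dots> = \<tau> * (\<tau> * (B * \<kappa>\<^sup>2 * k\<^sup>2))" by (simp add: power2_eq_square algebra_simps)
    also have "\<dots> \<le> \<tau> * 1" using small \<tau> by (intro mult_left_mono) (auto simp: \<tau>_def r_def)
    finally show ?thesis by simp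
  qed
  have c0: "norm (snd d + (1/2) *\<^sub>R wedge X (fst d)) \<le> \<tau>"
  proof -
    have "norm (wedge X (fst d)) \<le> B * norm X * norm (fst d)" by (rule B(2))
    also have "\<dots> \<le> B * T * r" using B(1) X xi(1) T(1) by (intro mult_mono) auto
    finally have "norm (wedge X (fst d)) \<le> B * T * r" .
    moreover have "norm ((1/2) *\<^sub>R wedge X (fst d)) \<le> norm (wedge X (fst d))" by simp
    ultimately have "norm ((1/2) *\<^sub>R wedge X (fst d)) \<le> B * T * r" by linarith
    then show ?thesis
      using xi(2) norm_triangle_ineq[of "snd d" "(1/2) *\<^sub>R wedge X (fst d)"]
      by (simp add: \<tau>_def algebra_simps)
  qed
  have "\<Phi> \<in> cball 0 (2 * \<tau>) \<rightarrow> cball 0 (2 * \<tau>)"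
  proof
    fix Z :: "real^'n^'n" assume "Z \<in> cball 0 (2 * \<tau>)"
    then have "norm (Q Z) \<le> \<tau>" by (intro Q_bound) simp
    then show "\<Phi> Z \<in> cball 0 (2 * \<tau>)"
      using c0 norm_triangle_ineq4[of "snd d + (1/2) *\<^sub>R wedge X (fst d)" "Q Z"]
      by (simp add: \<Phi>_def)
  qed
  moreover have "continuous_on (cball 0 (2 * \<tau>)) \<Phi>"
  proof -
    have ch: "continuous_on (cball 0 (2 * \<tau>)) (\<lambda>Z. h Z j)" for j
      unfolding h_def h0_def case_prod_beta
      by (cases "j = 0") (auto intro!: continuous_intros)
    show ?thesis
      unfolding \<Phi>_def Q_def vertex_def by (intro continuous_intros wedge.continuous_on ch)
  qed
  ultimately obtain Z where Z: "Z \<in> cball 0 (2 * \<tau>)" "\<Phi> Z = Z"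
    using brouwer_ball[of "2 * \<tau>" 0 \<Phi>] \<tau> by auto
  \<comment> \<open>Brouwer's theorem was applied in the space of all matrices; the fixed point
    inherits antisymmetry from the value \<open>\<Phi> Z\<close>.\<close>
  have "\<forall>i j. Z $ i $ j = - Z $ j $ i"
  proof (intro allI)
    fix i j
    have "Q Z $ i $ j = - Q Z $ j $ i"
      using G_carrier_skew[OF endpt_mem_G_carrier[of M "h Z"], of i j] by (simp add: endpt_def Q_def)
    then show "Z $ i $ j = - Z $ j $ i"
      using G_carrier_skew[OF d, of i j] wedge_nth[of X "fst d" i j] wedge_nth[of X "fst d" j i]
      by (subst (1 2) Z(2)[symmetric]) (simp add: \<Phi>_def algebra_simps)
  qed
  then have "(\<Sum>j<M. wedge (midpoint_of w j) (h Z j)) = Z"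
    unfolding lin by (rule wedge_basis_expansion[symmetric])
  moreover have "Z = snd d + (1/2) *\<^sub>R wedge X (fst d) - Q Z"
    using Z(2) by (simp add: \<Phi>_def)
  ultimately have "(\<Sum>j<M. wedge (midpoint_of w j) (h Z j)) - (1/2) *\<^sub>R wedge (vertex w M) (fst d)
        + (1/2) *\<^sub>R (\<Sum>j<M. wedge (vertex (h Z) j) (h Z j)) = snd d"
    by (simp add: X_def Q_def algebra_simps)
  then have "endpt M (\<lambda>i. w i + h Z i) = endpt M w + d"
    unfolding endpt_add sum_h by simp
  moreover have "(\<Sum>i<M. norm (h Z i)) \<le> \<kappa> * (1 + B * T) * k * norm d"
    using h_bound[of Z] Z(1) by (simp add: \<tau>_def r_def algebra_simps)
  ultimately show ?thesis by blast
qed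

subsection \<open>Distance near the abnormal set\<close>

text \<open>The projection along the axes a and b onto a subspace of codimension two, a graph over
  the other coordinates with slopes at most 1. The bound on the slopes keeps the family of subspaces
  compact, so that finitely many cells cover it at each scale.\<close>

definition graph_projection :: "'n \<Rightarrow> 'n \<Rightarrow> real^'n^'n \<Rightarrow> bool" where
  "graph_projection a b P \<longleftrightarrow> a \<noteq> b \<and> (\<forall>i. P $ i $ a = 0 \<and> P $ i $ b = 0) \<and>
     (\<forall>i j. i \<noteq> a \<longrightarrow> i \<noteq> b \<longrightarrow> P $ i $ j = (if i = j \<and> j \<noteq> a \<and> j \<noteq> b then 1 else 0)) \<and>
     (\<forall>j. \<bar>P $ a $ j\<bar> \<le> 1 \<and> \<bar>P $ b $ j\<bar> \<le> 1)"

text \<open>The map induced by P on bivectors, in matrix form P Y P^T.\<close>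

definition push_forward :: "real^'n^'n \<Rightarrow> real^'n^'n \<Rightarrow> real^'n^'n" where
  "push_forward P Y = (\<chi> i j. \<Sum>k\<in>UNIV. \<Sum>l\<in>UNIV. P $ i $ k * P $ j $ l * Y $ k $ l)"

text \<open>For s = 0 these are the pairs with x in V and Y in the second exterior power of V, for
  some such graph V of codimension two. Closeness is expressed by the residuals of the projection,
  which scale explicitly under dilations.\<close>

definition near_abnormal :: "real \<Rightarrow> ((real^'n) \<times> (real^'n^'n)) set" where
  "near_abnormal s = {p \<in> G_carrier. \<exists>a b P. graph_projection a b P \<and>
     (\<forall>i. \<bar>(fst p - P *v fst p) $ i\<bar> \<le> s) \<and>
     (\<forall>i j. \<bar>(snd p - push_forward P (snd p)) $ i $ j\<bar> \<le> s)}"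

text \<open>The effects achievable with total length at most 1 form a convex set, because budgets
  mix convexly, and this set contains the effect of every single segment.\<close>

lemma convex_hull_wedge_sum:
  fixes x :: "nat \<Rightarrow> real^'n"
  assumes "Z \<in> convex hull (\<Union>j<M. (\<lambda>h. wedge (x j) h) ` cball 0 1)"
  shows "\<exists>h. (\<Sum>j<M. wedge (x j) (h j)) = Z \<and> (\<Sum>j<M. norm (h j)) \<le> 1"
proof -
  define T where "T = {Z. \<exists>h. (\<Sum>j<M. wedge (x j) (h j)) = Z \<and> (\<Sum>j<M. norm (h j)) \<le> 1}"
  have "convex hull (\<Union>j<M. (\<lambda>h. wedge (x j) h) ` cball 0 1) \<subseteq> T"
  proof (rule hull_minimal)
    show "(\<Union>j<M. (\<lambda>h. wedge (x j) h) ` cball 0 1) \<subseteq> T"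
    proof clarify
      fix j h assume j: "j < M" and h: "h \<in> cball (0::real^'n) 1"
      have "(\<Sum>i<M. wedge (x i) (if i = j then h else 0)) = (\<Sum>i<M. if i = j then wedge (x j) h else 0)"
        by (rule sum.cong) auto
      moreover have "(\<Sum>i<M. norm (if i = j then h else 0)) = (\<Sum>i<M. if i = j then norm h else 0)"
        by (rule sum.cong) auto
      ultimately show "wedge (x j) h \<in> T"
        unfolding T_def using j h by (intro CollectI exI[of _ "\<lambda>i. if i = j then h else 0"]) simp
    qed
    show "convex T"
    proof (rule convexI)
      fix Z Z' and u v :: real assume "Z \<in> T" "Z' \<in> T" and uv: "0 \<le> u" "0 \<le> v" "u + v = 1"
      then obtain h h' where h: "(\<Sum>j<M. wedge (x j) (h j)) = Z" "(\<Sum>j<M. norm (h j)) \<le> 1"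
        and h': "(\<Sum>j<M. wedge (x j) (h' j)) = Z'" "(\<Sum>j<M. norm (h' j)) \<le> 1"
        unfolding T_def by blast
      have eq: "(\<Sum>j<M. wedge (x j) (u *\<^sub>R h j + v *\<^sub>R h' j)) = u *\<^sub>R Z + v *\<^sub>R Z'"
        by (simp add: wedge.add_right wedge.scaleR_right sum.distrib scaleR_sum_right flip: h(1) h'(1))
      have "(\<Sum>j<M. norm (u *\<^sub>R h j + v *\<^sub>R h' j)) \<le> (\<Sum>j<M. u * norm (h j) + v * norm (h' j))"
        using uv by (intro sum_mono) (auto intro: norm_triangle_le)
      also have "\<dots> = u * (\<Sum>j<M. norm (h j)) + v * (\<Sum>j<M. norm (h' j))"
        by (simp add: sum.distrib sum_distrib_left)
      also have "\<dots> \<le> u * 1 + v * 1" using uv h(2) h'(2) by (intro add_mono mult_left_mono)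
      finally have "(\<Sum>j<M. norm (u *\<^sub>R h j + v *\<^sub>R h' j)) \<le> 1" using uv by simp
      with eq show "u *\<^sub>R Z + v *\<^sub>R Z' \<in> T"
        unfolding T_def by (intro CollectI exI[of _ "\<lambda>j. u *\<^sub>R h j + v *\<^sub>R h' j"] conjI)
    qed
  qed
  then show ?thesis using assms unfolding T_def by blast
qed

text \<open>Read as a linear form in h, the pairing sees A only through its antisymmetric
  part.\<close>

lemma inner_wedge:
  fixes A :: "real^'n^'n"
  shows "inner A (wedge v h) = (\<Sum>k\<in>UNIV. h $ k * (\<Sum>i\<in>UNIV. (A $ i $ k - A $ k $ i) * v $ i))"
proof -
  have "inner A (wedge v h) = (\<Sum>i\<in>UNIV. \<Sum>k\<in>UNIV. A $ i $ k * (v $ i * h $ k)) - (\<Sum>i\<in>UNIV. \<Sum>k\<in>UNIV. A $ i $ k * (h $ i * v $ k))"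
    by (simp add: inner_vec_def wedge_nth right_diff_distrib sum_subtractf)
  also have "(\<Sum>i\<in>UNIV. \<Sum>k\<in>UNIV. A $ i $ k * (v $ i * h $ k)) = (\<Sum>k\<in>UNIV. \<Sum>i\<in>UNIV. A $ i $ k * (v $ i * h $ k))"
    by (rule sum.swap)
  finally show ?thesis
    by (simp add: sum_distrib_left sum_subtractf[symmetric] algebra_simps)
qed

text \<open>If Z is out of reach, a hyperplane with normal A separates it from the hull. Then D = A
  - A^T nearly annihilates all the x_j, and the two relations through the largest entry of D exhibit
  the projection that \<open>bad\<close> excludes.\<close>

lemma span_dichotomy:
  fixes x :: "nat \<Rightarrow> real^'n"
  assumes M: "M > 0"
    and bad: "\<not> (\<exists>a b P. graph_projection a b P \<and> (\<forall>j<M. \<forall>i. \<bar>(x j - P *v x j) $ i\<bar> \<le> \<sigma>))"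
    and Z: "\<forall>i j. Z $ i $ j = - Z $ j $ i" "(real CARD('n))\<^sup>2 * norm Z \<le> \<sigma>"
  shows "\<exists>h. (\<Sum>j<M. wedge (x j) (h j)) = Z \<and> (\<Sum>j<M. norm (h j)) \<le> 1"
proof (rule ccontr)
  define S where "S = (\<Union>j<M. (\<lambda>h. wedge (x j) h) ` cball 0 1)"
  assume "\<not> ?thesis"
  then have "Z \<notin> convex hull S" using convex_hull_wedge_sum[of Z x M] unfolding S_def by blast
  moreover have "compact S"
    unfolding S_def
    by (intro compact_UN compact_continuous_image wedge.continuous_on continuous_intros) auto
  then have "closed (convex hull S)" by (intro compact_imp_closed compact_convex_hull)
  ultimately obtain A c where A: "inner A Z < c" "\<And>y. y \<in> convex hull S \<Longrightarrow> c < inner A y"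
    using separating_hyperplane_closed_point[OF convex_convex_hull] by metis
  have inS: "c < inner A (wedge (x j) h)" if "j < M" "norm h \<le> 1" for j h
    using that unfolding S_def[symmetric] by (intro A(2) hull_inc) (force simp: S_def)
  \<comment> \<open>The hull contains 0, the effect of h = 0.\<close>
  have c0: "c < 0" using inS[of 0 0] M by simp
  define D where "D = (\<lambda>i k. A $ i $ k - A $ k $ i)"
  have D_skew: "D i k = - D k i" for i k by (simp add: D_def)
  \<comment> \<open>Testing the hyperplane with both signs of the k-th unit vector bounds the sum
    from both sides.\<close>
  have row: "\<bar>\<Sum>i\<in>UNIV. D i k * x j $ i\<bar> < - c" if "j < M" for j k
  proof -
    have eq: "inner A (wedge (x j) (t *\<^sub>R axis k 1)) = t * (\<Sum>i\<in>UNIV. D i k * x j $ i)" for t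
    proof -
      have "inner A (wedge (x j) (t *\<^sub>R axis k 1)) = (\<Sum>k'\<in>UNIV. if k' = k then t * (\<Sum>i\<in>UNIV. D i k' * x j $ i) else 0)"
        unfolding inner_wedge D_def by (rule sum.cong) (auto simp: axis_def)
      then show ?thesis by simp
    qed
    then show ?thesis
      using inS[OF that, of "1 *\<^sub>R axis k 1"] inS[OF that, of "(-1) *\<^sub>R axis k 1"]
      unfolding eq by simp
  qed
  have "2 * inner A Z = (\<Sum>i\<in>UNIV. \<Sum>k\<in>UNIV. A $ i $ k * Z $ i $ k) + (\<Sum>k\<in>UNIV. \<Sum>i\<in>UNIV. A $ i $ k * Z $ i $ k)"
    by (subst (2) sum.swap) (simp add: inner_vec_def)
  also have "(\<Sum>k\<in>UNIV. \<Sum>i\<in>UNIV. A $ i $ k * Z $ i $ k) = (\<Sum>k\<in>UNIV. \<Sum>i\<in>UNIV. - (A $ i $ k * Z $ k $ i))"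
    using Z(1) by (intro sum.cong refl) (metis mult_minus_right)
  finally have AZ: "2 * inner A Z = (\<Sum>i\<in>UNIV. \<Sum>k\<in>UNIV. D i k * Z $ i $ k)"
    by (simp add: D_def left_diff_distrib sum_subtractf sum_negf)
  \<comment> \<open>Taking an entry of largest absolute value as pivot keeps all slopes of the graph
    at most 1. It lies off the diagonal, as D is antisymmetric and will turn out nonzero.\<close>
  obtain a b where ab: "\<And>i k. \<bar>D i k\<bar> \<le> \<bar>D a b\<bar>"
  proof -
    let ?f = "\<lambda>q. \<bar>D (fst q) (snd q)\<bar>"
    have "Max (range ?f) \<in> range ?f" by (rule Max_in) auto
    then obtain p where p: "?f p = Max (range ?f)" by (metis (no_types, lifting) rangeE)
    have "?f q \<le> ?f p" for q unfolding p by (rule Max_ge) auto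
    then have "\<bar>D i k\<bar> \<le> \<bar>D (fst p) (snd p)\<bar>" for i k
      using fst_conv snd_conv by metis
    then show ?thesis by (rule that)
  qed
  define \<mu> where "\<mu> = \<bar>D a b\<bar>"
  have "- (2 * inner A Z) \<le> (\<Sum>i\<in>(UNIV::'n set). \<Sum>k\<in>(UNIV::'n set). \<mu> * norm Z)"
    unfolding AZ sum_negf[symmetric]
  proof (intro sum_mono)
    fix i k
    have "\<bar>D i k * Z $ i $ k\<bar> \<le> \<mu> * norm Z"
      unfolding abs_mult using ab[of i k] abs_entry_le_norm[of Z i k] by (intro mult_mono) (auto simp: \<mu>_def)
    then show "- (D i k * Z $ i $ k) \<le> \<mu> * norm Z" by linarith
  qed
  also have "\<dots> = \<mu> * ((real CARD('n))\<^sup>2 * norm Z)" by (simp add: power2_eq_square)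
  also have "\<dots> \<le> \<mu> * \<sigma>" using Z(2) by (intro mult_left_mono) (auto simp: \<mu>_def)
  finally have c: "- c \<le> \<mu> * \<sigma>" using A(1) c0 by linarith
  have \<mu>: "\<mu> > 0" using c c0 by (cases "\<mu> = 0") (auto simp: \<mu>_def)
  then have Dab: "D a b \<noteq> 0" and ne: "a \<noteq> b" using D_skew[of a a] by (auto simp: \<mu>_def)
  \<comment> \<open>The relation from column b of D does not contain the coordinate b of x, since
    \<open>D b b = 0\<close>, and is solved for the coordinate a; likewise column a is solved for
    the coordinate b. So the two relations decouple.\<close>
  define P :: "real^'n^'n" where "P = (\<chi> i j. if j = a \<or> j = b then 0 else
      if i = a then - D j b / D a b else if i = b then - D j a / D b a else if i = j then 1 else 0)"
  have Dba: "D b a = - D a b" by (rule D_skew)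
  then have Dba0: "D b a \<noteq> 0" using Dab by simp
  have "graph_projection a b P"
    unfolding graph_projection_def using ne ab Dab Dba by (auto simp: P_def divide_le_eq_1)
  moreover have "\<forall>j<M. \<forall>i. \<bar>(x j - P *v x j) $ i\<bar> \<le> \<sigma>"
  proof (intro allI impI)
    fix j i assume j: "j < M"
    have quot: "\<bar>(\<Sum>i\<in>UNIV. D i k * x j $ i) / D p q\<bar> \<le> \<sigma>" if "\<bar>D p q\<bar> = \<mu>" for k p q
      using row[OF j, of k] c \<mu> that by (simp add: divide_le_eq mult.commute)
    have split: "(\<Sum>l\<in>UNIV. f l) = f a + f b + (\<Sum>l\<in>UNIV - {a, b}. f l)" for f :: "'n \<Rightarrow> real"
      using ne by (subst sum.subset_diff[of "{a,b}"]) auto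
    consider "i = a" | "i = b" | "i \<noteq> a" "i \<noteq> b" by blast
    then show "\<bar>(x j - P *v x j) $ i\<bar> \<le> \<sigma>"
    proof cases
      case 1
      have "(x j - P *v x j) $ i = x j $ a + (\<Sum>l\<in>UNIV - {a, b}. D l b / D a b * x j $ l)"
      proof -
        have "(P *v x j) $ a = (\<Sum>l\<in>UNIV. P $ a $ l * x j $ l)"
          by (simp add: matrix_vector_mult_def)
        also have "\<dots> = (\<Sum>l\<in>UNIV - {a, b}. P $ a $ l * x j $ l)"
          unfolding split by (simp add: P_def)
        also have "\<dots> = (\<Sum>l\<in>UNIV - {a, b}. - (D l b / D a b * x j $ l))"
          using ne by (intro sum.cong) (auto simp: P_def)
        finally show ?thesis unfolding 1 by (simp add: sum_negf)
      qed
      also have "\<dots> = (\<Sum>i\<in>UNIV. D i b * x j $ i) / D a b"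
        using Dab D_skew[of b b] by (simp add: split add_divide_distrib sum_divide_distrib)
      finally show ?thesis using quot[of a b b] by (simp add: \<mu>_def)
    next
      case 2
      have "(x j - P *v x j) $ i = x j $ b + (\<Sum>l\<in>UNIV - {a, b}. D l a / D b a * x j $ l)"
      proof -
        have "(P *v x j) $ b = (\<Sum>l\<in>UNIV. P $ b $ l * x j $ l)"
          by (simp add: matrix_vector_mult_def)
        also have "\<dots> = (\<Sum>l\<in>UNIV - {a, b}. P $ b $ l * x j $ l)"
          unfolding split by (simp add: P_def)
        also have "\<dots> = (\<Sum>l\<in>UNIV - {a, b}. - (D l a / D b a * x j $ l))"
          using ne by (intro sum.cong) (auto simp: P_def)
        finally show ?thesis unfolding 2 by (simp add: sum_negf)
      qed
      also have "\<dots> = (\<Sum>i\<in>UNIV. D i a * x j $ i) / D b a"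
        using Dba0 D_skew[of a a]
        by (simp add: split add_divide_distrib sum_divide_distrib )
      finally show ?thesis using quot[of b a a] Dba by (simp add: \<mu>_def)
    next
      case 3
      have "(P *v x j) $ i = (\<Sum>l\<in>UNIV. if l = i then x j $ l else 0)"
        unfolding matrix_vector_mult_def vec_lambda_beta using 3 by (intro sum.cong) (auto simp: P_def)
      moreover have "\<sigma> \<ge> 0" using \<mu> c c0 by (smt (verit) mult_nonneg_nonpos)
      ultimately show ?thesis by simp
    qed
  qed
  ultimately show False using bad by blast
qed

section \<open>Endpoints of broken lines whose midpoints lie near a subspace\<close>

lemma push_forward_wedge: "push_forward P (wedge v w) = wedge (P *v v) (P *v w)"
proof -
  have "push_forward P (wedge v w) $ i $ j = wedge (P *v v) (P *v w) $ i $ j" for i j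
  proof -
    have "push_forward P (wedge v w) $ i $ j
        = (\<Sum>k\<in>UNIV. \<Sum>l\<in>UNIV. (P $ i $ k * v $ k) * (P $ j $ l * w $ l))
        - (\<Sum>k\<in>UNIV. \<Sum>l\<in>UNIV. (P $ i $ k * w $ k) * (P $ j $ l * v $ l))"
      by (simp add: push_forward_def wedge_nth sum_subtractf[symmetric] algebra_simps)
    then show ?thesis
      unfolding sum_product[symmetric] by (simp add: wedge_nth matrix_vector_mult_def)
  qed
  then show ?thesis by (simp add: vec_eq_iff)
qed

lemma push_forward_linear: "linear (push_forward P)"
  by (rule linearI) (simp_all add: push_forward_def vec_eq_iff sum.distrib[symmetric] sum_distrib_left algebra_simps)

lemma graph_projection_entry: "graph_projection a b P \<Longrightarrow> \<bar>P $ i $ j\<bar> \<le> 1"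
  unfolding graph_projection_def by (cases "i = a"; cases "i = b") auto

lemma norm_graph_projection_le:
  fixes P :: "real^'n^'n"
  assumes "graph_projection a b P"
  shows "norm (P *v v) \<le> (real CARD('n))\<^sup>2 * norm v"
proof -
  have "\<bar>(P *v v) $ i\<bar> \<le> (\<Sum>j\<in>(UNIV::'n set). norm v)" for i
  proof -
    have "\<bar>(P *v v) $ i\<bar> \<le> (\<Sum>j\<in>UNIV. \<bar>P $ i $ j * v $ j\<bar>)"
      unfolding matrix_vector_mult_def by (simp add: sum_abs)
    also have "\<dots> \<le> (\<Sum>j\<in>(UNIV::'n set). norm v)"
    proof (rule sum_mono)
      fix j
      have "\<bar>P $ i $ j\<bar> * \<bar>v $ j\<bar> \<le> 1 * norm v"
        by (intro mult_mono graph_projection_entry[OF assms] component_le_norm_cart) auto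
      then show "\<bar>P $ i $ j * v $ j\<bar> \<le> norm v" by (simp add: abs_mult)
    qed
    finally show ?thesis .
  qed
  then have "(\<Sum>i\<in>UNIV. \<bar>(P *v v) $ i\<bar>) \<le> (\<Sum>i\<in>(UNIV::'n set). \<Sum>j\<in>(UNIV::'n set). norm v)"
    by (intro sum_mono)
  then show ?thesis
    using norm_le_l1_cart[of "P *v v"] by (simp add: power2_eq_square)
qed

text \<open>Discrete Leibniz rule; it replaces integration by parts.\<close>

lemma sum_wedge_by_parts:
  "(\<Sum>j<m. wedge (midpoint_of v j) (w j)) =
     wedge (vertex v m) (vertex w m) + (\<Sum>j<m. wedge (midpoint_of w j) (v j))"
proof (induction m)
  case (Suc m)
  have "wedge (v m) (vertex w m) = - wedge (vertex w m) (v m)" "wedge (w m) (v m) = - wedge (v m) (w m)"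
    by (rule wedge_skew)+
  then show ?case
    unfolding sum.lessThan_Suc Suc
    by (simp add: midpoint_of_def wedge.add_left wedge.add_right wedge.scaleR_left algebra_simps)
qed simp

lemma mult_vertex: "P *v vertex w j = vertex (\<lambda>i. P *v w i) j"
  by (simp add: vertex_def linear_sum[OF matrix_vector_mul_linear])

lemma mult_midpoint_of: "P *v midpoint_of w j = midpoint_of (\<lambda>i. P *v w i) j"
  by (simp add: midpoint_of_def mult_vertex matrix_vector_right_distrib matrix_vector_mult_scaleR)

text \<open>With p = P w and q = w - p, the midpoints of q are small, but the sum of the |q_j| need
  not be. So the sum in which increments of q occur is rewritten by parts in terms of midpoints of
  q, and the bound depends only on the total length T.\<close>

lemma endpt_near_abnormal:
  fixes w :: "nat \<Rightarrow> real^'n"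
  assumes B: "B > 0" "\<And>v w :: real^'n. norm (wedge v w) \<le> B * norm v * norm w"
    and M: "w M = 0" and T: "(\<Sum>i<Suc M. norm (w i)) \<le> T"
    and P: "graph_projection a b P"
    and small: "\<And>j i. j < Suc M \<Longrightarrow> \<bar>(midpoint_of w j - P *v midpoint_of w j) $ i\<bar> \<le> \<sigma>"
    and C: "C = 1 + B * real CARD('n) * T * (1 + (real CARD('n))\<^sup>2)"
  shows "endpt (Suc M) w \<in> near_abnormal (C * \<sigma>)"
proof -
  define n where "n = real CARD('n)"
  have n: "n \<ge> 1" by (simp add: n_def Suc_leI)
  have T0: "T \<ge> 0" using T sum_nonneg[of "{..<Suc M}" "\<lambda>i. norm (w i)"] by simp
  have \<sigma>0: "\<sigma> \<ge> 0" using small[of 0] abs_ge_zero order_trans by blast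
  define p where "p = (\<lambda>i. P *v w i)"
  define q where "q = (\<lambda>i. w i - p i)"
  have vq: "vertex q j = vertex w j - P *v vertex w j" for j
    by (simp add: q_def p_def mult_vertex) (simp add: vertex_def sum_subtractf)
  have mq: "midpoint_of q j = midpoint_of w j - P *v midpoint_of w j" for j
    by (simp add: midpoint_of_def vq) (simp add: q_def p_def algebra_simps matrix_vector_right_distrib matrix_vector_mult_scaleR)
  have nq: "norm (midpoint_of q j) \<le> n * \<sigma>" if "j < Suc M" for j
  proof -
    have "norm (midpoint_of q j) \<le> (\<Sum>i\<in>UNIV. \<bar>midpoint_of q j $ i\<bar>)" by (rule norm_le_l1_cart)
    also have "\<dots> \<le> (\<Sum>i\<in>(UNIV::'n set). \<sigma>)" unfolding mq by (intro sum_mono small that)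
    finally show ?thesis by (simp add: n_def)
  qed
  \<comment> \<open>The final zero increment makes the last midpoint the endpoint, so the residual
    of the endpoint is small too.\<close>
  have last: "midpoint_of w M = vertex w (Suc M)" "midpoint_of q M = vertex q (Suc M)"
    by (simp_all add: midpoint_of_def M q_def p_def)
  have np: "norm (p j) \<le> n\<^sup>2 * norm (w j)" for j
    unfolding p_def n_def by (rule norm_graph_projection_le[OF P])
  define X where "X = vertex w (Suc M)"
  define Y where "Y = snd (endpt (Suc M) w)"
  have nX: "norm (vertex p (Suc M)) \<le> n\<^sup>2 * T"
  proof -
    have "norm (vertex p (Suc M)) \<le> n\<^sup>2 * norm X"
      unfolding p_def mult_vertex[symmetric] X_def n_def by (rule norm_graph_projection_le[OF P])
    also have "\<dots> \<le> n\<^sup>2 * T"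
      using norm_vertex_le[OF order_refl, of w "Suc M"] T by (intro mult_left_mono) (auto simp: X_def)
    finally show ?thesis .
  qed
  have Y: "Y = (1/2) *\<^sub>R (\<Sum>j<Suc M. wedge (midpoint_of w j) (w j))"
    by (simp add: Y_def endpt_def midpoint_of_alt)
  have pY: "push_forward P Y = (1/2) *\<^sub>R (\<Sum>j<Suc M. wedge (midpoint_of p j) (p j))"
    unfolding Y linear_cmul[OF push_forward_linear] linear_sum[OF push_forward_linear]
      push_forward_wedge mult_midpoint_of p_def ..
  have pm: "midpoint_of p j = P *v midpoint_of w j" for j by (simp add: p_def mult_midpoint_of)
  have "(\<Sum>j<Suc M. wedge (midpoint_of w j) (w j)) - (\<Sum>j<Suc M. wedge (midpoint_of p j) (p j))
      = (\<Sum>j<Suc M. wedge (midpoint_of q j) (w j)) + (\<Sum>j<Suc M. wedge (midpoint_of p j) (q j))"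
    unfolding sum_subtractf[symmetric] sum.distrib[symmetric] mq pm
    by (simp add: q_def wedge.diff_left wedge.diff_right)
  then have split: "2 *\<^sub>R (Y - push_forward P Y) = (\<Sum>j<Suc M. wedge (midpoint_of q j) (w j))
      + (wedge (vertex p (Suc M)) (vertex q (Suc M)) + (\<Sum>j<Suc M. wedge (midpoint_of q j) (p j)))"
    unfolding sum_wedge_by_parts[of p q]
    by (subst pY, subst Y) (simp add: scaleR_diff_right del: sum.lessThan_Suc vertex_Suc)
  have s1: "norm (\<Sum>j<Suc M. wedge (midpoint_of q j) (w j)) \<le> B * (n * \<sigma>) * T"
  proof -
    have "norm (\<Sum>j<Suc M. wedge (midpoint_of q j) (w j)) \<le> (\<Sum>j<Suc M. B * (n * \<sigma>) * norm (w j))"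
    proof (rule sum_norm_le)
      fix j assume "j \<in> {..<Suc M}"
      then have "B * norm (midpoint_of q j) * norm (w j) \<le> B * (n * \<sigma>) * norm (w j)"
        using nq[of j] B(1) by (intro mult_right_mono mult_left_mono) auto
      then show "norm (wedge (midpoint_of q j) (w j)) \<le> B * (n * \<sigma>) * norm (w j)"
        using B(2) order_trans by blast
    qed
    also have "\<dots> \<le> B * (n * \<sigma>) * T"
      unfolding sum_distrib_left[symmetric] using T B(1) n \<sigma>0 by (intro mult_left_mono) auto
    finally show ?thesis .
  qed
  have s2: "norm (\<Sum>j<Suc M. wedge (midpoint_of q j) (p j)) \<le> B * (n * \<sigma>) * (n\<^sup>2 * T)"
  proof -
    have "norm (\<Sum>j<Suc M. wedge (midpoint_of q j) (p j)) \<le> (\<Sum>j<Suc M. B * (n * \<sigma>) * (n\<^sup>2 * norm (w j)))"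
    proof (rule sum_norm_le)
      fix j assume "j \<in> {..<Suc M}"
      then have "B * norm (midpoint_of q j) * norm (p j) \<le> B * (n * \<sigma>) * (n\<^sup>2 * norm (w j))"
        using nq[of j] B(1) np[of j] n \<sigma>0 by (intro mult_mono) auto
      then show "norm (wedge (midpoint_of q j) (p j)) \<le> B * (n * \<sigma>) * (n\<^sup>2 * norm (w j))"
        using B(2) order_trans by blast
    qed
    also have "\<dots> \<le> B * (n * \<sigma>) * (n\<^sup>2 * T)"
      unfolding sum_distrib_left[symmetric] using T B(1) n \<sigma>0 by (intro mult_left_mono) auto
    finally show ?thesis .
  qed
  have s3: "norm (wedge (vertex p (Suc M)) (vertex q (Suc M))) \<le> B * (n\<^sup>2 * T) * (n * \<sigma>)"
  proof -
    have "B * norm (vertex p (Suc M)) * norm (vertex q (Suc M)) \<le> B * (n\<^sup>2 * T) * (n * \<sigma>)"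
      using nq[of M] last(2) nX B(1) n \<sigma>0 T0 by (intro mult_mono) auto
    then show ?thesis using B(2) order_trans by blast
  qed
  have "2 * norm (Y - push_forward P Y) = norm (2 *\<^sub>R (Y - push_forward P Y))" by simp
  also have "\<dots> \<le> B * (n * \<sigma>) * T + (B * (n\<^sup>2 * T) * (n * \<sigma>) + B * (n * \<sigma>) * (n\<^sup>2 * T))"
    unfolding split by (intro order_trans[OF norm_triangle_ineq] add_mono s1 s2 s3)
  also have "\<dots> \<le> 2 * (C * \<sigma>)"
    using B(1) n \<sigma>0 T0 by (simp add: C flip: n_def) (simp add: algebra_simps)
  finally have nY: "norm (Y - push_forward P Y) \<le> C * \<sigma>" by simp
  have C1: "C \<ge> 1" using B(1) n T0 by (simp add: C flip: n_def)
  have "\<bar>(X - P *v X) $ i\<bar> \<le> C * \<sigma>" for i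
    using small[of M i] last(1) C1 \<sigma>0 mult_right_mono[of 1 C \<sigma>] by (simp add: X_def)
  moreover have "\<bar>(Y - push_forward P Y) $ i $ j\<bar> \<le> C * \<sigma>" for i j
    using abs_entry_le_norm[of "Y - push_forward P Y" i j] nY by linarith
  moreover have "fst (endpt (Suc M) w) = X" by (simp add: endpt_def X_def)
  ultimately show ?thesis
    unfolding near_abnormal_def using P endpt_mem_G_carrier Y_def by blast
qed

text \<open>Passes from the endpoint \<open>- g\<close> of a broken line back to g.\<close>

lemma near_abnormal_uminus: "p \<in> near_abnormal s \<Longrightarrow> - p \<in> near_abnormal s"
proof -
  have "\<bar>(fst (-p) - P *v fst (-p)) $ i\<bar> = \<bar>(fst p - P *v fst p) $ i\<bar>" for P i
    by (simp add: linear_neg[OF matrix_vector_mul_linear])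
  moreover have "\<bar>(snd (-p) - push_forward P (snd (-p))) $ i $ j\<bar> = \<bar>(snd p - push_forward P (snd p)) $ i $ j\<bar>" for P i j
    by (simp add: linear_neg[OF push_forward_linear])
  moreover assume "p \<in> near_abnormal s"
  ultimately show ?thesis
    unfolding near_abnormal_def using subspace_neg[OF subspace_G_carrier, of p] by simp
qed

text \<open>Prepending and appending a zero vector makes both ends of the broken line midpoints.\<close>

lemma reach_padded:
  assumes "is_norm N" "reach N p L"
  obtains M w where "endpt (Suc M) w = p" "cost N (Suc M) w \<le> L" "w 0 = 0" "w M = 0"
proof -
  obtain m w where mw: "endpt m w = p" "cost N m w \<le> L" using assms(2) unfolding reach_def by blast
  define w1 where "w1 = (\<lambda>i. if i < 1 then (\<lambda>_. 0) i else w (i - 1))"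
  define w2 where "w2 = (\<lambda>i. if i < 1 + m then w1 i else (\<lambda>_. 0) (i - (1 + m)))"
  have e1: "endpt 1 (\<lambda>_. 0) = (0, 0)" by (simp add: endpt_Suc gmult_def)
  have "endpt (1 + m + 1) w2 = gmult (gmult (endpt 1 (\<lambda>_. 0)) (endpt m w)) (endpt 1 (\<lambda>_. 0))"
    using endpt_append[of "1 + m" 1 w1 "\<lambda>_. 0"] endpt_append[of 1 m "\<lambda>_. 0" w]
    unfolding w2_def w1_def by metis
  then have "endpt (Suc (1 + m)) w2 = p" unfolding e1 mw(1) by (simp add: gmult_def)
  moreover have "cost N (1 + m + 1) w2 = cost N 1 (\<lambda>_. 0) + cost N m w + cost N 1 (\<lambda>_. 0)"
    using cost_append[of N "1 + m" 1 w1 "\<lambda>_. 0"] cost_append[of N 1 m "\<lambda>_. 0" w]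
    unfolding w2_def w1_def by metis
  then have "cost N (Suc (1 + m)) w2 \<le> L"
    using mw(2) by (simp add: cost_def is_norm_zero[OF assms(1)])
  moreover have "w2 0 = 0" "w2 (1 + m) = 0" by (simp_all add: w2_def w1_def)
  ultimately show ?thesis using that by blast
qed

text \<open>The estimate is one-sided: g is far from the abnormal set, while q is any nearby point.
  A broken line to \<open>- g\<close> of cost within e of the optimum is bent into one to
  \<open>- q\<close>; then e tends to 0, since C and c depend neither on e nor on the line.\<close>

lemma cc_norm_increment_le:
  fixes N :: "real^'n \<Rightarrow> real"
  assumes N: "is_norm N" and L: "L \<ge> 0"
  obtains C c where "C > 0" "c > 0"
    "\<And>g q s. g \<in> G_carrier \<Longrightarrow> q \<in> G_carrier \<Longrightarrow> cc_norm N g \<le> L \<Longrightarrow> g \<notin> near_abnormal s \<Longrightarrow>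
       0 < s \<Longrightarrow> s \<le> 1 \<Longrightarrow> norm (q - g) \<le> c * s\<^sup>2 \<Longrightarrow> cc_norm N q \<le> cc_norm N g + C * norm (q - g) / s"
proof -
  obtain B0 where B0: "B0 > 0" "\<And>v w :: real^'n. norm (wedge v w) \<le> B0 * norm v * norm w"
    using norm_wedge_le by blast
  define B where "B = max 1 B0"
  have B: "B \<ge> 1" "norm (wedge v w) \<le> B * norm v * norm w" for v w :: "real^'n"
  proof -
    have "B0 * norm v * norm w \<le> B * norm v * norm w"
      by (intro mult_right_mono) (auto simp: B_def)
    then show "norm (wedge v w) \<le> B * norm v * norm w" using B0(2) order_trans by blast
  qed (simp add: B_def)
  obtain K where K: "K > 0" "\<And>x. N x \<le> K * norm x" using is_norm_upper[OF N] by blast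
  obtain l where l: "l > 0" "\<And>x. l * norm x \<le> N x" using is_norm_lower[OF N] by blast
  \<comment> \<open>Bounds the Euclidean length of all broken lines considered, whose cost is at
    most L + 1 because e is at most 1.\<close>
  define T where "T = (L + 1) / l"
  have T: "T \<ge> 0" using l(1) L by (simp add: T_def)
  define n where "n = real CARD('n)"
  have n: "n \<ge> 1" by (simp add: n_def Suc_leI)
  define C1 where "C1 = 1 + B * real CARD('n) * T * (1 + (real CARD('n))\<^sup>2)"
  have C1: "C1 \<ge> 1" using B(1) T by (simp add: C1_def)
  define \<kappa> where "\<kappa> = 4 * (real CARD('n))\<^sup>2 + 1"
  have \<kappa>: "\<kappa> \<ge> 1" by (simp add: \<kappa>_def)
  define k0 where "k0 = n\<^sup>2 * B * C1"
  have k0: "k0 \<ge> 1"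
    unfolding k0_def using n B(1) C1 by (intro mult_ge1_I one_le_power) auto
  define C where "C = K * (\<kappa> * (1 + B * T) * k0)"
  \<comment> \<open>Exactly the smallness required of the quadratic term when the linear problem
    costs \<open>k = k0 / s\<close>; squaring k produces the factor
    \<open>s\<^sup>2\<close>.\<close>
  define c where "c = 1 / ((1 + B * T) * (B * \<kappa>\<^sup>2 * k0\<^sup>2))"
  have BT: "1 + B * T > 0" using B(1) T by (simp add: add_pos_nonneg)
  have "C > 0" using K(1) \<kappa> BT k0 by (simp add: C_def)
  moreover have D: "(1 + B * T) * (B * \<kappa>\<^sup>2 * k0\<^sup>2) > 0" using BT B(1) \<kappa> k0 by simp
  then have "c > 0" by (simp add: c_def)
  moreover have "cc_norm N q \<le> cc_norm N g + C * norm (q - g) / s"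
    if g: "g \<in> G_carrier" and q: "q \<in> G_carrier" and gL: "cc_norm N g \<le> L" and na: "g \<notin> near_abnormal s"
      and s: "0 < s" "s \<le> 1" and qg: "norm (q - g) \<le> c * s\<^sup>2" for g q s
  proof -
    have "cc_norm N q \<le> cc_norm N g + C * norm (q - g) / s + e" if e: "0 < e" "e \<le> 1" for e
    proof -
      obtain M w where w: "endpt (Suc M) w = - g" "cost N (Suc M) w \<le> cc_norm N g + e" "w 0 = 0" "w M = 0"
        using reach_padded[OF N reach_cc_norm[OF N g e(1)]] by metis
      have "l * (\<Sum>i<Suc M. norm (w i)) \<le> cost N (Suc M) w"
        unfolding cost_def sum_distrib_left by (intro sum_mono l)
      then have wT: "(\<Sum>i<Suc M. norm (w i)) \<le> T"
        using w(2) gL e(2) l(1) by (simp add: T_def pos_le_divide_eq mult.commute del: sum.lessThan_Suc)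
      \<comment> \<open>Midpoints within \<sigma> of a subspace would put the endpoint into
        \<open>near_abnormal (C1 * \<sigma>)\<close>, that is, into
        \<open>near_abnormal s\<close>.\<close>
      define \<sigma> where "\<sigma> = s / C1"
      have \<sigma>: "\<sigma> > 0" "C1 * \<sigma> = s" using s(1) C1 by (auto simp: \<sigma>_def)
      have B': "B > 0" using B(1) by simp
      have nbad: "\<not> (\<exists>a b P. graph_projection a b P \<and>
          (\<forall>j<Suc M. \<forall>i. \<bar>(midpoint_of w j - P *v midpoint_of w j) $ i\<bar> \<le> \<sigma>))"
      proof
        assume "\<exists>a b P. graph_projection a b P \<and>
          (\<forall>j<Suc M. \<forall>i. \<bar>(midpoint_of w j - P *v midpoint_of w j) $ i\<bar> \<le> \<sigma>)"
        then obtain a b P where P: "graph_projection a b P"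
          "\<And>j i. j < Suc M \<Longrightarrow> \<bar>(midpoint_of w j - P *v midpoint_of w j) $ i\<bar> \<le> \<sigma>" by blast
        have "endpt (Suc M) w \<in> near_abnormal (C1 * \<sigma>)"
          by (rule endpt_near_abnormal[OF B' B(2) w(4) wT P C1_def])
        then have "- g \<in> near_abnormal s" unfolding w(1) \<sigma>(2) .
        then show False using near_abnormal_uminus[of "- g"] na by simp
      qed
      \<comment> \<open>A unit budget yields every bivector of norm at most
        \<open>\<sigma> / n\<^sup>2\<close>, while the basis bivectors have norm at most B.\<close>
      define k where "k = n\<^sup>2 * B / \<sigma>"
      have kk: "k = k0 / s" using \<sigma> s by (simp add: k_def k0_def \<sigma>_def)
      have k: "k \<ge> 1" unfolding kk using k0 s by (simp add: le_divide_eq)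
      have "\<exists>h. (\<Sum>j<Suc M. wedge (midpoint_of w j) (h j)) = wedge (axis a 1) (axis b 1) \<and>
          (\<Sum>j<Suc M. norm (h j)) \<le> k" for a b
      proof -
        have k_pos: "k > 0" using k by simp
        define Z where "Z = (1 / k) *\<^sub>R wedge (axis a 1) (axis b 1 :: real^'n)"
        have "\<forall>i j. Z $ i $ j = - Z $ j $ i" by (simp add: Z_def wedge_nth algebra_simps)
        moreover have "norm (wedge (axis a 1) (axis b 1 :: real^'n)) \<le> B"
          using B(2)[of "axis a 1" "axis b 1"] by simp
        then have "n\<^sup>2 * norm Z \<le> n\<^sup>2 * (1 / k * B)"
          unfolding Z_def using k_pos by (intro mult_left_mono) (auto simp: divide_right_mono)
        then have "(real CARD('n))\<^sup>2 * norm Z \<le> \<sigma>"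
          using n B' \<sigma>(1) by (simp add: k_def flip: n_def)
        ultimately obtain h where h: "(\<Sum>j<Suc M. wedge (midpoint_of w j) (h j)) = Z" "(\<Sum>j<Suc M. norm (h j)) \<le> 1"
          using span_dichotomy[OF _ nbad, of Z] by blast
        have "(\<Sum>j<Suc M. wedge (midpoint_of w j) (k *\<^sub>R h j)) = k *\<^sub>R Z"
          unfolding wedge.scaleR_right scaleR_sum_right[symmetric] h(1) ..
        moreover have "k *\<^sub>R Z = wedge (axis a 1) (axis b 1)" using k_pos by (simp add: Z_def)
        moreover have "(\<Sum>j<Suc M. norm (k *\<^sub>R h j)) = k * (\<Sum>j<Suc M. norm (h j))"
          unfolding norm_scaleR sum_distrib_left using k_pos by simp
        moreover have "k * (\<Sum>j<Suc M. norm (h j)) \<le> k * 1" using h(2) k_pos by (intro mult_left_mono) auto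
        ultimately show ?thesis by (intro exI[of _ "\<lambda>j. k *\<^sub>R h j"]) simp
      qed
      then obtain H where H: "\<And>a b. (\<Sum>j<Suc M. wedge (midpoint_of w j) (H a b j)) = wedge (axis a 1) (axis b 1)"
        "\<And>a b. (\<Sum>j<Suc M. norm (H a b j)) \<le> k"
        by metis
      \<comment> \<open>The difference is g - q because the broken lines end at \<open>- g\<close>
        and \<open>- q\<close>.\<close>
      define d where "d = g - q"
      have d: "d \<in> G_carrier" "norm d = norm (q - g)"
        using subspace_diff[OF subspace_G_carrier g q] by (auto simp: d_def norm_minus_commute)
      have "(1 + B * T) * norm d * (B * \<kappa>\<^sup>2 * k\<^sup>2) = norm d * ((1 + B * T) * (B * \<kappa>\<^sup>2 * k0\<^sup>2)) / s\<^sup>2"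
        by (simp add: kk power_divide)
      also have "\<dots> = norm d / (c * s\<^sup>2)" by (simp add: c_def)
      also have "\<dots> \<le> 1" using qg d(2) s(1) \<open>c > 0\<close> by simp
      finally have small: "(1 + B * T) * norm d * (B * \<kappa>\<^sup>2 * k\<^sup>2) \<le> 1" .
      obtain h where h: "endpt (Suc M) (\<lambda>i. w i + h i) = endpt (Suc M) w + d"
        "(\<Sum>i<Suc M. norm (h i)) \<le> \<kappa> * (1 + B * T) * k * norm d"
        using perturb_word[OF B _ w(3) T wT H(1) k H(2) d(1) \<kappa>_def small] by blast
      have "cost N (Suc M) (\<lambda>i. w i + h i) \<le> (\<Sum>i<Suc M. N (w i) + K * norm (h i))"
        unfolding cost_def
      proof (rule sum_mono)
        fix i show "N (w i + h i) \<le> N (w i) + K * norm (h i)"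
          using is_norm_triangle[OF N, of "w i" "h i"] K(2)[of "h i"] by linarith
      qed
      also have "\<dots> = cost N (Suc M) w + K * (\<Sum>i<Suc M. norm (h i))"
        unfolding sum.distrib sum_distrib_left cost_def ..
      also have "\<dots> \<le> (cc_norm N g + e) + K * (\<kappa> * (1 + B * T) * k * norm d)"
        using w(2) h(2) K(1) by (intro add_mono mult_left_mono) auto
      also have "K * (\<kappa> * (1 + B * T) * k * norm d) = C * norm (q - g) / s"
        by (simp add: C_def kk d(2))
      finally have "cost N (Suc M) (\<lambda>i. w i + h i) \<le> cc_norm N g + C * norm (q - g) / s + e" by simp
      moreover have "endpt (Suc M) (\<lambda>i. w i + h i) = - q" unfolding h(1) w(1) d_def by simp
      ultimately have "reach N (- q) (cc_norm N g + C * norm (q - g) / s + e)" unfolding reach_def by blast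
      then show ?thesis by (rule cc_norm_le[OF N])
    qed
    then have "cc_norm N q - (cc_norm N g + C * norm (q - g) / s) \<le> e" if "0 < e" for e
      using that by (smt (verit, best))
    then show ?thesis by (smt (verit) field_le_epsilon)
  qed
  ultimately show ?thesis using that by blast
qed

subsection \<open>Packing near the abnormal set\<close>

text \<open>These index the independent entries of an antisymmetric matrix; \<open>to_nat\<close>
  supplies the order that a bare finite type lacks.\<close>

definition ordered_pairs :: "'n::finite set \<Rightarrow> ('n \<times> 'n) set" where
  "ordered_pairs A = {(i, j). i \<in> A \<and> j \<in> A \<and> to_nat i < to_nat j}"

lemma finite_ordered_pairs [simp]: "finite (ordered_pairs A)"
  by (rule finite_subset[of _ "A \<times> A"]) (auto simp: ordered_pairs_def)

lemma card_ordered_pairs: "card (ordered_pairs A) = card A choose 2"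
proof -
  have "A \<times> A = (\<lambda>i. (i, i)) ` A \<union> (ordered_pairs A \<union> prod.swap ` ordered_pairs A)"
  proof (intro equalityI subsetI)
    fix p assume "p \<in> A \<times> A"
    then show "p \<in> (\<lambda>i. (i, i)) ` A \<union> (ordered_pairs A \<union> prod.swap ` ordered_pairs A)"
      by (cases p; cases "to_nat (fst p)" "to_nat (snd p)" rule: linorder_cases)
         (auto simp: ordered_pairs_def image_iff)
  qed (auto simp: ordered_pairs_def)
  then have "card (A \<times> A) = card ((\<lambda>i. (i, i)) ` A) + (card (ordered_pairs A) + card (prod.swap ` ordered_pairs A))"
    by (simp only:) (subst card_Un_disjoint; auto simp: ordered_pairs_def intro!: card_Un_disjoint)+
  moreover have "card (prod.swap ` ordered_pairs A) = card (ordered_pairs A)"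
    by (rule card_image) (auto simp: inj_on_def)
  ultimately have "card A * card A = card A + 2 * card (ordered_pairs A)"
    by (simp add: card_cartesian_product card_image inj_on_def)
  then have "card A * (card A - 1) = 2 * card (ordered_pairs A)"
    by (simp add: diff_mult_distrib2)
  then show ?thesis by (simp add: choose_two)
qed

abbreviation carnot_dim :: "'n::finite itself \<Rightarrow> nat" where
  "carnot_dim _ \<equiv> CARD('n) + (CARD('n) choose 2)"

section \<open>Counting points by grid cells\<close>

lemma norm_le_entries:
  fixes p :: "(real^'n) \<times> (real^'n^'n)"
  assumes "\<And>i. \<bar>fst p $ i\<bar> \<le> c" "\<And>i j. \<bar>snd p $ i $ j\<bar> \<le> c"
  shows "norm p \<le> (real CARD('n) + (real CARD('n))\<^sup>2) * c"
proof -
  have l1: "norm v \<le> real CARD('n) * b" if "\<And>i. norm (v $ i) \<le> b" for v :: "'a::real_normed_vector^'n" and b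
  proof -
    have "norm v \<le> (\<Sum>i\<in>UNIV. norm (v $ i))"
      unfolding norm_vec_def by (rule L2_set_le_sum) simp
    also have "\<dots> \<le> (\<Sum>i\<in>(UNIV::'n set). b)" by (intro sum_mono that)
    finally show ?thesis by simp
  qed
  have "norm p \<le> norm (fst p) + norm (snd p)" using norm_Pair_le[of "fst p" "snd p"] by simp
  also have "\<dots> \<le> real CARD('n) * c + real CARD('n) * (real CARD('n) * c)"
    using assms by (intro add_mono l1) auto
  finally show ?thesis by (simp add: power2_eq_square algebra_simps)
qed

lemma skew_entry_bound:
  assumes "p \<in> G_carrier" "c \<ge> 0" "\<And>i j. (i, j) \<in> ordered_pairs A \<Longrightarrow> \<bar>snd p $ i $ j\<bar> \<le> c"
    and "i \<in> A" "j \<in> A"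
  shows "\<bar>snd p $ i $ j\<bar> \<le> c"
proof (cases "to_nat i" "to_nat j" rule: linorder_cases)
  case less
  then show ?thesis using assms by (auto simp: ordered_pairs_def)
next
  case equal
  then show ?thesis using G_carrier_skew[OF assms(1), of i i] assms(2) by simp
next
  case greater
  then show ?thesis
    using assms G_carrier_skew[OF assms(1), of i j] by (auto simp: ordered_pairs_def)
qed

lemma card_PiE_le:
  assumes "finite I" "\<And>i. i \<in> I \<Longrightarrow> finite (A i)" "\<And>i. i \<in> I \<Longrightarrow> real (card (A i)) \<le> c"
  shows "real (card (Pi\<^sub>E I A)) \<le> c ^ card I"
proof -
  have "real (card (Pi\<^sub>E I A)) = (\<Prod>i\<in>I. real (card (A i)))"
    using assms(1) by (simp add: card_PiE)
  also have "\<dots> \<le> (\<Prod>i\<in>I. c)" using assms by (intro prod_mono) auto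
  finally show ?thesis by simp
qed

lemma card_floor_interval_le:
  fixes a b :: real
  assumes "a \<le> b"
  shows "real (card {\<lfloor>a\<rfloor>..\<lfloor>b\<rfloor>}) \<le> b - a + 2"
proof -
  have "real (card {\<lfloor>a\<rfloor>..\<lfloor>b\<rfloor>}) = real_of_int (\<lfloor>b\<rfloor> - \<lfloor>a\<rfloor> + 1)"
    using floor_mono[OF assms] by simp
  also have "\<dots> \<le> b - a + 2" by linarith
  finally show ?thesis .
qed

lemma floor_divide_eq_imp_close:
  fixes a b :: real
  assumes "\<lfloor>a / \<eta>\<rfloor> = \<lfloor>b / \<eta>\<rfloor>" "\<eta> > 0"
  shows "\<bar>a - b\<bar> \<le> \<eta>"
proof -
  have "\<bar>a / \<eta> - b / \<eta>\<bar> < 1" using assms(1) by linarith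
  then show ?thesis using assms(2) by (simp add: abs_if field_simps split: if_splits)
qed

lemma floor_divide_mem:
  fixes a :: real
  assumes "\<bar>a - a0\<bar> \<le> r" "\<eta> > 0"
  shows "\<lfloor>a / \<eta>\<rfloor> \<in> {\<lfloor>(a0 - r) / \<eta>\<rfloor>..\<lfloor>(a0 + r) / \<eta>\<rfloor>}"
  using assms by (auto intro!: floor_mono divide_right_mono)

lemma card_floor_range_le:
  fixes a :: real
  assumes "r \<ge> 0" "\<eta> > 0"
  shows "real (card {\<lfloor>(a - r) / \<eta>\<rfloor>..\<lfloor>(a + r) / \<eta>\<rfloor>}) \<le> 2 * r / \<eta> + 2"
proof -
  have "(a - r) / \<eta> \<le> (a + r) / \<eta>" using assms by (intro divide_right_mono) auto
  from card_floor_interval_le[OF this] show ?thesis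
    using assms by (simp add: diff_divide_distrib add_divide_distrib)
qed

lemma entry_dist_le:
  fixes p q :: "(real^'n) \<times> (real^'n^'n)"
  shows "\<bar>fst p $ i - fst q $ i\<bar> \<le> dist p q" "\<bar>snd p $ i $ j - snd q $ i $ j\<bar> \<le> dist p q"
proof -
  have "\<bar>(fst p - fst q) $ i\<bar> \<le> dist (fst p) (fst q)"
    unfolding dist_norm by (rule component_le_norm_cart)
  then show "\<bar>fst p $ i - fst q $ i\<bar> \<le> dist p q" using dist_fst_le[of p q] by simp
  have "\<bar>(snd p - snd q) $ i $ j\<bar> \<le> dist (snd p) (snd q)"
    unfolding dist_norm by (rule abs_entry_le_norm)
  then show "\<bar>snd p $ i $ j - snd q $ i $ j\<bar> \<le> dist p q" using dist_snd_le[of p q] by simp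
qed

text \<open>Rounding the coordinates to a fine grid is injective on a separated set, so its points
  are counted by grid cells.\<close>

lemma G_carrier_packing:
  obtains K where "K \<ge> 1"
    "\<And>\<epsilon> r (P :: ((real^'n) \<times> (real^'n^'n)) set). 0 < \<epsilon> \<Longrightarrow> \<epsilon> \<le> r \<Longrightarrow> P \<subseteq> G_carrier \<Longrightarrow> finite P \<Longrightarrow>
       separated \<epsilon> P \<Longrightarrow> (\<And>p q. p \<in> P \<Longrightarrow> q \<in> P \<Longrightarrow> dist p q \<le> r) \<Longrightarrow>
       real (card P) \<le> K * (r / \<epsilon>) ^ carnot_dim TYPE('n)"
proof -
  define \<nu> where "\<nu> = real CARD('n) + (real CARD('n))\<^sup>2"
  have \<nu>: "\<nu> \<ge> 0" by (simp add: \<nu>_def)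
  define U where "U = ordered_pairs (UNIV :: 'n set)"
  define K1 where "K1 = 2 * (\<nu> + 1) + 2"
  have K1: "K1 \<ge> 1" using \<nu> by (simp add: K1_def)
  have "real (card P) \<le> K1 ^ carnot_dim TYPE('n) * (r / \<epsilon>) ^ carnot_dim TYPE('n)"
    if \<epsilon>: "0 < \<epsilon>" "\<epsilon> \<le> r" and P: "P \<subseteq> G_carrier" "finite P" "separated \<epsilon> P"
      and r: "\<And>p q. p \<in> P \<Longrightarrow> q \<in> P \<Longrightarrow> dist p q \<le> r"
    for \<epsilon> r and P :: "((real^'n) \<times> (real^'n^'n)) set"
  proof (cases "P = {}")
    case True
    then show ?thesis using K1 \<epsilon> by simp
  next
    case False
    then obtain p0 where p0: "p0 \<in> P" by blast
    \<comment> \<open>A mesh so small that two points in one cell are closer than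
      \<epsilon>.\<close>
    define \<eta> where "\<eta> = \<epsilon> / (\<nu> + 1)"
    have \<eta>: "\<eta> > 0" "\<nu> * \<eta> < \<epsilon>" using \<epsilon> \<nu> by (auto simp: \<eta>_def field_simps)
    \<comment> \<open>Of the matrix, one entry of each antisymmetric pair is recorded; this makes
      the exponent the dimension of the group instead of n + n^2.\<close>
    define code where "code = (\<lambda>p::(real^'n) \<times> (real^'n^'n).
      (restrict (\<lambda>i. \<lfloor>fst p $ i / \<eta>\<rfloor>) UNIV, restrict (\<lambda>(i,j). \<lfloor>snd p $ i $ j / \<eta>\<rfloor>) U))"
    define A1 where "A1 = (\<lambda>i. {\<lfloor>(fst p0 $ i - r) / \<eta>\<rfloor>..\<lfloor>(fst p0 $ i + r) / \<eta>\<rfloor>})"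
    define A2 where "A2 = (\<lambda>(i,j). {\<lfloor>(snd p0 $ i $ j - r) / \<eta>\<rfloor>..\<lfloor>(snd p0 $ i $ j + r) / \<eta>\<rfloor>})"
    have "inj_on code P"
    proof (rule inj_onI)
      fix p q assume p: "p \<in> P" and q: "q \<in> P" and eq: "code p = code q"
      have pq: "p - q \<in> G_carrier" using p q P(1) by (intro subspace_diff[OF subspace_G_carrier]) auto
      have c1: "\<bar>fst (p - q) $ i\<bar> \<le> \<eta>" for i
      proof -
        have "\<lfloor>fst p $ i / \<eta>\<rfloor> = \<lfloor>fst q $ i / \<eta>\<rfloor>"
          using eq unfolding code_def by (metis (no_types, lifting) UNIV_I prod.inject restrict_apply)
        then show ?thesis using floor_divide_eq_imp_close \<eta>(1) by simp
      qed
      have c2: "\<bar>snd (p - q) $ i $ j\<bar> \<le> \<eta>" if "(i, j) \<in> U" for i j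
      proof -
        have "restrict (\<lambda>(i,j). \<lfloor>snd p $ i $ j / \<eta>\<rfloor>) U (i, j) = restrict (\<lambda>(i,j). \<lfloor>snd q $ i $ j / \<eta>\<rfloor>) U (i, j)"
          using eq unfolding code_def by simp
        then have "\<lfloor>snd p $ i $ j / \<eta>\<rfloor> = \<lfloor>snd q $ i $ j / \<eta>\<rfloor>" using that by simp
        then show ?thesis using floor_divide_eq_imp_close \<eta>(1) by simp
      qed
      have "\<bar>snd (p - q) $ i $ j\<bar> \<le> \<eta>" for i j
        by (rule skew_entry_bound[OF pq, of \<eta> UNIV]) (use \<eta>(1) c2 in \<open>auto simp: U_def\<close>)
      then have "norm (p - q) \<le> \<nu> * \<eta>"
        unfolding \<nu>_def by (intro norm_le_entries c1)
      then have "dist p q < \<epsilon>" using \<eta>(2) by (simp add: dist_norm)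
      then show "p = q" using P(3) p q unfolding separated_def by force
    qed
    then have "card P = card (code ` P)" by (simp add: card_image)
    also have "\<dots> \<le> card (Pi\<^sub>E UNIV A1 \<times> Pi\<^sub>E U A2)"
    proof (rule card_mono)
      show "finite (Pi\<^sub>E UNIV A1 \<times> Pi\<^sub>E U A2)"
        by (intro finite_cartesian_product finite_PiE) (auto simp: A1_def A2_def U_def)
      show "code ` P \<subseteq> Pi\<^sub>E UNIV A1 \<times> Pi\<^sub>E U A2"
      proof
        fix y assume "y \<in> code ` P"
        then obtain p where p: "p \<in> P" "y = code p" by blast
        have d: "dist p p0 \<le> r" using r p(1) p0 by blast
        have "\<lfloor>fst p $ i / \<eta>\<rfloor> \<in> A1 i" for i
          unfolding A1_def using entry_dist_le(1)[of p i p0] d \<eta>(1) by (intro floor_divide_mem) auto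
        moreover have "\<lfloor>snd p $ i $ j / \<eta>\<rfloor> \<in> A2 (i, j)" for i j
          unfolding A2_def prod.case using entry_dist_le(2)[of p i j p0] d \<eta>(1)
          by (intro floor_divide_mem) auto
        ultimately show "y \<in> Pi\<^sub>E UNIV A1 \<times> Pi\<^sub>E U A2"
          unfolding p(2) code_def by (auto simp: PiE_iff)
      qed
    qed
    also have "card (Pi\<^sub>E UNIV A1 \<times> Pi\<^sub>E U A2) = card (Pi\<^sub>E UNIV A1) * card (Pi\<^sub>E U A2)"
      by (rule card_cartesian_product)
    finally have "real (card P) \<le> real (card (Pi\<^sub>E UNIV A1)) * real (card (Pi\<^sub>E U A2))"
      by (metis of_nat_le_iff of_nat_mult)
    have r0: "r \<ge> 0" using \<epsilon> by simp
    have le: "2 * r / \<eta> + 2 \<le> K1 * (r / \<epsilon>)"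
      using \<epsilon> \<nu> by (simp add: \<eta>_def K1_def field_simps)
    have "real (card (Pi\<^sub>E UNIV A1)) \<le> (K1 * (r / \<epsilon>)) ^ CARD('n)"
      using order_trans[OF card_floor_range_le[OF r0 \<eta>(1)] le]
      by (intro card_PiE_le) (auto simp: A1_def)
    moreover have "real (card (Pi\<^sub>E U A2)) \<le> (K1 * (r / \<epsilon>)) ^ card U"
      by (rule card_PiE_le)
         (use order_trans[OF card_floor_range_le[OF r0 \<eta>(1)] le] in \<open>auto simp: A2_def U_def\<close>)
    ultimately have "real (card (Pi\<^sub>E UNIV A1)) * real (card (Pi\<^sub>E U A2)) \<le> (K1 * (r / \<epsilon>)) ^ CARD('n) * (K1 * (r / \<epsilon>)) ^ card U"
      using K1 \<epsilon> by (intro mult_mono) auto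
    also have "\<dots> = K1 ^ carnot_dim TYPE('n) * (r / \<epsilon>) ^ carnot_dim TYPE('n)"
      unfolding U_def card_ordered_pairs power_add[symmetric] power_mult_distrib[symmetric] ..
    finally show ?thesis using \<open>real (card P) \<le> _\<close> by linarith
  qed
  moreover have "K1 ^ carnot_dim TYPE('n) \<ge> 1" using K1 by (rule one_le_power)
  ultimately show ?thesis using that by blast
qed

text \<open>Serves the charts: the complement of a line in \<open>G_carrier\<close> then embeds
  isometrically into a Euclidean space of dimension d - 1.\<close>

lemma dim_G_carrier_le: "dim (G_carrier :: ((real^'n) \<times> (real^'n^'n)) set) \<le> carnot_dim TYPE('n)"
proof -
  define B1 where "B1 = range (\<lambda>i. (axis i 1, 0) :: (real^'n) \<times> (real^'n^'n))"
  define B2 where "B2 = (\<lambda>(i,j). (0, wedge (axis i 1) (axis j 1)) :: (real^'n) \<times> (real^'n^'n)) ` ordered_pairs UNIV"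
  have w: "(0, wedge (axis i 1) (axis j 1)) \<in> span (B1 \<union> B2)" for i j :: 'n
  proof (cases "to_nat i" "to_nat j" rule: linorder_cases)
    case less
    then have "(0, wedge (axis i 1) (axis j 1)) \<in> B2" by (force simp: B2_def ordered_pairs_def)
    then show ?thesis by (auto intro: span_base)
  next
    case greater
    then have "(0, wedge (axis j 1) (axis i 1)) \<in> B2" by (force simp: B2_def ordered_pairs_def)
    then have "- (0, wedge (axis j 1) (axis i 1)) \<in> span (B1 \<union> B2)" by (intro span_neg span_base) simp
    then show ?thesis using wedge_skew[of "axis i 1" "axis j 1"] by simp
  qed (simp add: span_zero flip: zero_prod_def)
  have "G_carrier \<subseteq> span (B1 \<union> B2)"
  proof
    fix p :: "(real^'n) \<times> (real^'n^'n)" assume "p \<in> G_carrier"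
    then have Y: "snd p = (\<Sum>(a, b)\<in>UNIV. (snd p $ a $ b / 2) *\<^sub>R wedge (axis a 1) (axis b 1))"
      using mem_G_carrier wedge_basis_expansion by blast
    have x: "fst p = (\<Sum>i\<in>UNIV. fst p $ i *\<^sub>R axis i 1)"
      using basis_expansion[of "fst p"] by (simp add: scalar_mult_eq_scaleR)
    have "p = (\<Sum>i\<in>UNIV. fst p $ i *\<^sub>R (axis i 1, 0)) + (\<Sum>q\<in>UNIV. (snd p $ fst q $ snd q / 2) *\<^sub>R (0, wedge (axis (fst q) 1) (axis (snd q) 1)))"
      using x Y by (simp add: prod_eq_iff fst_sum snd_sum case_prod_beta)
    also have "\<dots> \<in> span (B1 \<union> B2)"
      by (intro span_add span_sum span_scale w) (auto intro!: span_base simp: B1_def)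
    finally show "p \<in> span (B1 \<union> B2)" .
  qed
  then have "dim (G_carrier :: ((real^'n) \<times> (real^'n^'n)) set) \<le> card (B1 \<union> B2)"
    by (rule dim_le_card) (simp add: B1_def B2_def)
  also have "\<dots> \<le> card B1 + card B2" by (rule card_Un_le)
  also have "card B1 \<le> CARD('n)" unfolding B1_def by (rule card_image_le) simp
  also have "card B2 \<le> card (ordered_pairs (UNIV :: 'n set))" unfolding B2_def by (rule card_image_le) simp
  finally show ?thesis by (simp add: card_ordered_pairs)
qed

text \<open>The count behind codimension three. With k = n - 2 there are 2 k slopes of the graph,
  and k horizontal and (k choose 2) vertical coordinates of a point, while (k + 2 choose 2) = (k
  choose 2) + 2 k + 1.\<close>

lemma carnot_dim_minus_3:
  assumes "a \<noteq> (b :: 'n::finite)"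
  shows "carnot_dim TYPE('n) = 3 * card (UNIV - {a, b}) + (card (UNIV - {a, b}) choose 2) + 3"
proof -
  have "CARD('n) = card (UNIV - {a, b}) + card {a, b}"
    by (rule card_Un_disjoint[of "UNIV - {a, b}" "{a, b}", simplified Un_Diff_cancel2, simplified])
  then have "CARD('n) = Suc (Suc (card (UNIV - {a, b})))" using assms by simp
  then show ?thesis
    by (simp add: numeral_2_eq_2 del: card_Diff_insert)
qed

text \<open>The matrix P enters only through its rows a and b, and the columns a and b of P vanish.
  So up to an error of order s the point (x, Y) is determined by those two rows and by the entries
  of x and Y off a and b, which are three parameters fewer than the dimension of the group.\<close>

lemma graph_projection_close:
  fixes p q :: "(real^'n) \<times> (real^'n^'n)"
  assumes P: "graph_projection a b P" and Q: "graph_projection a b Q"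
    and G: "p \<in> G_carrier" "q \<in> G_carrier"
    and s: "s \<ge> 0" and R: "norm p \<le> R" "norm q \<le> R"
    and ps: "\<And>i. \<bar>(fst p - P *v fst p) $ i\<bar> \<le> s" "\<And>i j. \<bar>(snd p - push_forward P (snd p)) $ i $ j\<bar> \<le> s"
    and qs: "\<And>i. \<bar>(fst q - Q *v fst q) $ i\<bar> \<le> s" "\<And>i j. \<bar>(snd q - push_forward Q (snd q)) $ i $ j\<bar> \<le> s"
    and rows: "\<And>i. i \<notin> {a, b} \<Longrightarrow> \<bar>P $ a $ i - Q $ a $ i\<bar> \<le> s" "\<And>i. i \<notin> {a, b} \<Longrightarrow> \<bar>P $ b $ i - Q $ b $ i\<bar> \<le> s"
    and off: "\<And>i. i \<notin> {a, b} \<Longrightarrow> \<bar>fst p $ i - fst q $ i\<bar> \<le> s"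
      "\<And>i j. (i, j) \<in> ordered_pairs (UNIV - {a, b}) \<Longrightarrow> \<bar>snd p $ i $ j - snd q $ i $ j\<bar> \<le> s"
    and \<nu>: "\<nu> = real CARD('n) + (real CARD('n))\<^sup>2"
  shows "dist p q \<le> \<nu> * ((2 + \<nu> * (1 + 2 * R)) * s)"
proof -
  have R0: "R \<ge> 0" using R(1) norm_ge_zero order_trans by blast
  have PQ0: "P $ i $ k = 0" "Q $ i $ k = 0" if "k \<in> {a, b}" for i k
    using P Q that unfolding graph_projection_def by auto
  have PQ: "\<bar>P $ i $ k - Q $ i $ k\<bar> \<le> s" for i k
  proof (cases "k \<in> {a, b}")
    case True
    then show ?thesis using PQ0[OF True] s by simp
  next
    case False
    show ?thesis
    proof (cases "i = a \<or> i = b")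
      case True
      then show ?thesis using rows[OF False] by auto
    next
      case F: False
      then have "P $ i $ k = Q $ i $ k" using P Q unfolding graph_projection_def by simp
      then show ?thesis using s by simp
    qed
  qed
  note P1 = graph_projection_entry[OF P] and Q1 = graph_projection_entry[OF Q]
  have pq: "p - q \<in> G_carrier" using G by (rule subspace_diff[OF subspace_G_carrier])
  have Yoff: "\<bar>snd p $ k $ l - snd q $ k $ l\<bar> \<le> s" if "k \<notin> {a, b}" "l \<notin> {a, b}" for k l
    using skew_entry_bound[OF pq s, of "UNIV - {a, b}" k l] off(2) that by simp
  have xq: "\<bar>fst q $ i\<bar> \<le> R" "\<bar>snd q $ i $ j\<bar> \<le> R" for i j
    using entry_dist_le(1)[of q _ 0] entry_dist_le(2)[of q _ _ 0] R(2) by (auto intro: order_trans simp: dist_norm)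
  have prod_close: "\<bar>u * v - u' * v'\<bar> \<le> \<alpha> + \<beta> * \<gamma>"
    if "\<bar>u\<bar> \<le> 1" "\<bar>v - v'\<bar> \<le> \<alpha>" "\<bar>u - u'\<bar> \<le> \<beta>" "\<bar>v'\<bar> \<le> \<gamma>" for u v u' v' \<alpha> \<beta> \<gamma> :: real
  proof -
    have "u * v - u' * v' = u * (v - v') + (u - u') * v'" by (simp add: algebra_simps)
    moreover have "\<bar>u * (v - v')\<bar> \<le> 1 * \<alpha>" unfolding abs_mult using that by (intro mult_mono) auto
    moreover have "\<bar>(u - u') * v'\<bar> \<le> \<beta> * \<gamma>" unfolding abs_mult using that by (intro mult_mono) auto
    ultimately show ?thesis by linarith
  qed
  have x: "\<bar>(P *v fst p) $ i - (Q *v fst q) $ i\<bar> \<le> \<nu> * (1 + 2 * R) * s" for i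
  proof -
    have "\<bar>(P *v fst p) $ i - (Q *v fst q) $ i\<bar> \<le> (\<Sum>k\<in>UNIV. \<bar>P $ i $ k * fst p $ k - Q $ i $ k * fst q $ k\<bar>)"
      by (simp add: matrix_vector_mult_def sum_subtractf[symmetric] sum_abs)
    also have "\<dots> \<le> (\<Sum>k\<in>(UNIV::'n set). s + s * R)"
    proof (rule sum_mono)
      fix k show "\<bar>P $ i $ k * fst p $ k - Q $ i $ k * fst q $ k\<bar> \<le> s + s * R"
      proof (cases "k \<in> {a, b}")
        case True
        then show ?thesis using PQ0[OF True] s R0 by simp
      next
        case False
        then show ?thesis using P1 PQ xq off(1) by (intro prod_close)
      qed
    qed
    also have "\<dots> = real CARD('n) * ((1 + R) * s)" by (simp add: algebra_simps)
    also have "\<dots> \<le> \<nu> * ((1 + 2 * R) * s)"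
      using s R0 by (intro mult_mono mult_right_mono) (auto simp: \<nu>)
    finally show ?thesis by (simp add: mult.assoc)
  qed
  have Y: "\<bar>push_forward P (snd p) $ i $ j - push_forward Q (snd q) $ i $ j\<bar> \<le> \<nu> * (1 + 2 * R) * s" for i j
  proof -
    have "\<bar>push_forward P (snd p) $ i $ j - push_forward Q (snd q) $ i $ j\<bar>
        \<le> (\<Sum>k\<in>UNIV. \<bar>\<Sum>l\<in>UNIV. P $ i $ k * P $ j $ l * snd p $ k $ l - Q $ i $ k * Q $ j $ l * snd q $ k $ l\<bar>)"
      by (simp add: push_forward_def sum_subtractf[symmetric] sum_abs)
    also have "\<dots> \<le> (\<Sum>k\<in>(UNIV::'n set). \<Sum>l\<in>(UNIV::'n set). s + s * R + s * R)"
    proof (rule sum_mono)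
      fix k
      have "\<bar>\<Sum>l\<in>UNIV. P $ i $ k * P $ j $ l * snd p $ k $ l - Q $ i $ k * Q $ j $ l * snd q $ k $ l\<bar>
          \<le> (\<Sum>l\<in>UNIV. \<bar>P $ i $ k * P $ j $ l * snd p $ k $ l - Q $ i $ k * Q $ j $ l * snd q $ k $ l\<bar>)"
        by (rule sum_abs)
      also have "\<dots> \<le> (\<Sum>l\<in>(UNIV::'n set). s + s * R + s * R)"
      proof (rule sum_mono)
        fix l show "\<bar>P $ i $ k * P $ j $ l * snd p $ k $ l - Q $ i $ k * Q $ j $ l * snd q $ k $ l\<bar> \<le> s + s * R + s * R"
        proof (cases "k \<in> {a, b} \<or> l \<in> {a, b}")
          case True
          then show ?thesis using PQ0[of k] PQ0[of l] s R0 by auto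
        next
          case False
          have A: "\<bar>Q $ j $ l * snd q $ k $ l\<bar> \<le> 1 * R"
            unfolding abs_mult using Q1 xq by (intro mult_mono) auto
          have B: "\<bar>P $ j $ l * snd p $ k $ l - Q $ j $ l * snd q $ k $ l\<bar> \<le> s + s * R"
            using False by (intro prod_close P1 PQ xq Yoff) auto
          have "\<bar>P $ i $ k * (P $ j $ l * snd p $ k $ l) - Q $ i $ k * (Q $ j $ l * snd q $ k $ l)\<bar> \<le> (s + s * R) + s * R"
            by (rule prod_close[OF P1 B PQ A[simplified]])
          then show ?thesis by (simp add: mult.assoc)
        qed
      qed
      finally show "\<bar>\<Sum>l\<in>UNIV. P $ i $ k * P $ j $ l * snd p $ k $ l - Q $ i $ k * Q $ j $ l * snd q $ k $ l\<bar>
          \<le> (\<Sum>l\<in>(UNIV::'n set). s + s * R + s * R)" .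
    qed
    also have "\<dots> = (real CARD('n))\<^sup>2 * ((1 + 2 * R) * s)" by (simp add: power2_eq_square algebra_simps)
    also have "\<dots> \<le> \<nu> * ((1 + 2 * R) * s)"
      using s R0 by (intro mult_right_mono) (auto simp: \<nu>)
    finally show ?thesis by (simp add: mult.assoc)
  qed
  have "norm (p - q) \<le> \<nu> * ((2 + \<nu> * (1 + 2 * R)) * s)"
    unfolding \<nu>
  proof (rule norm_le_entries, unfold \<nu>[symmetric])
    fix i show "\<bar>fst (p - q) $ i\<bar> \<le> (2 + \<nu> * (1 + 2 * R)) * s"
      using x[of i] ps(1)[of i] qs(1)[of i] by (simp add: distrib_right abs_le_iff)
  next
    fix i j show "\<bar>snd (p - q) $ i $ j\<bar> \<le> (2 + \<nu> * (1 + 2 * R)) * s"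
      using Y[of i j] ps(2)[of i j] qs(2)[of i j] by (simp add: distrib_right abs_le_iff)
  qed
  then show ?thesis by (simp add: dist_norm)
qed

text \<open>Two scales are combined. The cells of size s in the d - 3 parameters number about s^(3 -
  d). Points in one cell have mutual distance of order s, so the packing bound of the group allows
  about (s / \<epsilon>)^d of them.\<close>

lemma near_abnormal_packing:
  assumes R: "R \<ge> 0" and S: "S > 0"
  obtains K where "K > 0"
    "\<And>\<epsilon> s (P :: ((real^'n) \<times> (real^'n^'n)) set). 0 < \<epsilon> \<Longrightarrow> \<epsilon> \<le> s \<Longrightarrow> s \<le> S \<Longrightarrow>
       P \<subseteq> near_abnormal s \<inter> cball 0 R \<Longrightarrow> finite P \<Longrightarrow> separated \<epsilon> P \<Longrightarrow>
       real (card P) \<le> K * s ^ 3 / \<epsilon> ^ carnot_dim TYPE('n)"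
proof -
  define D where "D = carnot_dim TYPE('n)"
  obtain K0 where K0: "K0 \<ge> 1"
    "\<And>\<epsilon> r (P :: ((real^'n) \<times> (real^'n^'n)) set). 0 < \<epsilon> \<Longrightarrow> \<epsilon> \<le> r \<Longrightarrow> P \<subseteq> G_carrier \<Longrightarrow> finite P \<Longrightarrow>
       separated \<epsilon> P \<Longrightarrow> (\<And>p q. p \<in> P \<Longrightarrow> q \<in> P \<Longrightarrow> dist p q \<le> r) \<Longrightarrow> real (card P) \<le> K0 * (r / \<epsilon>) ^ D"
    unfolding D_def using G_carrier_packing[where 'n = 'n] by metis
  define \<nu> where "\<nu> = real CARD('n) + (real CARD('n))\<^sup>2"
  have \<nu>1: "\<nu> \<ge> 1" by (simp add: \<nu>_def add_increasing2 Suc_leI)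
  define C where "C = \<nu> * (2 + \<nu> * (1 + 2 * R))"
  have C: "C \<ge> 1" unfolding C_def using \<nu>1 R by (intro mult_ge1_I) (auto intro: add_increasing2)
  \<comment> \<open>Each parameter is bounded by R or by 1 and s by S, so at most
    \<open>K1 / s\<close> cells are needed per parameter.\<close>
  define K1 where "K1 = 2 * (R + S + 1)"
  have K1: "K1 > 0" using R S by (simp add: K1_def)
  define K2 where "K2 = (\<Sum>(a,b)\<in>(UNIV::('n\<times>'n) set). K1 ^ (D - 3) * (K0 * C ^ D))"
  have K2: "K2 > 0" unfolding K2_def case_prod_beta using K1 K0(1) C by (intro sum_pos) auto
  have "real (card P) \<le> K2 * s ^ 3 / \<epsilon> ^ D"
    if \<epsilon>: "0 < \<epsilon>" "\<epsilon> \<le> s" "s \<le> S" and P: "P \<subseteq> near_abnormal s \<inter> cball 0 R" "finite P" "separated \<epsilon> P"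
    for \<epsilon> s and P :: "((real^'n) \<times> (real^'n^'n)) set"
  proof -
    have s: "s > 0" using \<epsilon> by simp
    have PG: "P \<subseteq> G_carrier" using P(1) by (auto simp: near_abnormal_def)
    have PR: "norm p \<le> R" if "p \<in> P" for p using P(1) that by auto
    have "\<forall>p\<in>P. \<exists>a b M. graph_projection a b M \<and> (\<forall>i. \<bar>(fst p - M *v fst p) $ i\<bar> \<le> s) \<and>
     (\<forall>i j. \<bar>(snd p - push_forward M (snd p)) $ i $ j\<bar> \<le> s)"
      using P(1) by (auto simp: near_abnormal_def)
    then obtain a b M where ab: "\<And>p. p \<in> P \<Longrightarrow> graph_projection (a p) (b p) (M p)"
      "\<And>p i. p \<in> P \<Longrightarrow> \<bar>(fst p - M p *v fst p) $ i\<bar> \<le> s"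
      "\<And>p i j. p \<in> P \<Longrightarrow> \<bar>(snd p - push_forward (M p) (snd p)) $ i $ j\<bar> \<le> s"
      by metis
    \<comment> \<open>The points are sorted by the pair of dependent coordinates, because that pair
      decides which entries serve as parameters.\<close>
    have fibre: "real (card {p \<in> P. a p = a0 \<and> b p = b0}) \<le> K1 ^ (D - 3) * (K0 * C ^ D) * (s ^ 3 / \<epsilon> ^ D)"
      (is "real (card ?P) \<le> _") for a0 b0
    proof (cases "?P = {}")
      case True
      have "0 \<le> K1 ^ (D - 3) * (K0 * C ^ D) * (s ^ 3 / \<epsilon> ^ D)"
        using K1 K0(1) C s \<epsilon>(1) by auto
      then show ?thesis unfolding True by simp
    next
      case False
      then obtain p1 where p1: "p1 \<in> P" "a p1 = a0" "b p1 = b0" by blast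
      then have ne: "a0 \<noteq> b0" using ab(1)[OF p1(1)] by (simp add: graph_projection_def)
      define Off where "Off = UNIV - {a0, b0}"
      define U where "U = ordered_pairs Off"
      have D3: "D = card U + 3 * card Off + 3"
        unfolding D_def U_def card_ordered_pairs Off_def using carnot_dim_minus_3[OF ne] by simp
      define code where "code = (\<lambda>p::(real^'n) \<times> (real^'n^'n).
        (restrict (\<lambda>(i,j). \<lfloor>snd p $ i $ j / s\<rfloor>) U, restrict (\<lambda>i. \<lfloor>fst p $ i / s\<rfloor>) Off,
         restrict (\<lambda>i. \<lfloor>M p $ a0 $ i / s\<rfloor>) Off, restrict (\<lambda>i. \<lfloor>M p $ b0 $ i / s\<rfloor>) Off))"
      define I where "I = (\<lambda>r. {\<lfloor>(0 - r) / s\<rfloor>..\<lfloor>(0 + r) / s\<rfloor>})"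
      define T where "T = Pi\<^sub>E U (\<lambda>_. I R) \<times> Pi\<^sub>E Off (\<lambda>_. I R) \<times> Pi\<^sub>E Off (\<lambda>_. I 1) \<times> Pi\<^sub>E Off (\<lambda>_. I 1)"
      have finT: "finite T"
        unfolding T_def by (intro finite_cartesian_product finite_PiE) (auto simp: I_def U_def)
      have cI: "real (card (I r)) \<le> K1 / s" if "0 \<le> r" "r \<le> R + 1" for r
      proof -
        have "real (card (I r)) \<le> 2 * r / s + 2"
          unfolding I_def by (rule card_floor_range_le) (use that s in auto)
        also have "\<dots> = (2 * r + 2 * s) / s" using s by (simp add: field_simps)
        also have "\<dots> \<le> K1 / s" using that \<epsilon> s by (intro divide_right_mono) (auto simp: K1_def)
        finally show ?thesis .
      qed
      have "real (card T) \<le> (K1 / s) ^ card U * ((K1 / s) ^ card Off * ((K1 / s) ^ card Off * (K1 / s) ^ card Off))"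
        unfolding T_def card_cartesian_product of_nat_mult
        using K1 s R by (intro mult_mono card_PiE_le cI mult_nonneg_nonneg) (auto simp: I_def U_def)
      also have "\<dots> = (K1 / s) ^ (D - 3)"
        unfolding power_add[symmetric] D3 by (rule arg_cong[where f = "(^) (K1 / s)"]) simp
      finally have cT: "real (card T) \<le> (K1 / s) ^ (D - 3)" .
      have codeT: "code ` ?P \<subseteq> T"
      proof
        fix y assume "y \<in> code ` ?P"
        then obtain p where p: "p \<in> P" "a p = a0" "b p = b0" "y = code p" by blast
        have "\<lfloor>fst p $ i / s\<rfloor> \<in> I R" "\<lfloor>snd p $ i $ j / s\<rfloor> \<in> I R" for i j
          unfolding I_def using entry_dist_le(1)[of p _ 0] entry_dist_le(2)[of p _ _ 0] PR[OF p(1)] s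
          by (intro floor_divide_mem; auto simp: dist_norm intro: order_trans)+
        moreover have "\<lfloor>M p $ i $ j / s\<rfloor> \<in> I 1" for i j
          unfolding I_def using graph_projection_entry[OF ab(1)[OF p(1)]] s
          by (intro floor_divide_mem) auto
        ultimately show "y \<in> T"
          unfolding p(4) code_def T_def by (auto simp: PiE_iff)
      qed
      have fib: "real (card {p \<in> ?P. code p = y}) \<le> K0 * (C * s / \<epsilon>) ^ D" for y
      proof (rule K0(2)[OF \<epsilon>(1)])
        have "1 * s \<le> C * s" using C s by (intro mult_right_mono) auto
        then show "\<epsilon> \<le> C * s" using \<epsilon>(2) by simp
        show "{p \<in> ?P. code p = y} \<subseteq> G_carrier" using PG by blast
        show "finite {p \<in> ?P. code p = y}" using P(2) by simp
        show "separated \<epsilon> {p \<in> ?P. code p = y}" using P(3) unfolding separated_def by blast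
        fix p q assume "p \<in> {p \<in> ?P. code p = y}" "q \<in> {p \<in> ?P. code p = y}"
        then have p: "p \<in> P" "a p = a0" "b p = b0" and q: "q \<in> P" "a q = a0" "b q = b0" and eq: "code p = code q"
          by auto
        note eqs = eq[unfolded code_def prod.inject, THEN conjunct1]
          eq[unfolded code_def prod.inject, THEN conjunct2, THEN conjunct1]
          eq[unfolded code_def prod.inject, THEN conjunct2, THEN conjunct2, THEN conjunct1]
          eq[unfolded code_def prod.inject, THEN conjunct2, THEN conjunct2, THEN conjunct2]
        have "dist p q \<le> \<nu> * ((2 + \<nu> * (1 + 2 * R)) * s)"
        proof (rule graph_projection_close[where P = "M p" and Q = "M q" and a = a0 and b = b0])
          show "graph_projection a0 b0 (M p)" "graph_projection a0 b0 (M q)"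
            using ab(1) p q by metis+
          show "\<bar>M p $ a0 $ i - M q $ a0 $ i\<bar> \<le> s" if "i \<notin> {a0, b0}" for i
            using fun_cong[OF eqs(3), of i] that s
            by (intro floor_divide_eq_imp_close) (auto simp: Off_def)
          show "\<bar>M p $ b0 $ i - M q $ b0 $ i\<bar> \<le> s" if "i \<notin> {a0, b0}" for i
            using fun_cong[OF eqs(4), of i] that s
            by (intro floor_divide_eq_imp_close) (auto simp: Off_def)
          show "\<bar>fst p $ i - fst q $ i\<bar> \<le> s" if "i \<notin> {a0, b0}" for i
            using fun_cong[OF eqs(2), of i] that s
            by (intro floor_divide_eq_imp_close) (auto simp: Off_def)
          show "\<bar>snd p $ i $ j - snd q $ i $ j\<bar> \<le> s" if "(i, j) \<in> ordered_pairs (UNIV - {a0, b0})" for i j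
            using fun_cong[OF eqs(1), of "(i, j)"] that s
            by (intro floor_divide_eq_imp_close) (auto simp: U_def Off_def)
        qed (use PG PR p q s ab(2,3) \<nu>_def in auto)
        then show "dist p q \<le> C * s" by (simp add: C_def mult.assoc)
      qed
      have "?P = (\<Union>y\<in>code ` ?P. {p \<in> ?P. code p = y})" by blast
      then have "card ?P \<le> (\<Sum>y\<in>code ` ?P. card {p \<in> ?P. code p = y})"
        using card_UN_le[of "code ` ?P" "\<lambda>y. {p \<in> ?P. code p = y}"] P(2) by simp
      then have "real (card ?P) \<le> (\<Sum>y\<in>code ` ?P. real (card {p \<in> ?P. code p = y}))"
        unfolding of_nat_sum[symmetric] of_nat_le_iff .
      also have "\<dots> \<le> (\<Sum>y\<in>code ` ?P. K0 * (C * s / \<epsilon>) ^ D)" by (intro sum_mono fib)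
      also have "\<dots> = real (card (code ` ?P)) * (K0 * (C * s / \<epsilon>) ^ D)" by simp
      also have "\<dots> \<le> (K1 / s) ^ (D - 3) * (K0 * (C * s / \<epsilon>) ^ D)"
        using cT card_mono[OF finT codeT] K0(1) C s \<epsilon>(1) by (intro mult_right_mono) auto
      also have "\<dots> = K1 ^ (D - 3) * (K0 * C ^ D) * (s ^ D / s ^ (D - 3) / \<epsilon> ^ D)"
        by (simp add: power_divide power_mult_distrib)
      also have "s ^ D / s ^ (D - 3) = s ^ 3"
        using s D3 by (simp add: power_diff[symmetric])
      finally show ?thesis .
    qed
    have "P = (\<Union>(a0,b0)\<in>UNIV. {p \<in> P. a p = a0 \<and> b p = b0})" by blast
    then have "card P \<le> (\<Sum>q\<in>UNIV. card {p \<in> P. a p = fst q \<and> b p = snd q})"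
      using card_UN_le[of UNIV "\<lambda>q. {p \<in> P. a p = fst q \<and> b p = snd q}"] by (simp add: case_prod_beta)
    then have "real (card P) \<le> (\<Sum>q\<in>UNIV. real (card {p \<in> P. a p = fst q \<and> b p = snd q}))"
      unfolding of_nat_sum[symmetric] of_nat_le_iff .
    also have "\<dots> \<le> (\<Sum>q\<in>(UNIV::('n\<times>'n) set). K1 ^ (D - 3) * (K0 * C ^ D) * (s ^ 3 / \<epsilon> ^ D))"
      by (intro sum_mono fibre)
    also have "\<dots> = K2 * s ^ 3 / \<epsilon> ^ D" by (simp add: K2_def case_prod_beta)
    finally show ?thesis .
  qed
  then show ?thesis using that K2 unfolding D_def by blast
qed

subsection \<open>Hausdorff measure of the sphere\<close>

lemma near_abnormal_mono:
  "s \<le> s' \<Longrightarrow> near_abnormal s \<subseteq> (near_abnormal s' :: ((real^'n) \<times> (real^'n^'n)) set)"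
proof
  fix p :: "(real^'n) \<times> (real^'n^'n)"
  assume s: "s \<le> s'" and "p \<in> near_abnormal s"
  then obtain a b P where P: "graph_projection a b P" "p \<in> G_carrier"
    "\<And>i. \<bar>(fst p - P *v fst p) $ i\<bar> \<le> s" "\<And>i j. \<bar>(snd p - push_forward P (snd p)) $ i $ j\<bar> \<le> s"
    unfolding near_abnormal_def by blast
  then show "p \<in> near_abnormal s'"
    unfolding near_abnormal_def using order_trans[OF _ s] by blast
qed

text \<open>The coordinate projection with all slopes zero will do; two distinct indices exist
  because n is at least 2. It is used in two ways: a large s captures a whole ball, and points
  outside \<open>near_abnormal s\<close> stay away from the identity.\<close>

lemma near_abnormal_if_small:
  fixes p :: "(real^'n) \<times> (real^'n^'n)"
  assumes n: "CARD('n) \<ge> 2" and p: "p \<in> G_carrier" "(1 + (real CARD('n))\<^sup>2) * norm p \<le> s"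
  shows "p \<in> near_abnormal s"
proof -
  obtain a b :: 'n where "a \<noteq> b"
    using n by (metis (full_types) One_nat_def Suc_1 UNIV_I card_le_Suc0_iff_eq finite not_less_eq_eq)
  define P :: "real^'n^'n" where "P = (\<chi> i j. if i = j \<and> j \<noteq> a \<and> j \<noteq> b then 1 else 0)"
  have P: "graph_projection a b P"
    using \<open>a \<noteq> b\<close> by (auto simp: graph_projection_def P_def)
  have "\<bar>(fst p - P *v fst p) $ i\<bar> \<le> s" for i
  proof -
    have "\<bar>(fst p - P *v fst p) $ i\<bar> \<le> norm (fst p - P *v fst p)" by (rule component_le_norm_cart)
    also have "\<dots> \<le> norm (fst p) + (real CARD('n))\<^sup>2 * norm (fst p)"
      using norm_triangle_ineq4[of "fst p" "P *v fst p"] norm_graph_projection_le[OF P, of "fst p"] by linarith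
    also have "\<dots> = (1 + (real CARD('n))\<^sup>2) * norm (fst p)" by (simp add: algebra_simps)
    also have "\<dots> \<le> (1 + (real CARD('n))\<^sup>2) * norm p"
      by (intro mult_left_mono) (metis norm_fst_le prod.collapse, simp)
    finally show ?thesis using p(2) by linarith
  qed
  moreover have "\<bar>(snd p - push_forward P (snd p)) $ i $ j\<bar> \<le> s" for i j
  proof -
    have sp: "\<bar>snd p $ k $ l\<bar> \<le> norm p" for k l
      using abs_entry_le_norm[of "snd p" k l] norm_snd_le[of "snd p" "fst p"] by simp
    have "\<bar>push_forward P (snd p) $ i $ j\<bar> \<le> (\<Sum>k\<in>UNIV. \<Sum>l\<in>UNIV. \<bar>P $ i $ k * P $ j $ l * snd p $ k $ l\<bar>)"
      unfolding push_forward_def vec_lambda_beta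
      by (intro order_trans[OF sum_abs] sum_mono sum_abs)
    also have "\<dots> \<le> (\<Sum>k\<in>(UNIV::'n set). \<Sum>l\<in>(UNIV::'n set). norm p)"
    proof (intro sum_mono)
      fix k l
      have "\<bar>P $ i $ k\<bar> * \<bar>P $ j $ l\<bar> * \<bar>snd p $ k $ l\<bar> \<le> 1 * 1 * norm p"
        by (intro mult_mono graph_projection_entry[OF P] sp) auto
      then show "\<bar>P $ i $ k * P $ j $ l * snd p $ k $ l\<bar> \<le> norm p" by (simp add: abs_mult)
    qed
    finally have "\<bar>push_forward P (snd p) $ i $ j\<bar> \<le> (real CARD('n))\<^sup>2 * norm p"
      by (simp add: power2_eq_square)
    then show ?thesis using sp[of i j] p(2) by (simp add: algebra_simps abs_le_iff)
  qed
  ultimately show ?thesis unfolding near_abnormal_def using P p(1) by blast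
qed

lemma dist_dil_ge:
  assumes "t \<ge> 1"
  shows "dist p q \<le> dist (dil t p) (dil t q)"
proof -
  have le: "dist x y \<le> dist (u *\<^sub>R x) (u *\<^sub>R y)" if "u \<ge> 1" for u and x y :: "'x::real_normed_vector"
    using that mult_right_mono[of 1 u "norm (x - y)"] by (simp add: dist_norm flip: scaleR_diff_right)
  have "dist (fst p) (fst q) \<le> dist (t *\<^sub>R fst p) (t *\<^sub>R fst q)" by (rule le[OF assms])
  moreover have "dist (snd p) (snd q) \<le> dist (t\<^sup>2 *\<^sub>R snd p) (t\<^sup>2 *\<^sub>R snd q)"
    by (rule le) (use assms in simp)
  ultimately show ?thesis
    unfolding dist_prod_def dil_def by (intro real_sqrt_le_mono add_mono power_mono) auto
qed

text \<open>P and its action on bivectors are linear, so they commute with dilations.\<close>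

lemma near_abnormal_dil_residuals:
  "(fst (dil t p) - P *v fst (dil t p)) $ i = t * (fst p - P *v fst p) $ i"
  "(snd (dil t p) - push_forward P (snd (dil t p))) $ i $ j = t\<^sup>2 * (snd p - push_forward P (snd p)) $ i $ j"
  by (simp_all add: dil_def matrix_vector_mult_scaleR linear_cmul[OF push_forward_linear] right_diff_distrib)

lemma near_abnormal_dil:
  assumes p: "p \<in> near_abnormal s" and t: "1 \<le> t" "t \<le> 2" and s: "s \<ge> 0"
  shows "dil t p \<in> near_abnormal (4 * s)"
proof -
  have t4: "t \<le> 4" "t\<^sup>2 \<le> 4" using t power_mono[of t 2 2] by auto
  obtain a b P where P: "graph_projection a b P" "p \<in> G_carrier"
    "\<And>i. \<bar>(fst p - P *v fst p) $ i\<bar> \<le> s" "\<And>i j. \<bar>(snd p - push_forward P (snd p)) $ i $ j\<bar> \<le> s"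
    using p unfolding near_abnormal_def by blast
  have "\<bar>(fst (dil t p) - P *v fst (dil t p)) $ i\<bar> \<le> 4 * s" for i
    unfolding near_abnormal_dil_residuals abs_mult using P(3) t t4 s by (intro mult_mono) auto
  moreover have "\<bar>(snd (dil t p) - push_forward P (snd (dil t p))) $ i $ j\<bar> \<le> 4 * s" for i j
    unfolding near_abnormal_dil_residuals abs_mult using P(4) t t4 s by (intro mult_mono) auto
  ultimately show ?thesis
    unfolding near_abnormal_def using P(1) dil_mem_G_carrier[OF P(2)] by blast
qed

lemma near_abnormal_of_dil:
  assumes p: "dil t p \<in> near_abnormal s" and t: "1 \<le> t" and G: "p \<in> G_carrier"
  shows "p \<in> near_abnormal s"
proof -
  have t2: "t\<^sup>2 \<ge> 1" using t by simp
  obtain a b P where P: "graph_projection a b P"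
    "\<And>i. \<bar>(fst (dil t p) - P *v fst (dil t p)) $ i\<bar> \<le> s"
    "\<And>i j. \<bar>(snd (dil t p) - push_forward P (snd (dil t p))) $ i $ j\<bar> \<le> s"
    using p unfolding near_abnormal_def by blast
  have le: "\<bar>x\<bar> \<le> s" if "\<bar>u * x\<bar> \<le> s" "u \<ge> 1" for u x :: real
    using that mult_right_mono[of 1 u "\<bar>x\<bar>"] by (simp add: abs_mult)
  have "\<bar>(fst p - P *v fst p) $ i\<bar> \<le> s" for i using le[OF P(2)[unfolded near_abnormal_dil_residuals] t] .
  moreover have "\<bar>(snd p - push_forward P (snd p)) $ i $ j\<bar> \<le> s" for i j using le[OF P(3)[unfolded near_abnormal_dil_residuals] t2] .
  ultimately show ?thesis unfolding near_abnormal_def using P(1) G by blast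
qed

text \<open>The bound 4 leaves room for dilates of the sphere by factors up to 2. At scale s0 the
  whole ball of radius R counts as near abnormal, so the shells below s0 exhaust the sphere up to
  the abnormal set itself.\<close>

locale sphere_setup =
  fixes N :: "real^'n \<Rightarrow> real" and R s0 C c :: real
  assumes N: "is_norm N" and card: "CARD('n) \<ge> 2"
    and bounds: "R > 0" "s0 \<ge> 1" "C > 0" "c > 0"
    and norm_le: "\<And>g. g \<in> G_carrier \<Longrightarrow> cc_norm N g \<le> 4 \<Longrightarrow> norm g \<le> R"
    and near_s0: "\<And>g :: (real^'n) \<times> (real^'n^'n). g \<in> G_carrier \<Longrightarrow> norm g \<le> R \<Longrightarrow> g \<in> near_abnormal s0"
    and increment: "\<And>g q s. g \<in> G_carrier \<Longrightarrow> q \<in> G_carrier \<Longrightarrow> cc_norm N g \<le> 4 \<Longrightarrow> g \<notin> near_abnormal s \<Longrightarrow>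
       0 < s \<Longrightarrow> s \<le> s0 \<Longrightarrow> norm (q - g) \<le> c * s\<^sup>2 \<Longrightarrow> cc_norm N q \<le> cc_norm N g + C * norm (q - g) / s"

lemma sphere_setup_exists:
  fixes N :: "real^'n \<Rightarrow> real"
  assumes N: "is_norm N" and n: "CARD('n) \<ge> 2"
  obtains R s0 C c where "sphere_setup N R s0 C c"
proof -
  obtain R where R: "R > 0" "\<And>p. reach N p 5 \<Longrightarrow> norm p \<le> R" using reach_bounded[OF N] by metis
  have nl: "norm g \<le> R" if "g \<in> G_carrier" "cc_norm N g \<le> 4" for g
    using R(2)[of "- g"] reach_mono[OF reach_cc_norm[OF N that(1), of 1], of 5] that(2) by simp
  define s0 where "s0 = max 1 ((1 + (real CARD('n))\<^sup>2) * R)"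
  have near: "g \<in> near_abnormal s0" if "g \<in> G_carrier" "norm g \<le> R" for g :: "(real^'n) \<times> (real^'n^'n)"
  proof (rule near_abnormal_if_small[OF n that(1)])
    have "(1 + (real CARD('n))\<^sup>2) * norm g \<le> (1 + (real CARD('n))\<^sup>2) * R"
      using that(2) by (intro mult_left_mono) auto
    then show "(1 + (real CARD('n))\<^sup>2) * norm g \<le> s0" by (simp add: s0_def)
  qed
  obtain C c where Cc: "C > 0" "c > 0"
    "\<And>g q s. g \<in> G_carrier \<Longrightarrow> q \<in> G_carrier \<Longrightarrow> cc_norm N g \<le> 4 \<Longrightarrow> g \<notin> near_abnormal s \<Longrightarrow>
       0 < s \<Longrightarrow> s \<le> 1 \<Longrightarrow> norm (q - g) \<le> c * s\<^sup>2 \<Longrightarrow> cc_norm N q \<le> cc_norm N g + C * norm (q - g) / s"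
    using cc_norm_increment_le[OF N, of 4] by auto
  have s0: "s0 \<ge> 1" by (simp add: s0_def)
  \<comment> \<open>The Lipschitz estimate is available for s at most 1. At a scale s up to s0 it is
    applied with s / s0, which multiplies C by s0 and divides c by the square of s0.\<close>
  have "sphere_setup N R s0 (C * s0) (c / s0\<^sup>2)"
  proof
    fix g q :: "(real^'n) \<times> (real^'n^'n)" and s
    assume g: "g \<in> G_carrier" "q \<in> G_carrier" "cc_norm N g \<le> 4" "g \<notin> near_abnormal s" "0 < s" "s \<le> s0"
      and qg: "norm (q - g) \<le> c / s0\<^sup>2 * s\<^sup>2"
    have "s / s0 \<le> s" using s0 g(5) by (simp add: field_simps)
    then have "g \<notin> near_abnormal (s / s0)" using near_abnormal_mono g(4) by blast
    then have "cc_norm N q \<le> cc_norm N g + C * norm (q - g) / (s / s0)"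
      using g s0 qg by (intro Cc) (auto simp: power_divide)
    then show "cc_norm N q \<le> cc_norm N g + C * s0 * norm (q - g) / s" by (simp add: mult_ac)
  qed (use N n R(1) s0 Cc nl near in auto)
  then show ?thesis by (rule that)
qed

section \<open>Packing and covering the dyadic shells\<close>

context sphere_setup
begin

lemma mem_sphere: "g \<in> cc_sphere N \<longleftrightarrow> g \<in> G_carrier \<and> cc_norm N g = 1"
  by (simp add: cc_sphere_def cc_norm_def)

lemma sphere_norm_le: "g \<in> cc_sphere N \<Longrightarrow> norm g \<le> R"
  using norm_le by (simp add: mem_sphere)

text \<open>The dilates of a separated set at scales that are C e / s apart form a separated set again,
  because on the complement of the s-neighbourhood of the abnormal set the distance from the
  identity is Lipschitz with constant C / s. This gains the factor e / s over the packing bound in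
  the whole group.\<close>

lemma shell_packing:
  obtains K where "K > 0"
    "\<And>s \<epsilon> P. 0 < s \<Longrightarrow> s \<le> s0 \<Longrightarrow> 0 < \<epsilon> \<Longrightarrow> \<epsilon> \<le> s \<Longrightarrow> \<epsilon> \<le> c * s\<^sup>2 \<Longrightarrow>
       P \<subseteq> cc_sphere N \<inter> near_abnormal (2 * s) - near_abnormal s \<Longrightarrow> finite P \<Longrightarrow> separated \<epsilon> P \<Longrightarrow>
       real (card P) \<le> K * s\<^sup>2 / \<epsilon> ^ (carnot_dim TYPE('n) - 1)"
proof -
  define D where "D = carnot_dim TYPE('n)"
  have D1: "D = Suc (D - 1)" using card by (simp add: D_def)
  have R0: "R \<ge> 0" and S0: "8 * s0 > 0" using bounds by auto
  obtain K0 where K0: "K0 > 0" "\<And>\<epsilon> s (P :: ((real^'n) \<times> (real^'n^'n)) set). 0 < \<epsilon> \<Longrightarrow> \<epsilon> \<le> s \<Longrightarrow> s \<le> 8 * s0 \<Longrightarrow>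
       P \<subseteq> near_abnormal s \<inter> cball 0 R \<Longrightarrow> finite P \<Longrightarrow> separated \<epsilon> P \<Longrightarrow> real (card P) \<le> K0 * s ^ 3 / \<epsilon> ^ D"
    unfolding D_def using near_abnormal_packing[OF R0 S0, where 'n = 'n] by metis
  \<comment> \<open>The factor 1024 is 8^3, from the neighbourhood
    \<open>near_abnormal (8 * s)\<close> that contains all dilates, times 2 from the spacing
    \<eta>.\<close>
  have "real (card P) \<le> K0 * 1024 * C * s\<^sup>2 / \<epsilon> ^ (D - 1)"
    if s: "0 < s" "s \<le> s0" and \<epsilon>: "0 < \<epsilon>" "\<epsilon> \<le> s" "\<epsilon> \<le> c * s\<^sup>2"
      and P: "P \<subseteq> cc_sphere N \<inter> near_abnormal (2 * s) - near_abnormal s" "finite P" "separated \<epsilon> P" for s \<epsilon> P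
  proof -
    \<comment> \<open>Twice the change of distance from the identity that the Lipschitz estimate
      permits between points closer than \<epsilon>.\<close>
    define \<eta> where "\<eta> = 2 * C * \<epsilon> / s"
    have \<eta>: "\<eta> > 0" using bounds \<epsilon> s by (simp add: \<eta>_def)
    \<comment> \<open>The number of steps of size \<eta> that keep the factor at most 2. Even if it
      is 0, \<open>Suc J\<close> dilates are at least as many as
      \<open>s / (2 * C * \<epsilon>)\<close>.\<close>
    define J where "J = nat \<lfloor>1 / \<eta>\<rfloor>"
    define t where "t = (\<lambda>j::nat. 1 + real j * \<eta>)"
    have t: "1 \<le> t j" "t j \<le> 2" if "j \<le> J" for j
    proof -
      have "real j \<le> 1 / \<eta>" using that \<eta> by (simp add: J_def le_nat_floor le_nat_iff le_floor_iff)
      then show "t j \<le> 2" using \<eta> by (simp add: t_def field_simps)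
    qed (use \<eta> in \<open>simp add: t_def\<close>)
    define F where "F = (\<lambda>(j, p :: (real^'n) \<times> (real^'n^'n)). dil (t j) p)"
    have F: "F (j, p) \<in> G_carrier" "cc_norm N (F (j, p)) = t j" "F (j, p) \<notin> near_abnormal s"
      "F (j, p) \<in> near_abnormal (8 * s)" "norm (F (j, p)) \<le> R" if "j \<le> J" "p \<in> P" for j p
    proof -
      have p: "p \<in> G_carrier" "cc_norm N p = 1" "p \<in> near_abnormal (2 * s)" "p \<notin> near_abnormal s"
        using that P(1) by (auto simp: mem_sphere)
      note tj = t[OF that(1)]
      show 1: "F (j, p) \<in> G_carrier" by (simp add: F_def dil_mem_G_carrier p)
      show 2: "cc_norm N (F (j, p)) = t j" using cc_norm_dil[OF N _ p(1), of "t j"] p(2) tj by (simp add: F_def)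
      show "F (j, p) \<notin> near_abnormal s" using near_abnormal_of_dil[OF _ tj(1) p(1)] p(4) by (auto simp: F_def)
      show "F (j, p) \<in> near_abnormal (8 * s)"
        using near_abnormal_dil[OF p(3) tj] s(1) by (simp add: F_def)
      show "norm (F (j, p)) \<le> R" using 1 2 tj by (intro norm_le) auto
    qed
    \<comment> \<open>The estimate is based at the dilate with the smaller factor and bounds the
      distance of the other one from above.\<close>
    have far: "\<epsilon> \<le> dist (F (j, p)) (F (j', p'))" if j: "j < j'" "j' \<le> J" and p: "p \<in> P" "p' \<in> P" for j j' p p'
    proof (rule ccontr)
      assume "\<not> ?thesis"
      then have d: "norm (F (j', p') - F (j, p)) < \<epsilon>" by (simp add: dist_norm norm_minus_commute)
      have jJ: "j \<le> J" using j by simp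
      have "cc_norm N (F (j', p')) \<le> cc_norm N (F (j, p)) + C * norm (F (j', p') - F (j, p)) / s"
        using F[OF jJ p(1)] F[OF j(2) p(2)] t(2)[OF jJ] d \<epsilon> s by (intro increment) auto
      also have "C * norm (F (j', p') - F (j, p)) / s \<le> C * \<epsilon> / s"
        using d bounds(3) s(1) by (intro divide_right_mono mult_left_mono) auto
      finally have "t j' \<le> t j + \<eta> / 2" using F(2)[OF jJ p(1)] F(2)[OF j(2) p(2)] by (simp add: \<eta>_def)
      moreover have "t j' - t j = (real j' - real j) * \<eta>" by (simp add: t_def algebra_simps)
      moreover have "1 * \<eta> \<le> (real j' - real j) * \<eta>" using j(1) \<eta> by (intro mult_right_mono) auto
      ultimately show False using \<eta> by linarith
    qed
    have sep: "\<epsilon> \<le> dist (F x) (F y)" if xyP: "x \<in> {..J} \<times> P" "y \<in> {..J} \<times> P" "x \<noteq> y" for x y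
    proof -
      obtain j p j' p' where xy: "x = (j, p)" "y = (j', p')" by (metis surj_pair)
      consider "j < j'" | "j' < j" | "j = j'" "p \<noteq> p'" using xyP(3) xy by (metis linorder_neqE_nat)
      then show ?thesis
      proof cases
        case 3
        then have "\<epsilon> \<le> dist p p'" using P(3) xyP xy by (simp add: separated_def)
        also have "\<dots> \<le> dist (F x) (F y)"
          using xyP xy 3 by (auto simp: F_def intro!: dist_dil_ge t)
        finally show ?thesis .
      next
        case 1
        then show ?thesis using far[of j j' p p'] xyP xy by simp
      next
        case 2
        then show ?thesis using far[of j' j p' p] xyP xy by (simp add: dist_commute)
      qed
    qed
    then have inj: "inj_on F ({..J} \<times> P)"
      using \<epsilon>(1) by (intro inj_onI) (metis dist_self not_less)
    have "real (card (F ` ({..J} \<times> P))) \<le> K0 * (8 * s) ^ 3 / \<epsilon> ^ D"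
    proof (rule K0(2)[OF \<epsilon>(1)])
      show "separated \<epsilon> (F ` ({..J} \<times> P))" using sep unfolding separated_def by blast
      show "F ` ({..J} \<times> P) \<subseteq> near_abnormal (8 * s) \<inter> cball 0 R" using F(4,5) by auto
    qed (use s \<epsilon> P(2) in auto)
    then have "real (card P) * real (Suc J) \<le> K0 * (8 * s) ^ 3 / \<epsilon> ^ D"
      by (simp add: card_image[OF inj] card_cartesian_product algebra_simps)
    moreover have "s / (2 * C * \<epsilon>) \<le> real (Suc J)"
    proof -
      have "1 / \<eta> \<le> real (Suc J)" unfolding J_def using \<eta> by linarith
      then show ?thesis by (simp add: \<eta>_def)
    qed
    then have "real (card P) * (s / (2 * C * \<epsilon>)) \<le> real (card P) * real (Suc J)" by (intro mult_left_mono) auto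
    ultimately have "real (card P) * (s / (2 * C * \<epsilon>)) \<le> K0 * (8 * s) ^ 3 / \<epsilon> ^ D" by linarith
    then have "real (card P) \<le> K0 * (8 * s) ^ 3 / \<epsilon> ^ D * (2 * C * \<epsilon> / s)"
      using s \<epsilon> bounds(3) by (simp add: field_simps)
    also have "\<dots> = K0 * 1024 * C * s\<^sup>2 / \<epsilon> ^ (D - 1)"
      using s \<epsilon> by (subst D1) (simp add: power2_eq_square power3_eq_cube field_simps)
    finally show ?thesis .
  qed
  moreover have "K0 * 1024 * C > 0" using K0(1) bounds(3) by simp
  ultimately show ?thesis using that unfolding D_def by blast
qed

text \<open>\<epsilon> may be as small as \<delta> demands, since its power in the packing bound
  cancels against the cost of the balls.\<close>

lemma shell_cover_cost:
  obtains K where "K > 0"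
    "\<And>s \<delta>. 0 < s \<Longrightarrow> s \<le> s0 \<Longrightarrow> \<delta> > 0 \<Longrightarrow>
       finite_cover_cost (real (carnot_dim TYPE('n) - 1)) \<delta> (cc_sphere N \<inter> near_abnormal (2 * s) - near_abnormal s) (K * s\<^sup>2)"
proof -
  define d where "d = carnot_dim TYPE('n) - 1"
  have d: "d > 0" using card by (simp add: d_def)
  obtain K where K: "K > 0" "\<And>s \<epsilon> P. 0 < s \<Longrightarrow> s \<le> s0 \<Longrightarrow> 0 < \<epsilon> \<Longrightarrow> \<epsilon> \<le> s \<Longrightarrow> \<epsilon> \<le> c * s\<^sup>2 \<Longrightarrow>
       P \<subseteq> cc_sphere N \<inter> near_abnormal (2 * s) - near_abnormal s \<Longrightarrow> finite P \<Longrightarrow> separated \<epsilon> P \<Longrightarrow>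
       real (card P) \<le> K * s\<^sup>2 / \<epsilon> ^ d"
    unfolding d_def using shell_packing by metis
  have "finite_cover_cost (real d) \<delta> (cc_sphere N \<inter> near_abnormal (2 * s) - near_abnormal s) (K * 2 ^ d * s\<^sup>2)"
    if s: "0 < s" "s \<le> s0" and \<delta>: "\<delta> > 0" for s \<delta>
  proof -
    define \<epsilon> where "\<epsilon> = min (\<delta> / 2) (min s (c * s\<^sup>2))"
    have \<epsilon>: "\<epsilon> > 0" "2 * \<epsilon> \<le> \<delta>" "\<epsilon> \<le> s" "\<epsilon> \<le> c * s\<^sup>2"
      using s \<delta> bounds(4) by (auto simp: \<epsilon>_def)
    have "finite_cover_cost (real d) \<delta> (cc_sphere N \<inter> near_abnormal (2 * s) - near_abnormal s)
        ((K * s\<^sup>2 / \<epsilon> ^ d) * (2 * \<epsilon>) powr real d)"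
      using \<epsilon> s d by (intro finite_cover_cost_separated K) auto
    moreover have "(K * s\<^sup>2 / \<epsilon> ^ d) * (2 * \<epsilon>) powr real d = K * 2 ^ d * s\<^sup>2"
      using \<epsilon>(1) by (simp add: powr_realpow power_mult_distrib)
    ultimately show ?thesis by simp
  qed
  moreover have "K * 2 ^ d > 0" using K(1) by simp
  ultimately show ?thesis using that unfolding d_def by blast
qed

text \<open>Balls of radius s, the width of the neighbourhood itself: about s^(3 - d) of them, each
  costing s^(d - 1) up to a constant. No Lipschitz estimate enters, so this covers the abnormal
  points as well.\<close>

lemma near_abnormal_cover_cost:
  obtains K where "K > 0"
    "\<And>s \<delta>. 0 < s \<Longrightarrow> s \<le> s0 \<Longrightarrow> 2 * s \<le> \<delta> \<Longrightarrow>
       finite_cover_cost (real (carnot_dim TYPE('n) - 1)) \<delta> (cc_sphere N \<inter> near_abnormal s) (K * s\<^sup>2)"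
proof -
  define D where "D = carnot_dim TYPE('n)"
  have D1: "D = Suc (D - 1)" "D - 1 > 0" using card by (auto simp: D_def)
  have R0: "R \<ge> 0" and S0: "s0 > 0" using bounds by auto
  obtain K where K: "K > 0" "\<And>\<epsilon> s (P :: ((real^'n) \<times> (real^'n^'n)) set). 0 < \<epsilon> \<Longrightarrow> \<epsilon> \<le> s \<Longrightarrow> s \<le> s0 \<Longrightarrow>
       P \<subseteq> near_abnormal s \<inter> cball 0 R \<Longrightarrow> finite P \<Longrightarrow> separated \<epsilon> P \<Longrightarrow> real (card P) \<le> K * s ^ 3 / \<epsilon> ^ D"
    unfolding D_def using near_abnormal_packing[OF R0 S0, where 'n = 'n] by metis
  have "finite_cover_cost (real (D - 1)) \<delta> (cc_sphere N \<inter> near_abnormal s) (K * 2 ^ (D - 1) * s\<^sup>2)"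
    if s: "0 < s" "s \<le> s0" and \<delta>: "2 * s \<le> \<delta>" for s \<delta>
  proof -
    have "finite_cover_cost (real (D - 1)) \<delta> (cc_sphere N \<inter> near_abnormal s)
        ((K * s ^ 3 / s ^ D) * (2 * s) powr real (D - 1))"
      using s \<delta> D1 sphere_norm_le by (intro finite_cover_cost_separated K) auto
    moreover have "(K * s ^ 3 / s ^ D) * (2 * s) powr real (D - 1) = K * 2 ^ (D - 1) * s\<^sup>2"
      using s by (subst D1(1)) (simp add: powr_realpow power_mult_distrib power2_eq_square power3_eq_cube)
    ultimately show ?thesis by simp
  qed
  moreover have "K * 2 ^ (D - 1) > 0" using K(1) by simp
  ultimately show ?thesis using that unfolding D_def by blast
qed

lemma hausdorff_measure_sphere_finite:
  "hausdorff_measure (real (carnot_dim TYPE('n) - 1)) (cc_sphere N) < \<infinity>"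
proof -
  define d where "d = carnot_dim TYPE('n) - 1"
  obtain K where K: "K > 0" "\<And>s \<delta>. 0 < s \<Longrightarrow> s \<le> s0 \<Longrightarrow> \<delta> > 0 \<Longrightarrow>
       finite_cover_cost (real d) \<delta> (cc_sphere N \<inter> near_abnormal (2 * s) - near_abnormal s) (K * s\<^sup>2)"
    unfolding d_def using shell_cover_cost by metis
  obtain K' where K': "K' > 0" "\<And>s \<delta>. 0 < s \<Longrightarrow> s \<le> s0 \<Longrightarrow> 2 * s \<le> \<delta> \<Longrightarrow>
       finite_cover_cost (real d) \<delta> (cc_sphere N \<inter> near_abnormal s) (K' * s\<^sup>2)"
    unfolding d_def using near_abnormal_cover_cost by metis
  define \<sigma> where "\<sigma> = (\<lambda>j::nat. s0 / 2 ^ j)"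
  have \<sigma>: "0 < \<sigma> j" "\<sigma> j \<le> s0" "2 * \<sigma> (Suc j) = \<sigma> j" for j
    using bounds(2) by (auto simp: \<sigma>_def field_simps)
  \<comment> \<open>The closed form majorizes the geometric sum of the shell costs: shell j + 1
    costs \<open>K * s0\<^sup>2 * (1/4) ^ Suc j\<close>, and the bound grows by three times as
    much.\<close>
  have shells: "finite_cover_cost (real d) \<delta> (cc_sphere N - near_abnormal (\<sigma> j)) (K * s0\<^sup>2 * (1 - (1/4) ^ j))"
    if \<delta>: "\<delta> > 0" for \<delta> j
  proof (induction j)
    case 0
    have "cc_sphere N - near_abnormal (\<sigma> 0) = {}"
      using near_s0 sphere_norm_le by (auto simp: \<sigma>_def mem_sphere)
    then show ?case unfolding finite_cover_cost_def by (intro exI[of _ "{}"]) simp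
  next
    case (Suc j)
    have "finite_cover_cost (real d) \<delta> ((cc_sphere N - near_abnormal (\<sigma> j)) \<union>
        (cc_sphere N \<inter> near_abnormal (2 * \<sigma> (Suc j)) - near_abnormal (\<sigma> (Suc j))))
        (K * s0\<^sup>2 * (1 - (1/4) ^ j) + K * (\<sigma> (Suc j))\<^sup>2)"
      by (intro finite_cover_cost_Un Suc K(2) \<sigma> \<delta>)
    then show ?case
    proof (rule finite_cover_cost_mono)
      show "cc_sphere N - near_abnormal (\<sigma> (Suc j)) \<subseteq> (cc_sphere N - near_abnormal (\<sigma> j)) \<union>
        (cc_sphere N \<inter> near_abnormal (2 * \<sigma> (Suc j)) - near_abnormal (\<sigma> (Suc j)))"
        unfolding \<sigma>(3) by blast
      have sq: "(\<sigma> (Suc j))\<^sup>2 = s0\<^sup>2 * ((1/4) ^ j / 4)"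
      proof -
        have "((2::real) ^ j)\<^sup>2 = 4 ^ j" by (simp add: power2_eq_square flip: power_mult_distrib)
        then show ?thesis by (simp add: \<sigma>_def power_divide power_mult_distrib)
      qed
      have "K * s0\<^sup>2 * ((1/4) ^ j / 4) \<le> K * s0\<^sup>2 * ((1/4) ^ j - (1/4) ^ Suc j)"
        using K(1) by (intro mult_left_mono) auto
      then show "K * s0\<^sup>2 * (1 - (1/4) ^ j) + K * (\<sigma> (Suc j))\<^sup>2 \<le> K * s0\<^sup>2 * (1 - (1/4) ^ Suc j)"
        unfolding sq by (simp add: algebra_simps)
    qed
  qed
  have "finite_cover_cost (real d) \<delta> (cc_sphere N) (K * s0\<^sup>2 + K' * s0\<^sup>2)" if \<delta>: "\<delta> > 0" for \<delta>
  proof -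
    \<comment> \<open>Shells are removed until the remaining core is thin enough to be covered at
      its own scale within \<delta>.\<close>
    obtain j where "(1/2) ^ j < \<delta> / (2 * s0)"
      using real_arch_pow_inv[of "\<delta> / (2 * s0)" "1/2"] \<delta> bounds(2) by auto
    then have j: "2 * \<sigma> j \<le> \<delta>" using bounds(2) by (simp add: \<sigma>_def field_simps power_one_over)
    have "finite_cover_cost (real d) \<delta> ((cc_sphere N - near_abnormal (\<sigma> j)) \<union> (cc_sphere N \<inter> near_abnormal (\<sigma> j)))
        (K * s0\<^sup>2 * (1 - (1/4) ^ j) + K' * (\<sigma> j)\<^sup>2)"
      by (intro finite_cover_cost_Un shells K'(2) \<sigma> \<delta> j)
    then show ?thesis
    proof (rule finite_cover_cost_mono)
      have "K * s0\<^sup>2 * (1 - (1/4) ^ j) \<le> K * s0\<^sup>2 * 1" using K(1) by (intro mult_left_mono) auto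
      moreover have "K' * (\<sigma> j)\<^sup>2 \<le> K' * s0\<^sup>2"
        using K'(1) \<sigma>[of j] by (intro mult_left_mono power_mono) auto
      ultimately show "K * s0\<^sup>2 * (1 - (1/4) ^ j) + K' * (\<sigma> j)\<^sup>2 \<le> K * s0\<^sup>2 + K' * s0\<^sup>2" by simp
    qed blast
  qed
  then have "hausdorff_measure (real d) (cc_sphere N) \<le> ennreal (K * s0\<^sup>2 + K' * s0\<^sup>2)"
    by (rule hausdorff_measure_le_finite_cover_cost)
  then show ?thesis unfolding d_def by (rule order.strict_trans1) simp
qed

text \<open>Disposes of the part of the sphere that no chart reaches: its cost K s^2 tends to 0 with
  s.\<close>

lemma hausdorff_measure_abnormal_zero:
  assumes A: "A \<subseteq> cc_sphere N" "\<And>s. s > 0 \<Longrightarrow> A \<subseteq> near_abnormal s"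
  shows "hausdorff_measure (real (carnot_dim TYPE('n) - 1)) A = 0"
proof -
  define d where "d = carnot_dim TYPE('n) - 1"
  obtain K where K: "K > 0" "\<And>s \<delta>. 0 < s \<Longrightarrow> s \<le> s0 \<Longrightarrow> 2 * s \<le> \<delta> \<Longrightarrow>
       finite_cover_cost (real d) \<delta> (cc_sphere N \<inter> near_abnormal s) (K * s\<^sup>2)"
    unfolding d_def using near_abnormal_cover_cost by metis
  have "hausdorff_measure (real d) A \<le> ennreal e" if e: "e > 0" for e
  proof (rule hausdorff_measure_le_finite_cover_cost)
    fix \<delta> :: real assume \<delta>: "\<delta> > 0"
    define s where "s = min (min s0 (\<delta> / 2)) (sqrt (e / K))"
    have s: "0 < s" "s \<le> s0" "2 * s \<le> \<delta>" using \<delta> e K(1) bounds(2) by (auto simp: s_def)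
    have "s\<^sup>2 \<le> (sqrt (e / K))\<^sup>2" using s by (intro power_mono) (auto simp: s_def)
    then have "K * s\<^sup>2 \<le> e" using e K(1) by (simp add: field_simps)
    then show "finite_cover_cost (real d) \<delta> A e"
      using finite_cover_cost_mono[OF K(2)[OF s], of A e] A s(1) by blast
  qed
  then have "hausdorff_measure (real d) A = 0"
    by (metis ennreal_le_epsilon add.left_neutral ennreal_less_zero_iff zero_less_one le_zero_eq)
  then show ?thesis by (simp add: d_def)
qed

end

subsection \<open>Charts of the sphere\<close>

text \<open>The generator of the dilations, that is, the derivative of \<open>dil (1 + t) p\<close>
  at t = 0.\<close>

definition dil_field :: "(real^'n) \<times> (real^'n^'n) \<Rightarrow> (real^'n) \<times> (real^'n^'n)" where
  "dil_field p = (fst p, 2 *\<^sub>R snd p)"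

lemma dil_expansion: "dil (1 + t) q = q + t *\<^sub>R dil_field q + (0, t\<^sup>2 *\<^sub>R snd q)"
  by (simp add: dil_def dil_field_def prod_eq_iff power2_eq_square algebra_simps)

lemma dil_field_mem: "p \<in> G_carrier \<Longrightarrow> dil_field p \<in> G_carrier"
proof -
  assume p: "p \<in> G_carrier"
  have "snd (dil_field p) $ i $ j = - snd (dil_field p) $ j $ i" for i j
    using G_carrier_skew[OF p, of i j] by (simp add: dil_field_def)
  then show ?thesis unfolding mem_G_carrier by blast
qed

lemma norm_dil_field: "norm p \<le> norm (dil_field p)" "norm (dil_field p) \<le> 2 * norm p"
proof -
  have "(norm (dil_field p))\<^sup>2 = (norm (fst p))\<^sup>2 + 4 * (norm (snd p))\<^sup>2"
    by (simp add: dil_field_def norm_prod_def power_mult_distrib)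
  moreover have "(norm p)\<^sup>2 = (norm (fst p))\<^sup>2 + (norm (snd p))\<^sup>2" by (simp add: norm_prod_def)
  ultimately have *: "(norm p)\<^sup>2 \<le> (norm (dil_field p))\<^sup>2" "(norm (dil_field p))\<^sup>2 \<le> (2 * norm p)\<^sup>2"
    by (simp_all add: power_mult_distrib)
  show "norm p \<le> norm (dil_field p)" by (rule power2_le_imp_le[OF *(1)]) simp
  show "norm (dil_field p) \<le> 2 * norm p" by (rule power2_le_imp_le[OF *(2)]) simp
qed

lemma dil_field_diff: "dil_field p - dil_field q = dil_field (p - q)"
  by (simp add: dil_field_def scaleR_diff_right)

context sphere_setup
begin

text \<open>Moving along the dilations changes the distance from the identity at unit speed, so two
  nearby points of the sphere cannot differ mainly in the direction of the dilation field.\<close>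

lemma sphere_transversal:
  assumes s: "0 < s" "s \<le> s0"
  obtains r \<kappa> where "r > 0" "\<kappa> > 0"
    "\<And>p q q' t e. p \<in> cc_sphere N - near_abnormal s \<Longrightarrow> q \<in> cc_sphere N - near_abnormal s \<Longrightarrow>
       q' \<in> cc_sphere N - near_abnormal s \<Longrightarrow> dist p q \<le> r \<Longrightarrow> dist p q' \<le> r \<Longrightarrow>
       q' - q = t *\<^sub>R dil_field p + e \<Longrightarrow> norm (t *\<^sub>R dil_field p) \<le> norm (q' - q) \<Longrightarrow>
       dist q q' \<le> \<kappa> * norm e"
proof -
  \<comment> \<open>A lower bound for the norm of p, hence for the dilation field at p: points
    closer to the identity lie in \<open>near_abnormal s\<close>.\<close>
  define k0 where "k0 = s / (1 + (real CARD('n))\<^sup>2)"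
  have n1: "1 + (real CARD('n))\<^sup>2 > 0" by (simp add: add_pos_nonneg)
  have k0: "k0 > 0" using s n1 by (simp add: k0_def)
  define A where "A = 2 * (2 + R / k0)"
  have A: "A > 0" using bounds(1) k0 by (simp add: A_def add_pos_pos)
  \<comment> \<open>The three terms ensure that t is at most 1, that the dilate g of q lies within
    the range of the Lipschitz estimate around q', and that the error proportional to t can be
    absorbed with factor 1/2.\<close>
  define r where "r = min (k0 / 2) (min (c * s\<^sup>2 / (4 + 2 * A)) (s / (2 * C * A)))"
  have r: "r > 0" using k0 s bounds A by (simp add: r_def)
  have r1: "2 * r \<le> k0" by (simp add: r_def)
  have "r \<le> c * s\<^sup>2 / (4 + 2 * A)" by (simp add: r_def)
  then have r2: "r * (4 + 2 * A) \<le> c * s\<^sup>2" using A by (simp add: pos_le_divide_eq)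
  have "r \<le> s / (2 * C * A)" by (simp add: r_def)
  then have r3: "C * (r * A) / s \<le> 1 / 2" using A s bounds(3) by (simp add: field_simps)
  define \<kappa> where "\<kappa> = 2 * C / s * (2 * R) + 1"
  have \<kappa>: "\<kappa> > 0" using s bounds by (simp add: \<kappa>_def add_pos_pos)
  have main: "norm (q' - q) \<le> \<kappa> * norm e"
    if p: "p \<in> cc_sphere N - near_abnormal s" and q: "q \<in> cc_sphere N" "q' \<in> cc_sphere N - near_abnormal s"
      and d: "dist p q \<le> r" "dist p q' \<le> r" and eq: "q' - q = t *\<^sub>R dil_field p + e" and t0: "t \<ge> 0"
      and tn: "norm (t *\<^sub>R dil_field p) \<le> norm (q' - q)" for p q q' t e
  proof -
    have G: "p \<in> G_carrier" "q \<in> G_carrier" "q' \<in> G_carrier" and cc: "cc_norm N q = 1" "cc_norm N q' = 1"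
      using p q by (auto simp: mem_sphere)
    have "k0 \<le> norm p"
    proof (rule ccontr)
      assume "\<not> k0 \<le> norm p"
      then have "(1 + (real CARD('n))\<^sup>2) * norm p \<le> s" using n1 by (simp add: k0_def field_simps)
      then show False using near_abnormal_if_small[OF card G(1)] p by blast
    qed
    then have v: "k0 \<le> norm (dil_field p)" using norm_dil_field(1)[of p] by linarith
    have qq: "norm (q' - q) \<le> 2 * r"
      using d dist_triangle[of q' q p] by (simp add: dist_norm norm_minus_commute)
    have tk: "t * k0 \<le> 2 * r"
      using tn qq t0 mult_left_mono[OF v t0] by simp
    have "t * k0 \<le> 1 * k0" using tk r1 by linarith
    then have t1: "t \<le> 1" using k0 by (rule mult_right_le_imp_le)
    have tk': "t \<le> 2 * r / k0" using tk k0 by (simp add: field_simps)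
    \<comment> \<open>This dilate has distance exactly 1 + t from the identity, whereas q' has
      distance 1, and g differs from q' by e up to an error of order t r. The Lipschitz estimate at
      q' therefore bounds t by C |e| / s plus at most t / 2.\<close>
    define g where "g = dil (1 + t) q"
    have gG: "g \<in> G_carrier" by (simp add: g_def dil_mem_G_carrier G)
    have cg: "cc_norm N g = 1 + t" using cc_norm_dil[OF N _ G(2), of "1 + t"] t0 cc(1) by (simp add: g_def)
    have ne: "norm e \<le> 4 * r"
    proof -
      have "e = (q' - q) - t *\<^sub>R dil_field p" using eq by simp
      then show ?thesis using norm_triangle_ineq4[of "q' - q" "t *\<^sub>R dil_field p"] tn qq by simp
    qed
    have diff: "g - q' = - e + (t *\<^sub>R dil_field (q - p) + (0, t\<^sup>2 *\<^sub>R snd q))"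
    proof -
      have "q' = q + (t *\<^sub>R dil_field p + e)" using eq by (simp add: algebra_simps)
      then show ?thesis
        by (simp add: g_def dil_expansion dil_field_diff[symmetric] scaleR_diff_right)
    qed
    have n2: "norm (t *\<^sub>R dil_field (q - p)) \<le> t * (2 * r)"
      using norm_dil_field(2)[of "q - p"] d(1) t0
      by (simp add: dist_norm norm_minus_commute mult_left_mono)
    have n3: "norm ((0, t\<^sup>2 *\<^sub>R snd q) :: (real^'n) \<times> (real^'n^'n)) \<le> t * (2 * r / k0 * R)"
    proof -
      have "norm (snd q) \<le> R"
        using sphere_norm_le[OF q(1)] norm_snd_le[of "snd q" "fst q"] by simp
      then have "t * norm (snd q) \<le> 2 * r / k0 * R" using tk' t0 by (intro mult_mono) auto
      then have "t * (t * norm (snd q)) \<le> t * (2 * r / k0 * R)" using t0 by (rule mult_left_mono)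
      moreover have "norm ((0, y) :: (real^'n) \<times> (real^'n^'n)) = norm y" for y
        by (simp add: norm_prod_def)
      ultimately show ?thesis by (simp add: power2_eq_square mult.assoc abs_mult t0)
    qed
    have "norm (g - q') \<le> norm e + (t * (2 * r) + t * (2 * r / k0 * R))"
      unfolding diff using n2 n3
        norm_triangle_ineq[of "- e" "t *\<^sub>R dil_field (q - p) + (0, t\<^sup>2 *\<^sub>R snd q)"]
        norm_triangle_ineq[of "t *\<^sub>R dil_field (q - p)" "(0, t\<^sup>2 *\<^sub>R snd q)"] by simp
    also have "\<dots> \<le> norm e + t * (r * A)"
    proof -
      have "t * (2 * r) + t * (2 * r / k0 * R) = t * r * (2 + 2 * (R / k0))" by (simp add: algebra_simps)
      also have "\<dots> \<le> t * r * A" unfolding A_def using t0 r by (intro mult_left_mono) auto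
      finally show ?thesis by (simp add: mult.assoc)
    qed
    finally have gq: "norm (g - q') \<le> norm e + t * (r * A)" .
    have "t * (r * A) \<le> 1 * (r * A)" using t1 r A by (intro mult_right_mono) auto
    then have "norm (g - q') \<le> r * (4 + 2 * A)" using gq ne mult_pos_pos[OF r A] by (simp add: algebra_simps)
    then have "norm (g - q') \<le> c * s\<^sup>2" using r2 by linarith
    then have "cc_norm N g \<le> cc_norm N q' + C * norm (g - q') / s"
      using G gG cc q s by (intro increment) auto
    then have "t \<le> C * norm (g - q') / s" using cg cc by simp
    also have "\<dots> \<le> C * (norm e + t * (r * A)) / s"
      using gq bounds(3) s by (intro divide_right_mono mult_left_mono) auto
    also have "\<dots> = C / s * norm e + t * (C * (r * A) / s)" by (simp add: algebra_simps add_divide_distrib)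
    also have "t * (C * (r * A) / s) \<le> t * (1 / 2)" using r3 t0 by (rule mult_left_mono)
    finally have t: "t \<le> 2 * C / s * norm e" by simp
    have "norm (q' - q) \<le> t * norm (dil_field p) + norm e"
      unfolding eq using norm_triangle_ineq[of "t *\<^sub>R dil_field p" e] t0 by simp
    also have "t * norm (dil_field p) \<le> (2 * C / s * norm e) * (2 * R)"
    proof (rule mult_mono[OF t])
      have "norm p \<le> R" using p sphere_norm_le by blast
      then show "norm (dil_field p) \<le> 2 * R" using norm_dil_field(2)[of p] by linarith
    qed (use s bounds in auto)
    finally show ?thesis by (simp add: \<kappa>_def algebra_simps)
  qed
  have "dist q q' \<le> \<kappa> * norm e"
    if p: "p \<in> cc_sphere N - near_abnormal s" and q: "q \<in> cc_sphere N - near_abnormal s"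
      and q': "q' \<in> cc_sphere N - near_abnormal s"
      and d: "dist p q \<le> r" "dist p q' \<le> r" and eq: "q' - q = t *\<^sub>R dil_field p + e"
      and tn: "norm (t *\<^sub>R dil_field p) \<le> norm (q' - q)" for p q q' t e
  proof (cases "t \<ge> 0")
    case True
    then show ?thesis using main[OF p _ q' d eq True tn] q by (simp add: dist_norm norm_minus_commute)
  next
    \<comment> \<open>For negative t the roles of q and q' are exchanged.\<close>
    case False
    have eq': "q - q' = (- t) *\<^sub>R dil_field p + (- e)" using eq by (simp add: algebra_simps)
    have "norm ((- t) *\<^sub>R dil_field p) \<le> norm (q - q')" using tn by (simp add: norm_minus_commute)
    then have "norm (q - q') \<le> \<kappa> * norm (- e)"
      using q' False by (intro main[OF p _ q d(2,1) eq']) auto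
    then show ?thesis by (simp add: dist_norm)
  qed
  then show ?thesis using that r \<kappa> by blast
qed

text \<open>By transversality, the orthogonal projection along the dilation field at p is injective
  on the sphere near p, with Lipschitz inverse; that inverse is the chart. The radius r depends on s
  but not on p.\<close>

lemma sphere_chart:
  assumes k: "DIM('k::euclidean_space) = carnot_dim TYPE('n) - 1"
    and s: "0 < s" "s \<le> s0"
  obtains r where "r > 0" "\<And>p. p \<in> cc_sphere N - near_abnormal s \<Longrightarrow>
    \<exists>E (f :: 'k \<Rightarrow> (real^'n) \<times> (real^'n^'n)). closed E \<and> (\<exists>L. L-lipschitz_on E f) \<and> f ` E \<subseteq> G_carrier \<and>
      (cc_sphere N - near_abnormal s) \<inter> ball p r \<subseteq> f ` E"
proof -
  obtain r \<kappa> where r: "r > 0" and \<kappa>: "\<kappa> > 0"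
    and tr: "\<And>p q q' t e. p \<in> cc_sphere N - near_abnormal s \<Longrightarrow> q \<in> cc_sphere N - near_abnormal s \<Longrightarrow>
       q' \<in> cc_sphere N - near_abnormal s \<Longrightarrow> dist p q \<le> r \<Longrightarrow> dist p q' \<le> r \<Longrightarrow>
       q' - q = t *\<^sub>R dil_field p + e \<Longrightarrow> norm (t *\<^sub>R dil_field p) \<le> norm (q' - q) \<Longrightarrow>
       dist q q' \<le> \<kappa> * norm e"
    using sphere_transversal[OF s] by metis
  have "\<exists>E (f :: 'k \<Rightarrow> (real^'n) \<times> (real^'n^'n)). closed E \<and> (\<exists>L. L-lipschitz_on E f) \<and> f ` E \<subseteq> G_carrier \<and>
      (cc_sphere N - near_abnormal s) \<inter> ball p r \<subseteq> f ` E"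
    if p: "p \<in> cc_sphere N - near_abnormal s" for p
  proof -
    define v where "v = dil_field p"
    define T where "T = (cc_sphere N - near_abnormal s) \<inter> ball p r"
    have pG: "p \<in> G_carrier" using p by (simp add: mem_sphere)
    have TG: "T \<subseteq> G_carrier" by (auto simp: T_def mem_sphere)
    have vG: "v \<in> G_carrier" by (simp add: v_def dil_field_mem pG)
    have "p \<noteq> 0"
      using near_abnormal_if_small[OF card pG, of s] p s by auto
    then have v0: "v \<noteq> 0" using norm_dil_field(1)[of p] by (auto simp: v_def)
    define W where "W = {y \<in> G_carrier. \<forall>x\<in>span {v}. orthogonal x y}"
    have "span {v} \<subseteq> G_carrier" using vG by (intro span_minimal subspace_G_carrier) auto
    then have "dim W + dim (span {v}) = dim (G_carrier :: ((real^'n) \<times> (real^'n^'n)) set)"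
      unfolding W_def by (intro dim_subspace_orthogonal_to_vectors subspace_span subspace_G_carrier)
    moreover have "dim (span {v}) = 1" using v0 by (simp add: dim_span dim_singleton)
    ultimately have dimW: "dim W \<le> dim (UNIV :: 'k set)"
      using dim_G_carrier_le[where 'n = 'n] k by (simp add: dim_UNIV)
    have subW: "subspace W"
      unfolding W_def
      by (intro subspaceI)
         (simp_all add: subspace_0 subspace_add subspace_scale subspace_G_carrier orthogonal_def inner_add_right)
    obtain f :: "_ \<Rightarrow> 'k" where f: "linear f" "\<And>x. x \<in> W \<Longrightarrow> norm (f x) = norm x"
      using isometry_subset_subspace[OF subW subspace_UNIV dimW] by metis
    define \<tau> where "\<tau> = (\<lambda>x. inner v x / inner v v)"
    define h where "h = (\<lambda>x. f (x - \<tau> x *\<^sub>R v))"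
    have hd: "norm (h x - h y) = norm ((x - y) - \<tau> (x - y) *\<^sub>R v)" if "x \<in> G_carrier" "y \<in> G_carrier" for x y
    proof -
      have "h x - h y = f ((x - \<tau> x *\<^sub>R v) - (y - \<tau> y *\<^sub>R v))"
        unfolding h_def by (simp add: linear_diff[OF f(1)])
      also have "(x - \<tau> x *\<^sub>R v) - (y - \<tau> y *\<^sub>R v) = (x - y) - \<tau> (x - y) *\<^sub>R v"
        by (simp add: \<tau>_def inner_diff_right diff_divide_distrib scaleR_diff_left)
      also have "norm (f \<dots>) = norm \<dots>"
      proof (rule f(2))
        have "(x - y) - \<tau> (x - y) *\<^sub>R v \<in> G_carrier"
          by (intro subspace_diff subspace_scale subspace_G_carrier that vG)
        moreover have "orthogonal z ((x - y) - \<tau> (x - y) *\<^sub>R v)" if "z \<in> span {v}" for z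
        proof -
          obtain b where z: "z = b *\<^sub>R v" using \<open>z \<in> span {v}\<close> by (auto simp: span_singleton)
          have "inner v ((x - y) - \<tau> (x - y) *\<^sub>R v) = 0"
            using v0 by (simp add: \<tau>_def inner_diff_right)
          then show ?thesis unfolding orthogonal_def z inner_scaleR_left by (simp only: mult_zero_right)
        qed
        ultimately show "(x - y) - \<tau> (x - y) *\<^sub>R v \<in> W" by (simp add: W_def)
      qed
      finally show ?thesis .
    qed
    have lower: "dist x y \<le> \<kappa> * dist (h x) (h y)" if x: "x \<in> T" and y: "y \<in> T" for x y
    proof -
      have "dist x y \<le> \<kappa> * norm ((y - x) - \<tau> (y - x) *\<^sub>R v)"
      proof (rule tr[OF p])
        show "y - x = \<tau> (y - x) *\<^sub>R dil_field p + ((y - x) - \<tau> (y - x) *\<^sub>R v)" by (simp add: v_def)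
        have "\<bar>inner v (y - x)\<bar> \<le> norm v * norm (y - x)" by (rule Cauchy_Schwarz_ineq2)
        then show "norm (\<tau> (y - x) *\<^sub>R dil_field p) \<le> norm (y - x)"
          using v0 by (simp add: \<tau>_def v_def[symmetric] power2_norm_eq_inner[symmetric] power2_eq_square field_simps)
      qed (use x y in \<open>auto simp: T_def\<close>)
      moreover have "norm (h y - h x) = norm ((y - x) - \<tau> (y - x) *\<^sub>R v)"
        using x y TG by (intro hd) auto
      ultimately show ?thesis by (simp add: dist_norm norm_minus_commute)
    qed
    define g where "g = inv_into T h"
    have inj: "inj_on h T" using lower by (intro inj_onI) force
    have "\<kappa>-lipschitz_on (h ` T) g"
      using lower \<kappa> inj by (intro lipschitz_onI) (auto simp: g_def)
    \<comment> \<open>Extension to the closure makes the domain closed, hence Lebesgue measurable;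
      the values stay in the closed subspace \<open>G_carrier\<close>.\<close>
    then obtain F where F: "\<kappa>-lipschitz_on (closure (h ` T)) F" "\<And>x. x \<in> h ` T \<Longrightarrow> F x = g x"
      using lipschitz_extend_closure by metis
    have FT: "F (h x) = x" if "x \<in> T" for x using F(2) that inj by (simp add: g_def)
    have "F ` closure (h ` T) \<subseteq> closure (F ` (h ` T))"
      by (rule continuous_image_closure_subset[OF lipschitz_on_continuous_on[OF F(1)] subset_refl])
    also have "F ` (h ` T) \<subseteq> G_carrier" using FT TG by auto
    then have "closure (F ` (h ` T)) \<subseteq> G_carrier"
      by (intro closure_minimal closed_subspace subspace_G_carrier)
    finally have "F ` closure (h ` T) \<subseteq> G_carrier" .
    moreover have "T \<subseteq> F ` closure (h ` T)"
      using FT closure_subset by (metis (no_types, lifting) image_eqI imageI subsetD subsetI)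
    ultimately show ?thesis
      using F(1) unfolding T_def[symmetric] by (intro exI[of _ "closure (h ` T)"] exI[of _ F]) auto
  qed
  then show ?thesis using that r by blast
qed

text \<open>For each m, Lindelof's theorem leaves countably many charts for the points outside
  \<open>near_abnormal (1 / real (Suc m))\<close>. A point missed for every m lies in all
  neighbourhoods of the abnormal set.\<close>

lemma sphere_rectifiable:
  assumes k: "DIM('k::euclidean_space) = carnot_dim TYPE('n) - 1"
  shows "euclid_rectifiable TYPE('k) G_carrier (cc_sphere N)"
proof -
  define good where "good = (\<lambda>(E :: 'k set, f :: 'k \<Rightarrow> (real^'n) \<times> (real^'n^'n)).
    closed E \<and> (\<exists>L. L-lipschitz_on E f) \<and> f ` E \<subseteq> G_carrier)"
  have "\<exists>\<F>. countable \<F> \<and> (\<forall>x\<in>\<F>. good x) \<and>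
      cc_sphere N - near_abnormal (1 / real (Suc m)) \<subseteq> (\<Union>(E, f)\<in>\<F>. f ` E)" for m
  proof -
    define T where "T = cc_sphere N - near_abnormal (1 / real (Suc m))"
    have m: "0 < 1 / real (Suc m)" "1 / real (Suc m) \<le> s0"
      using bounds(2) order_trans[of "1 / real (Suc m)" 1 s0] by auto
    obtain r where r: "r > 0" "\<And>p. p \<in> T \<Longrightarrow> \<exists>E (f :: 'k \<Rightarrow> _). closed E \<and> (\<exists>L. L-lipschitz_on E f) \<and>
        f ` E \<subseteq> G_carrier \<and> T \<inter> ball p r \<subseteq> f ` E"
      using sphere_chart[OF k m] unfolding T_def by metis
    then have "\<forall>p\<in>T. \<exists>x. good x \<and> T \<inter> ball p r \<subseteq> snd x ` fst x"
      unfolding good_def by fastforce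
    then obtain ch where ch: "\<And>p. p \<in> T \<Longrightarrow> good (ch p)" "\<And>p. p \<in> T \<Longrightarrow> T \<inter> ball p r \<subseteq> snd (ch p) ` fst (ch p)"
      by metis
    obtain B where B: "B \<subseteq> (\<lambda>p. ball p r) ` T" "countable B" "\<Union>B = (\<Union>p\<in>T. ball p r)"
      using Lindelof[of "(\<lambda>p. ball p r) ` T"] by auto
    obtain Q where Q: "countable Q" "Q \<subseteq> T" "B = (\<lambda>p. ball p r) ` Q"
      using B(1,2) countable_subset_image by metis
    have "T \<subseteq> (\<Union>(E, f)\<in>ch ` Q. f ` E)"
    proof
      fix x assume x: "x \<in> T"
      then have "x \<in> \<Union>B" unfolding B(3) using r(1) centre_in_ball by blast
      then obtain p where "p \<in> Q" "x \<in> ball p r" using Q(3) by auto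
      then have "x \<in> snd (ch p) ` fst (ch p)" using ch(2)[of p] Q(2) x by blast
      then show "x \<in> (\<Union>(E, f)\<in>ch ` Q. f ` E)"
        using \<open>p \<in> Q\<close> unfolding case_prod_beta by blast
    qed
    then show ?thesis
      unfolding T_def using Q ch(1) by (intro exI[of _ "ch ` Q"]) auto
  qed
  then obtain \<F> where \<F>: "\<And>m. countable (\<F> m)" "\<And>m x. x \<in> \<F> m \<Longrightarrow> good x"
    "\<And>m. cc_sphere N - near_abnormal (1 / real (Suc m)) \<subseteq> (\<Union>(E, f)\<in>\<F> m. f ` E)"
    by metis
  \<comment> \<open>The empty chart makes the family nonempty, as an enumeration by the natural
    numbers requires.\<close>
  define \<H> where "\<H> = insert ({}, \<lambda>_. 0) (\<Union>m. \<F> m)"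
  have goodH: "good x" if "x \<in> \<H>" for x
  proof -
    have "0-lipschitz_on {} (\<lambda>_ :: 'k. 0 :: (real^'n) \<times> (real^'n^'n))" by (simp add: lipschitz_on_def)
    then have "good ({}, \<lambda>_. 0)" by (auto simp: good_def)
    then show ?thesis using that \<F>(2) unfolding \<H>_def by blast
  qed
  have cH: "countable \<H>" "\<H> \<noteq> {}" using \<F>(1) by (auto simp: \<H>_def)
  define E where "E = (\<lambda>j. fst (from_nat_into \<H> j))"
  define f where "f = (\<lambda>j. snd (from_nat_into \<H> j))"
  have Ef: "good (E j, f j)" for j
    using goodH from_nat_into[OF cH(2), of j] by (simp add: E_def f_def)
  have U: "(\<Union>j. f j ` E j) = (\<Union>x\<in>\<H>. snd x ` fst x)"
  proof -
    have "(\<Union>j. f j ` E j) = (\<Union>x\<in>range (from_nat_into \<H>). snd x ` fst x)"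
      unfolding E_def f_def by blast
    then show ?thesis unfolding range_from_nat_into[OF cH(2,1)] .
  qed
  have null: "cc_sphere N - (\<Union>j. f j ` E j) \<subseteq> near_abnormal s" if s: "s > 0" for s
  proof -
    obtain m where m: "1 / real (Suc m) < s" using nat_approx_posE[OF s] by auto
    have "cc_sphere N - near_abnormal (1 / real (Suc m)) \<subseteq> (\<Union>j. f j ` E j)"
      unfolding U \<H>_def using \<F>(3)[of m] by (fastforce simp: case_prod_beta)
    then show ?thesis using near_abnormal_mono[of "1 / real (Suc m)" s] m by auto
  qed
  have "hausdorff_measure (real DIM('k)) (cc_sphere N - (\<Union>j. f j ` E j)) = 0"
    unfolding k by (rule hausdorff_measure_abnormal_zero) (use null in auto)
  moreover have "hausdorff_measure (real DIM('k)) (cc_sphere N) < \<infinity>"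
    unfolding k by (rule hausdorff_measure_sphere_finite)
  moreover have "E j \<in> sets lebesgue \<and> (\<exists>L. L-lipschitz_on (E j) (f j)) \<and> f j ` E j \<subseteq> G_carrier" for j
    using Ef[of j] by (auto simp: good_def)
  ultimately show ?thesis unfolding euclid_rectifiable_def by blast
qed

end

theorem mainTheorem1:
  fixes N :: "real^'n \<Rightarrow> real"
  assumes "CARD('n) \<ge> 2"
    and "is_norm N"
    and "CARD('k::finite) = CARD('n) + (CARD('n) choose 2) - 1"
  shows "euclid_rectifiable TYPE(real^'k) (G_carrier :: ((real^'n) \<times> (real^'n^'n)) set) (cc_sphere N)"
proof -
  obtain R s0 C c where "sphere_setup N R s0 C c"
    using sphere_setup_exists[OF assms(2,1)] by blast
  then show ?thesis
    by (rule sphere_setup.sphere_rectifiable) (use assms(3) in simp)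
qed

end
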